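(* For all $P_1,P_2,N>0$ and every $2\times 2$ positive semidefinite matrix $\mathsf{K}_W$, $$\mathcal{C}_{\mathrm{NoisyFB}}(P_1,P_2,N,\mathsf{K}_W)\supseteq \mathcal{R}(P_1,P_2,N,\mathsf{K}_W).$$
   Context: Channel model (noisy feedback). Fix $P_1,P_2,N>0$ and a $2\times 2$ positive semidefinite matrix $\mathsf{K}_W=\begin{pmatrix}\sigma_1^2&\varrho\sigma_1\sigma_2\\ \varrho\sigma_1\sigma_2&\sigma_2^2\end{pmatrix}$ with $\sigma_1,\sigma_2\ge 0$, $\varrho\in[-1,1]$. Messages $M_1,M_2$ are independent and uniform on finite sets $\mathcal{M}_1,\mathcal{M}_2$. $\{Z_t\}$ is IID $\mathcal{N}(0,N)$, $\{(W_{1,t},W_{2,t})\}$ is IID zero-mean bivariate Gaussian with covariance $\mathsf{K}_W$, and $M_1,M_2,\{Z_t\},\{(W_{1,t},W_{2,t})\}$ are mutually independent. The output is $Y_t=X_{1,t}+X_{2,t}+Z_t$ and Transmitter $\nu\in\{1,2\}$ observes causally the feedback $V_{\nu,t}=Y_t+W_{\nu,t}$. A blocklength-$n$ code consists of encoders $X_{\nu,t}=\varphi_{\nu,t}(M_\nu,V_{\nu,1},\dots,V_{\nu,t-1})$, $t=1,\dots,n$, satisfying $\frac1n\sum_{t=1}^n\mathbb{E}[X_{\nu,t}^2]\le P_\nu$ ($\nu=1,2$), and a decoder $\phi:\mathbb{R}^n\to\mathcal{M}_1\times\mathcal{M}_2$. A pair $(R_1,R_2)$ is achievable if for every $\delta>0$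 and all sufficiently large $n$ there is such a code with $\frac1n\log|\mathcal{M}_\nu|>R_\nu-\delta$ ($\nu=1,2$), and the error probabilities $\Pr[\phi(Y_1,\dots,Y_n)\ne(M_1,M_2)]$ tend to $0$ as $n\to\infty$. $\mathcal{C}_{\mathrm{NoisyFB}}(P_1,P_2,N,\mathsf{K}_W)$ is the set of achievable pairs. Region $\mathcal{R}$. For a positive integer $\eta$, vectors $\mathbf a_1,\mathbf a_2\in\mathbb{R}^\eta$, strictly lower-triangular $\mathsf B_1,\mathsf B_2\in\mathbb{R}^{\eta\times\eta}$ and $\mathsf C\in\mathbb{R}^{2\times\eta}$, let $\mathsf A=(\mathbf a_1\ \mathbf a_2)\in\mathbb{R}^{\eta\times2}$ and $\mathsf Q=N\mathsf I_\eta+\sigma_1^2\mathsf B_1\mathsf B_1^{\mathsf T}+\sigma_2^2\mathsf B_2\mathsf B_2^{\mathsf T}+\varrho\sigma_1\sigma_2(\mathsf B_1\mathsf B_2^{\mathsf T}+\mathsf B_2\mathsf B_1^{\mathsf T})$ (this equals $N\mathsf I_\eta+(\mathsf B_1\ \mathsf B_2)(\mathsf K_W\otimes \mathsf I_\eta)(\mathsf B_1\ \mathsf B_2)^{\mathsf T}$). If $\mathsf C\mathsf C^{\mathsf T}$ is nonsingular, $\mathcal{R}_\eta^{N,\mathsf K_W}(\mathbf a_1,\mathbf a_2,\mathsf B_1,\mathsf B_2,\mathsf C)$ is the set of nonnegative $(R_1,R_2)$ with $R_1\le\frac{1}{2\eta}\log\frac{\det(\mathsf C(\mathbf a_1\mathbf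 a_1^{\mathsf T}+\mathsf Q)\mathsf C^{\mathsf T})}{\det(\mathsf C\mathsf Q\mathsf C^{\mathsf T})}$, $R_2\le\frac{1}{2\eta}\log\frac{\det(\mathsf C(\mathbf a_2\mathbf a_2^{\mathsf T}+\mathsf Q)\mathsf C^{\mathsf T})}{\det(\mathsf C\mathsf Q\mathsf C^{\mathsf T})}$, $R_1+R_2\le\frac{1}{2\eta}\log\frac{\det(\mathsf C(\mathsf A\mathsf A^{\mathsf T}+\mathsf Q)\mathsf C^{\mathsf T})}{\det(\mathsf C\mathsf Q\mathsf C^{\mathsf T})}$; if $\mathsf C\mathsf C^{\mathsf T}$ is singular but $\mathsf C\neq 0$, the same definition with $\mathsf C$ replaced by any nonzero row of $\mathsf C$; if $\mathsf C=0$, the set $\{(0,0)\}$. Power constraints: let $\mathbb B=\begin{pmatrix}\mathsf B_1&\mathsf B_1\\ \mathsf B_2&\mathsf B_2\end{pmatrix}$, $\mathsf A_d=\begin{pmatrix}\mathbf a_1&\mathbf 0\\ \mathbf 0&\mathbf a_2\end{pmatrix}$, $\mathsf B_t=\begin{pmatrix}\mathsf B_1\\ \mathsf B_2\end{pmatrix}$, $\mathsf B_d=\begin{pmatrix}\mathsf B_1&0\\0&\mathsf B_2\end{pmatrix}$, $\mathsf K_W\otimes\mathsf I_\eta=\begin{pmatrix}\sigma_1^2\mathsf I_\eta&\varrho\sigma_1\sigma_2\mathsf I_\eta\\ \varrho\sigma_1\sigma_2\mathsf I_\eta&\sigma_2^2\mathsf I_\eta\end{pmatrix}$, and $\Sigma=(\mathsf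 I_{2\eta}-\mathbb B)^{-1}(\mathsf A_d\mathsf A_d^{\mathsf T}+N\mathsf B_t\mathsf B_t^{\mathsf T}+\mathsf B_d(\mathsf K_W\otimes\mathsf I_\eta)\mathsf B_d^{\mathsf T})(\mathsf I_{2\eta}-\mathbb B)^{-\mathsf T}$; require the trace of the upper-left $\eta\times\eta$ block of $\Sigma$ to be $\le\eta P_1$ and the trace of the lower-right $\eta\times\eta$ block to be $\le \eta P_2$. Then $\mathcal{R}(P_1,P_2,N,\mathsf K_W)$ is the closure of the union of $\mathcal{R}_\eta^{N,\mathsf K_W}(\mathbf a_1,\mathbf a_2,\mathsf B_1,\mathsf B_2,\mathsf C)$ over all $(\eta,\mathbf a_1,\mathbf a_2,\mathsf B_1,\mathsf B_2,\mathsf C)$ satisfying the power constraints. *)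

theory Defs
  imports "HOL-Probability.Probability" "Jordan_Normal_Form.Gauss_Jordan_Elimination"
          "Jordan_Normal_Form.Determinant"
begin

text \<open>Time indices are 0,...,n-1. The standard Gaussian law on the reals.\<close>
definition std_gauss :: "real measure" where
  "std_gauss = density lborel std_normal_density"

text \<open>Joint law of one noise triple (Z_t, W_{1,t}, W_{2,t}): Z_t ~ N(0,N) independent of
 (W_1,W_2) ~ N(0,K_W) with K_W = [[s1^2, r s1 s2],[r s1 s2, s2^2]] (built from IID
 standard Gaussians).\<close>
definition noise_law :: "real \<Rightarrow> real \<Rightarrow> real \<Rightarrow> real \<Rightarrow> (real \<times> real \<times> real) measure" where
  "noise_law N s1 s2 r =
     distr (std_gauss \<Otimes>\<^sub>M std_gauss \<Otimes>\<^sub>M std_gauss) borel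
       (\<lambda>(a, b, c). (sqrt N * a, s1 * b, s2 * (r * b + sqrt (1 - r\<^sup>2) * c)))"

definition chan_space :: "real \<Rightarrow> real \<Rightarrow> real \<Rightarrow> real \<Rightarrow> nat \<Rightarrow> nat \<Rightarrow> nat
     \<Rightarrow> ((nat \<times> nat) \<times> (nat \<Rightarrow> real \<times> real \<times> real)) measure" where
  "chan_space N s1 s2 r n k1 k2 =
     measure_pmf (pmf_of_set ({..<k1} \<times> {..<k2})) \<Otimes>\<^sub>M PiM {..<n} (\<lambda>_. noise_law N s1 s2 r)"

definition fb_past :: "real list \<Rightarrow> (nat \<Rightarrow> real) \<Rightarrow> nat \<Rightarrow> (nat \<Rightarrow> real)" where
  "fb_past ys w t = restrict (\<lambda>s. ys ! s + w s) {..<t}"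

text \<open>Encoders: f t m v gives X_t from the message m and the past feedback v (a function on {..<t}).
 out_seq returns the list of outputs Y_0,...,Y_{t-1}.\<close>
fun out_seq :: "(nat \<Rightarrow> nat \<Rightarrow> (nat \<Rightarrow> real) \<Rightarrow> real) \<Rightarrow> (nat \<Rightarrow> nat \<Rightarrow> (nat \<Rightarrow> real) \<Rightarrow> real)
    \<Rightarrow> nat \<Rightarrow> nat \<Rightarrow> (nat \<Rightarrow> real) \<Rightarrow> (nat \<Rightarrow> real) \<Rightarrow> (nat \<Rightarrow> real) \<Rightarrow> nat \<Rightarrow> real list" where
  "out_seq f1 f2 m1 m2 z w1 w2 0 = []"
| "out_seq f1 f2 m1 m2 z w1 w2 (Suc t) =
     (let ys = out_seq f1 f2 m1 m2 z w1 w2 t in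
      ys @ [f1 t m1 (fb_past ys w1 t) + f2 t m2 (fb_past ys w2 t) + z t])"

definition noiseZ :: "(nat \<Rightarrow> real \<times> real \<times> real) \<Rightarrow> nat \<Rightarrow> real" where
  "noiseZ g t = fst (g t)"
definition noiseW1 :: "(nat \<Rightarrow> real \<times> real \<times> real) \<Rightarrow> nat \<Rightarrow> real" where
  "noiseW1 g t = fst (snd (g t))"
definition noiseW2 :: "(nat \<Rightarrow> real \<times> real \<times> real) \<Rightarrow> nat \<Rightarrow> real" where
  "noiseW2 g t = snd (snd (g t))"

definition chanX1 where
  "chanX1 f1 f2 t \<omega> = (case \<omega> of ((m1, m2), g) \<Rightarrow>
     f1 t m1 (fb_past (out_seq f1 f2 m1 m2 (noiseZ g) (noiseW1 g) (noiseW2 g) t) (noiseW1 g) t))"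
definition chanX2 where
  "chanX2 f1 f2 t \<omega> = (case \<omega> of ((m1, m2), g) \<Rightarrow>
     f2 t m2 (fb_past (out_seq f1 f2 m1 m2 (noiseZ g) (noiseW1 g) (noiseW2 g) t) (noiseW2 g) t))"
definition chanY :: "_ \<Rightarrow> _ \<Rightarrow> nat \<Rightarrow> (nat \<times> nat) \<times> (nat \<Rightarrow> real \<times> real \<times> real) \<Rightarrow> (nat \<Rightarrow> real)" where
  "chanY f1 f2 n \<omega> = (case \<omega> of ((m1, m2), g) \<Rightarrow>
     restrict (\<lambda>s. out_seq f1 f2 m1 m2 (noiseZ g) (noiseW1 g) (noiseW2 g) n ! s) {..<n})"

definition is_code :: "real \<Rightarrow> real \<Rightarrow> real \<Rightarrow> real \<Rightarrow> real \<Rightarrow> real \<Rightarrow> nat \<Rightarrow> nat \<Rightarrow> nat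
    \<Rightarrow> (nat \<Rightarrow> nat \<Rightarrow> (nat \<Rightarrow> real) \<Rightarrow> real) \<Rightarrow> (nat \<Rightarrow> nat \<Rightarrow> (nat \<Rightarrow> real) \<Rightarrow> real)
    \<Rightarrow> ((nat \<Rightarrow> real) \<Rightarrow> nat \<times> nat) \<Rightarrow> bool" where
  "is_code P1 P2 N s1 s2 r n k1 k2 f1 f2 dec \<longleftrightarrow>
     1 \<le> k1 \<and> 1 \<le> k2 \<and>
     (\<forall>t<n. \<forall>m. f1 t m \<in> borel_measurable (PiM {..<t} (\<lambda>_. borel))) \<and>
     (\<forall>t<n. \<forall>m. f2 t m \<in> borel_measurable (PiM {..<t} (\<lambda>_. borel))) \<and>
     dec \<in> PiM {..<n} (\<lambda>_. borel) \<rightarrow>\<^sub>M count_space UNIV \<and>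
     (\<Sum>t<n. \<integral>\<^sup>+ \<omega>. ennreal ((chanX1 f1 f2 t \<omega>)\<^sup>2) \<partial>chan_space N s1 s2 r n k1 k2)
        \<le> ennreal (real n * P1) \<and>
     (\<Sum>t<n. \<integral>\<^sup>+ \<omega>. ennreal ((chanX2 f1 f2 t \<omega>)\<^sup>2) \<partial>chan_space N s1 s2 r n k1 k2)
        \<le> ennreal (real n * P2)"

definition err_prob :: "real \<Rightarrow> real \<Rightarrow> real \<Rightarrow> real \<Rightarrow> nat \<Rightarrow> nat \<Rightarrow> nat
    \<Rightarrow> (nat \<Rightarrow> nat \<Rightarrow> (nat \<Rightarrow> real) \<Rightarrow> real) \<Rightarrow> (nat \<Rightarrow> nat \<Rightarrow> (nat \<Rightarrow> real) \<Rightarrow> real)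
    \<Rightarrow> ((nat \<Rightarrow> real) \<Rightarrow> nat \<times> nat) \<Rightarrow> real" where
  "err_prob N s1 s2 r n k1 k2 f1 f2 dec =
     measure (chan_space N s1 s2 r n k1 k2)
       {\<omega> \<in> space (chan_space N s1 s2 r n k1 k2). dec (chanY f1 f2 n \<omega>) \<noteq> fst \<omega>}"

definition C_NoisyFB :: "real \<Rightarrow> real \<Rightarrow> real \<Rightarrow> real \<Rightarrow> real \<Rightarrow> real \<Rightarrow> (real \<times> real) set" where
  "C_NoisyFB P1 P2 N s1 s2 r = {(R1, R2). \<forall>\<delta>>0.
     \<exists>k1 k2 :: nat \<Rightarrow> nat. \<exists>f1 f2 :: nat \<Rightarrow> nat \<Rightarrow> nat \<Rightarrow> (nat \<Rightarrow> real) \<Rightarrow> real.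
     \<exists>dec :: nat \<Rightarrow> (nat \<Rightarrow> real) \<Rightarrow> nat \<times> nat. \<exists>n0.
       (\<forall>n\<ge>n0. is_code P1 P2 N s1 s2 r n (k1 n) (k2 n) (f1 n) (f2 n) (dec n) \<and>
                ln (real (k1 n)) / real n > R1 - \<delta> \<and> ln (real (k2 n)) / real n > R2 - \<delta>) \<and>
       (\<lambda>n. err_prob N s1 s2 r n (k1 n) (k2 n) (f1 n) (f2 n) (dec n)) \<longlonglongrightarrow> 0}"

definition strictly_lower :: "nat \<Rightarrow> real mat \<Rightarrow> bool" where
  "strictly_lower \<eta> B \<longleftrightarrow> B \<in> carrier_mat \<eta> \<eta> \<and> (\<forall>i<\<eta>. \<forall>j<\<eta>. i \<le> j \<longrightarrow> B $$ (i, j) = 0)"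

definition colmat :: "real vec \<Rightarrow> real mat" where
  "colmat a = mat (dim_vec a) 1 (\<lambda>(i, _). a $ i)"

definition Qmat :: "nat \<Rightarrow> real \<Rightarrow> real \<Rightarrow> real \<Rightarrow> real \<Rightarrow> real mat \<Rightarrow> real mat \<Rightarrow> real mat" where
  "Qmat \<eta> N s1 s2 r B1 B2 =
     N \<cdot>\<^sub>m 1\<^sub>m \<eta> + (s1\<^sup>2) \<cdot>\<^sub>m (B1 * B1\<^sup>T) + (s2\<^sup>2) \<cdot>\<^sub>m (B2 * B2\<^sup>T)
     + (r * s1 * s2) \<cdot>\<^sub>m (B1 * B2\<^sup>T + B2 * B1\<^sup>T)"

definition ld_bound :: "nat \<Rightarrow> real mat \<Rightarrow> real mat \<Rightarrow> real mat \<Rightarrow> real" where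
  "ld_bound \<eta> Cm M Q = ln (det (Cm * M * Cm\<^sup>T) / det (Cm * Q * Cm\<^sup>T)) / (2 * real \<eta>)"

definition region_with :: "nat \<Rightarrow> real \<Rightarrow> real \<Rightarrow> real \<Rightarrow> real \<Rightarrow> real vec \<Rightarrow> real vec
    \<Rightarrow> real mat \<Rightarrow> real mat \<Rightarrow> real mat \<Rightarrow> (real \<times> real) set" where
  "region_with \<eta> N s1 s2 r a1 a2 B1 B2 Cm =
     (let Q = Qmat \<eta> N s1 s2 r B1 B2;
          A = mat \<eta> 2 (\<lambda>(i, j). if j = 0 then a1 $ i else a2 $ i) in
      {(R1, R2). 0 \<le> R1 \<and> 0 \<le> R2 \<and>
        R1 \<le> ld_bound \<eta> Cm (colmat a1 * (colmat a1)\<^sup>T + Q) Q \<and>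
        R2 \<le> ld_bound \<eta> Cm (colmat a2 * (colmat a2)\<^sup>T + Q) Q \<and>
        R1 + R2 \<le> ld_bound \<eta> Cm (A * A\<^sup>T + Q) Q})"

text \<open>R_eta(a1,a2,B1,B2,C) with C a 2 x eta matrix. If C C^T is singular but C is nonzero,
 C is replaced by a nonzero row (the first one); the rows are then parallel, so the choice
 does not matter.\<close>
definition region_eta :: "nat \<Rightarrow> real \<Rightarrow> real \<Rightarrow> real \<Rightarrow> real \<Rightarrow> real vec \<Rightarrow> real vec
    \<Rightarrow> real mat \<Rightarrow> real mat \<Rightarrow> real mat \<Rightarrow> (real \<times> real) set" where
  "region_eta \<eta> N s1 s2 r a1 a2 B1 B2 C =
     (if det (C * C\<^sup>T) \<noteq> 0 then region_with \<eta> N s1 s2 r a1 a2 B1 B2 C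
      else if C \<noteq> 0\<^sub>m 2 \<eta> then
        region_with \<eta> N s1 s2 r a1 a2 B1 B2
          (mat_of_rows \<eta> [if row C 0 \<noteq> 0\<^sub>v \<eta> then row C 0 else row C 1])
      else {(0, 0)})"

text \<open>The covariance Sigma of the 2 eta inputs of the linear scheme.\<close>
definition Sigma_mat :: "nat \<Rightarrow> real \<Rightarrow> real \<Rightarrow> real \<Rightarrow> real \<Rightarrow> real vec \<Rightarrow> real vec
    \<Rightarrow> real mat \<Rightarrow> real mat \<Rightarrow> real mat" where
  "Sigma_mat \<eta> N s1 s2 r a1 a2 B1 B2 =
     (let BB = four_block_mat B1 B1 B2 B2;
          Ad = mat (2 * \<eta>) 2 (\<lambda>(i, j). if i < \<eta> \<and> j = 0 then a1 $ i
                                     else if \<eta> \<le> i \<and> j = 1 then a2 $ (i - \<eta>) else 0);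
          Bt = mat (2 * \<eta>) \<eta> (\<lambda>(i, j). if i < \<eta> then B1 $$ (i, j) else B2 $$ (i - \<eta>, j));
          Bd = four_block_mat B1 (0\<^sub>m \<eta> \<eta>) (0\<^sub>m \<eta> \<eta>) B2;
          KW = four_block_mat ((s1\<^sup>2) \<cdot>\<^sub>m 1\<^sub>m \<eta>) ((r * s1 * s2) \<cdot>\<^sub>m 1\<^sub>m \<eta>)
                              ((r * s1 * s2) \<cdot>\<^sub>m 1\<^sub>m \<eta>) ((s2\<^sup>2) \<cdot>\<^sub>m 1\<^sub>m \<eta>);
          Inv = the (mat_inverse (1\<^sub>m (2 * \<eta>) - BB)) in
      Inv * (Ad * Ad\<^sup>T + N \<cdot>\<^sub>m (Bt * Bt\<^sup>T) + Bd * KW * Bd\<^sup>T) * Inv\<^sup>T)"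

definition power_ok :: "nat \<Rightarrow> real \<Rightarrow> real \<Rightarrow> real \<Rightarrow> real \<Rightarrow> real \<Rightarrow> real \<Rightarrow> real vec \<Rightarrow> real vec
    \<Rightarrow> real mat \<Rightarrow> real mat \<Rightarrow> bool" where
  "power_ok \<eta> P1 P2 N s1 s2 r a1 a2 B1 B2 \<longleftrightarrow>
     (let S = Sigma_mat \<eta> N s1 s2 r a1 a2 B1 B2 in
       (\<Sum>i<\<eta>. S $$ (i, i)) \<le> real \<eta> * P1 \<and>
       (\<Sum>i<\<eta>. S $$ (\<eta> + i, \<eta> + i)) \<le> real \<eta> * P2)"

definition R_region :: "real \<Rightarrow> real \<Rightarrow> real \<Rightarrow> real \<Rightarrow> real \<Rightarrow> real \<Rightarrow> (real \<times> real) set" where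
  "R_region P1 P2 N s1 s2 r = closure (\<Union> {region_eta \<eta> N s1 s2 r a1 a2 B1 B2 C | \<eta> a1 a2 B1 B2 C.
       0 < \<eta> \<and> a1 \<in> carrier_vec \<eta> \<and> a2 \<in> carrier_vec \<eta> \<and>
       strictly_lower \<eta> B1 \<and> strictly_lower \<eta> B2 \<and> C \<in> carrier_mat 2 \<eta> \<and>
       power_ok \<eta> P1 P2 N s1 s2 r a1 a2 B1 B2})"

end

theory Submission
  imports Defs
begin

text \<open>
  Time is cut into blocks of length \<open>\<eta>\<close>. In a block user \<open>\<nu>\<close> sends
  \<open>a\<^sub>\<nu> \<xi>\<^sub>\<nu> + B\<^sub>\<nu> v\<^sub>\<nu>\<close>, where \<open>\<xi>\<^sub>\<nu>\<close> is a letter of its codeword and \<open>v\<^sub>\<nu>\<close> its feedback.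
  The receiver knows \<open>B\<^sub>1\<close> and \<open>B\<^sub>2\<close>, so it can form \<open>(I - B\<^sub>1 - B\<^sub>2) y = A \<xi> + n\<close> with \<open>n\<close> of covariance
  \<open>Q\<close>. It keeps only the matched-filter outputs \<open>t = A\<^sup>T C\<^sup>T (C Q C\<^sup>T)\<^sup>-\<^sup>1 C (A \<xi> + n) = G \<xi> + v\<close>, whose noise \<open>v\<close>
  again has covariance \<open>G\<close>; by the matrix determinant lemma the three bounds of the region are the logarithms of
  \<open>1 + G\<^sub>1\<^sub>1\<close>, \<open>1 + G\<^sub>2\<^sub>2\<close> and \<open>det (I + G)\<close>.

  Codewords have independent standard normal letters. A message pair is accepted when its three empirical
  information densities exceed their means up to \<open>\<epsilon>\<close>. Whatever the output is, the exponential of an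
  information density has mean one under an independent codeword, which bounds the probability of accepting a wrong
  pair. The information densities of the transmitted pair are quadratic in inputs and noise, so Chebyshev's
  inequality applied to the empirical second moments shows that it is accepted; this uses moments only, not the
  Gaussianity of \<open>v\<close>. The same second moments control the transmit power of a codebook, so one
  codebook is good for the error probability and for both power constraints as soon as the \<open>a\<^sub>\<nu>\<close> are scaled by
  a factor slightly below one.
\<close>

section \<open>Gaussian integrals\<close>

text \<open>Feedback makes a transmitted symbol depend on both codebooks and on the noise, so power
  cannot be controlled word by word: it involves the correlation between the words of the two users.
  The discrepancy therefore records all sixteen second moments of the two inputs and the two
  filtered noises. Its entries for the inputs alone are free of noise, and a codebook pair whose
  mean penalty is below one has these entries close to the identity on average over the messages.
  Scaling the amplitudes by \<open>c < 1\<close> leaves the factor 1 / c^2 as room for this error;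
  the power caused by the noise that is fed back is not scaled and is exact. The encoders use
  feedback from the current block only, so with random words the blocks are independent and
  identically distributed, and the last \<open>n mod \<eta>\<close> channel uses are silent. Because
  gain and noise covariance of the filter outputs are the same matrix G, only I + G is ever
  inverted. It is positive definite even when G is singular, so parallel rows of C and the case C =
  0 need no separate channel argument.\<close>

lemma prob_space_std_gauss: "prob_space std_gauss"
  unfolding std_gauss_def by (rule prob_space_normal_density) simp

lemma sets_std_gauss [measurable_cong, simp]: "sets std_gauss = sets borel"
  by (simp add: std_gauss_def)

lemma space_std_gauss [simp]: "space std_gauss = UNIV"
  by (simp add: std_gauss_def)

lemma std_gauss_integrable_power [simp]: "integrable std_gauss (\<lambda>x. x ^ k)"
  unfolding std_gauss_def
  by (subst integrable_density) (auto intro: integrable_std_normal_moment)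

lemma std_gauss_integral_power:
  "(\<integral>x. x ^ k \<partial>std_gauss) = (\<integral>x. std_normal_density x * x ^ k \<partial>lborel)"
  unfolding std_gauss_def
  by (subst integral_density) auto

lemma std_gauss_mean: "(\<integral>x. x \<partial>std_gauss) = 0"
  using std_gauss_integral_power[of 1] integral_std_normal_moment_odd[of 0] by simp

lemma std_gauss_second_moment: "(\<integral>x. x\<^sup>2 \<partial>std_gauss) = 1"
  using std_gauss_integral_power[of 2] integral_std_normal_moment_even[of 1]
  by (simp add: fact_numeral)

text \<open>Completing the square turns the integrand into a multiple of a normal density.\<close>
lemma std_gauss_exp_quadratic:
  assumes "1 + g > 0"
  shows "(\<integral>\<^sup>+x. ennreal (exp (b * x - g * x\<^sup>2 / 2)) \<partial>std_gauss)
    = ennreal (exp (b\<^sup>2 / (2 * (1 + g))) / sqrt (1 + g))"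
proof -
  define s where "s = 1 / sqrt (1 + g)"
  define m where "m = b / (1 + g)"
  define K where "K = exp (b\<^sup>2 / (2 * (1 + g))) / sqrt (1 + g)"
  have K: "K \<ge> 0" using assms by (simp add: K_def)
  have s: "s > 0" "s\<^sup>2 = 1 / (1 + g)" using assms by (auto simp: s_def power_divide)
  have eq: "std_normal_density x * exp (b * x - g * x\<^sup>2 / 2) = K * normal_density m s x" for x
  proof -
    have "- (x - m)\<^sup>2 / (2 * s\<^sup>2) + b\<^sup>2 / (2 * (1 + g)) = - x\<^sup>2 / 2 + (b * x - g * x\<^sup>2 / 2)"
    proof -
      have b: "b = m * (1 + g)" and q: "1 + g \<noteq> 0" using assms by (auto simp: m_def)
      have "b\<^sup>2 / (2 * (1 + g)) = m\<^sup>2 * (1 + g) / 2" unfolding b using q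
        by (simp add: power2_eq_square divide_simps) 
      moreover have "- (x - m)\<^sup>2 / (2 * s\<^sup>2) = - (x - m)\<^sup>2 * (1 + g) / 2" unfolding s(2) by simp
      ultimately show ?thesis unfolding b
        by (simp add: power2_eq_square algebra_simps add_divide_distrib diff_divide_distrib)
    qed
    hence "exp (- (x - m)\<^sup>2 / (2 * s\<^sup>2)) * exp (b\<^sup>2 / (2 * (1 + g)))
      = exp (- x\<^sup>2 / 2) * exp (b * x - g * x\<^sup>2 / 2)"
      by (simp only: exp_add[symmetric])
    moreover have "sqrt (2 * pi * s\<^sup>2) = sqrt (2 * pi) * s"
      using s(1) by (simp add: real_sqrt_mult)
    ultimately show ?thesis using assms
      by (simp add: std_normal_density_def normal_density_def K_def s_def field_simps)
  qed
  have "(\<integral>\<^sup>+x. ennreal (exp (b * x - g * x\<^sup>2 / 2)) \<partial>std_gauss)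
      = (\<integral>\<^sup>+x. ennreal (std_normal_density x) * ennreal (exp (b * x - g * x\<^sup>2 / 2)) \<partial>lborel)"
    unfolding std_gauss_def by (subst nn_integral_density) auto
  also have "\<dots> = (\<integral>\<^sup>+x. ennreal K * ennreal (normal_density m s x) \<partial>lborel)"
    using K by (intro nn_integral_cong) (simp add: ennreal_mult[symmetric] eq)
  also have "\<dots> = ennreal K * (\<integral>\<^sup>+x. ennreal (normal_density m s x) \<partial>lborel)"
    by (rule nn_integral_cmult) auto
  also have "(\<integral>\<^sup>+x. ennreal (normal_density m s x) \<partial>lborel) = 1"
    using s by (subst nn_integral_eq_integral) auto
  finally show ?thesis by (simp add: K_def)
qed

text \<open>Information density of the scalar Gaussian channel with matched-filter output \<open>s = g x + noise\<close>,
  where the noise has variance \<open>g\<close>.\<close>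
definition idens :: "real \<Rightarrow> real \<Rightarrow> real \<Rightarrow> real" where
  "idens g s x = x * s - g * x\<^sup>2 / 2 - s\<^sup>2 / (2 * (1 + g)) + ln (1 + g) / 2"

text \<open>For positive \<open>g\<close>, \<open>exp (idens g s x)\<close> is the density of the
  output \<open>s\<close> given \<open>x\<close>, normal with mean \<open>g * x\<close> and variance
  \<open>g\<close>, divided by its marginal density, normal with variance
  \<open>g * (1 + g)\<close>. Averaging this ratio over \<open>x\<close> gives one for every fixed
  \<open>s\<close>. The formula contains no division by \<open>g\<close>, so the zero filter is
  covered as well.\<close>

lemma exp_idens_mean:
  assumes "1 + g > 0"
  shows "(\<integral>\<^sup>+x. ennreal (exp (idens g s x)) \<partial>std_gauss) = 1"
proof -
  define K where "K = exp (- s\<^sup>2 / (2 * (1 + g)) + ln (1 + g) / 2)"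
  have "exp (idens g s x) = K * exp (s * x - g * x\<^sup>2 / 2)" for x
    unfolding K_def idens_def by (simp add: exp_add[symmetric] algebra_simps)
  hence "(\<integral>\<^sup>+x. ennreal (exp (idens g s x)) \<partial>std_gauss)
      = (\<integral>\<^sup>+x. ennreal K * ennreal (exp (s * x - g * x\<^sup>2 / 2)) \<partial>std_gauss)"
    by (simp add: ennreal_mult K_def)
  also have "\<dots> = ennreal K * ennreal (exp (s\<^sup>2 / (2 * (1 + g))) / sqrt (1 + g))"
    by (subst nn_integral_cmult) (auto simp: std_gauss_exp_quadratic[OF assms])
  also have "\<dots> = ennreal (K * (exp (s\<^sup>2 / (2 * (1 + g))) / sqrt (1 + g)))"
    by (subst ennreal_mult[symmetric]) (use assms in \<open>auto simp: K_def\<close>)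
  also have "K * (exp (s\<^sup>2 / (2 * (1 + g))) / sqrt (1 + g)) = 1"
  proof -
    have "exp (ln (1 + g) / 2) = sqrt (1 + g)" using assms by (simp add: ln_sqrt[symmetric])
    hence "K = sqrt (1 + g) / exp (s\<^sup>2 / (2 * (1 + g)))"
      by (simp add: K_def exp_diff)
    thus ?thesis using assms by simp
  qed
  finally show ?thesis by simp
qed

text \<open>Written by the chain rule: first the density of \<open>x1\<close> given both outputs, then that of \<open>x2\<close> given
  \<open>x1\<close> as well; \<open>idens2_eq\<close> is the symmetric form.\<close>
definition idens2 :: "real \<Rightarrow> real \<Rightarrow> real \<Rightarrow> real \<Rightarrow> real \<Rightarrow> real \<Rightarrow> real \<Rightarrow> real" where
  "idens2 g1 g2 h t1 t2 x1 x2 =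
     idens g2 (t2 - h * x1) x2
     + idens (g1 - h\<^sup>2 / (1 + g2)) (t1 - h * t2 / (1 + g2)) x1"

text \<open>The form in \<open>t1\<close> and \<open>t2\<close> is that of the inverse of I + G, and
  \<open>d\<close> is det (I + G). The chain-rule form is suited to exponential means; the
  second-moment estimate needs this polynomial one.\<close>

lemma idens2_eq:
  assumes "1 + g2 > 0" "(1 + g1) * (1 + g2) - h\<^sup>2 > 0"
  defines "d \<equiv> (1 + g1) * (1 + g2) - h\<^sup>2"
  shows "idens2 g1 g2 h t1 t2 x1 x2 =
    x1 * t1 + x2 * t2 - (g1 * x1\<^sup>2 + 2 * h * x1 * x2 + g2 * x2\<^sup>2) / 2
    - ((1 + g2) * t1\<^sup>2 - 2 * h * t1 * t2 + (1 + g1) * t2\<^sup>2) / (2 * d) + ln d / 2"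
proof -
  define q where "q = 1 + g2"
  have d: "d > 0" "q > 0" using assms(1,2) by (auto simp: d_def q_def)
  \<comment> \<open>The Schur complement of \<open>1 + g2\<close> in I + G; with it the two
    logarithms add up to \<open>ln d\<close>.\<close>
  have g1: "1 + (g1 - h\<^sup>2 / (1 + g2)) = d / q"
    using d by (simp add: d_def q_def field_simps)
  have g1': "g1 = (d + h\<^sup>2) / q - 1" using d by (simp add: d_def q_def field_simps)
  have ln: "ln (d / q) = ln d - ln q" using d by (simp add: ln_div)
  have g2: "g2 = q - 1" by (simp add: q_def)
  have "idens2 g1 g2 h t1 t2 x1 x2 = 
    x1 * t1 + x2 * t2 - (g1 * x1\<^sup>2 + 2 * h * x1 * x2 + g2 * x2\<^sup>2) / 2
    - ((t2 - h * x1)\<^sup>2 / (2 * q) - x1 * x1 * h\<^sup>2 / (2 * q) + x1 * h * t2 / q + (t1 - h * t2 / q)\<^sup>2 / (2 * (d / q))) + ln d / 2"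
    unfolding idens2_def idens_def g1 ln unfolding q_def[symmetric]
    by (simp add: algebra_simps power2_eq_square add_divide_distrib diff_divide_distrib)
  also have "(t2 - h * x1)\<^sup>2 / (2 * q) - x1 * x1 * h\<^sup>2 / (2 * q) + x1 * h * t2 / q + (t1 - h * t2 / q)\<^sup>2 / (2 * (d / q))
     = ((1 + g2) * t1\<^sup>2 - 2 * h * t1 * t2 + (1 + g1) * t2\<^sup>2) / (2 * d)"
  proof -
    have 1: "(t2 - h * x1)\<^sup>2 / (2 * q) - x1 * x1 * h\<^sup>2 / (2 * q) + x1 * h * t2 / q = t2\<^sup>2 / (2 * q)"
      using d by (simp add: field_simps power2_eq_square)
    have 2: "(t1 - h * t2 / q)\<^sup>2 / (2 * (d / q)) = (q * t1\<^sup>2 - 2 * h * t1 * t2 + h\<^sup>2 * t2\<^sup>2 / q) / (2 * d)"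
      using d by (simp add: field_simps power2_eq_square)
    have 3: "(1 + g1) = (d + h\<^sup>2) / q" using g1' by simp
    show ?thesis unfolding 1 2 3 using d by (simp add: g2 field_simps)
  qed
  finally show ?thesis .
qed

section \<open>Fourth moments and independence\<close>

text \<open>Chebyshev's inequality for products of two letters needs fourth moments. This class is
  closed under linear combinations, and the product of two members is square integrable.\<close>

definition L4 :: "'a measure \<Rightarrow> ('a \<Rightarrow> real) \<Rightarrow> bool" where
  "L4 M f \<longleftrightarrow> f \<in> borel_measurable M \<and> integrable M (\<lambda>x. f x ^ 4)"

lemma L4_measurable [dest]: "L4 M f \<Longrightarrow> f \<in> borel_measurable M"
  by (simp add: L4_def)

lemma norm_mono_nonneg: "0 \<le> x \<Longrightarrow> x \<le> y \<Longrightarrow> norm x \<le> norm y" for x y :: real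
  by simp

lemma norm_le_one_plus_square: "norm x \<le> norm (1 + x\<^sup>2)" for x :: real
proof -
  have "2 * \<bar>x\<bar> \<le> 1 + \<bar>x\<bar>\<^sup>2" using sum_squares_bound[of 1 "\<bar>x\<bar>"] by simp
  thus ?thesis by (simp add: abs_of_nonneg)
qed

lemma square_product_le: "(x * y)\<^sup>2 \<le> (x ^ 4 + y ^ 4) / 2" for x y :: real
proof -
  have "2 * x\<^sup>2 * y\<^sup>2 \<le> (x\<^sup>2)\<^sup>2 + (y\<^sup>2)\<^sup>2" by (rule sum_squares_bound)
  thus ?thesis by (simp add: power_mult_distrib flip: power_mult)
qed

lemma fourth_power_sum_le: "(x + y) ^ 4 \<le> 8 * (x ^ 4 + y ^ 4)" for x y :: real
proof -
  have "(x + y)\<^sup>2 \<le> 2 * (x\<^sup>2 + y\<^sup>2)" using sum_squares_bound[of x y] by (simp add: power2_sum)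
  hence "((x + y)\<^sup>2)\<^sup>2 \<le> (2 * (x\<^sup>2 + y\<^sup>2))\<^sup>2" by (rule power_mono) simp
  also have "\<dots> \<le> 4 * (2 * ((x\<^sup>2)\<^sup>2 + (y\<^sup>2)\<^sup>2))"
    using sum_squares_bound[of "x\<^sup>2" "y\<^sup>2"] by (simp add: power2_sum power_mult_distrib)
  finally show ?thesis by (simp flip: power_mult)
qed

context prob_space
begin

lemma L4_integrable_mult_square:
  assumes "L4 M f" "L4 M g" shows "integrable M (\<lambda>x. (f x * g x)\<^sup>2)"
proof (rule Bochner_Integration.integrable_bound)
  show "integrable M (\<lambda>x. (f x ^ 4 + g x ^ 4) / 2)" using assms by (auto simp: L4_def)
  show "(\<lambda>x. (f x * g x)\<^sup>2) \<in> borel_measurable M" using assms[THEN L4_measurable] by measurable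
  show "AE x in M. norm ((f x * g x)\<^sup>2) \<le> norm ((f x ^ 4 + g x ^ 4) / 2)"
    by (intro AE_I2 norm_mono_nonneg square_product_le) simp
qed

lemma L4_const: "L4 M (\<lambda>x. c)"
  by (simp add: L4_def)

lemma L4_integrable_mult:
  assumes "L4 M f" "L4 M g" shows "integrable M (\<lambda>x. f x * g x)"
proof (rule Bochner_Integration.integrable_bound)
  show "integrable M (\<lambda>x. 1 + (f x * g x)\<^sup>2)" using L4_integrable_mult_square[OF assms] by auto
  show "(\<lambda>x. f x * g x) \<in> borel_measurable M" using assms[THEN L4_measurable] by measurable
  show "AE x in M. norm (f x * g x) \<le> norm (1 + (f x * g x)\<^sup>2)"
    by (intro AE_I2 norm_le_one_plus_square)
qed

lemma L4_integrable: "L4 M f \<Longrightarrow> integrable M f"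
  using L4_integrable_mult[OF _ L4_const[of 1]] by simp

lemma L4_add:
  assumes "L4 M f" "L4 M g" shows "L4 M (\<lambda>x. f x + g x)"
  unfolding L4_def
proof
  show m: "(\<lambda>x. f x + g x) \<in> borel_measurable M" using assms[THEN L4_measurable] by measurable
  show "integrable M (\<lambda>x. (f x + g x) ^ 4)"
  proof (rule Bochner_Integration.integrable_bound)
    show "integrable M (\<lambda>x. 8 * (f x ^ 4 + g x ^ 4))" using assms by (auto simp: L4_def)
    show "(\<lambda>x. (f x + g x) ^ 4) \<in> borel_measurable M" using m by measurable
    show "AE x in M. norm ((f x + g x) ^ 4) \<le> norm (8 * (f x ^ 4 + g x ^ 4))"
      by (intro AE_I2 norm_mono_nonneg fourth_power_sum_le) simp
  qed
qed

lemma L4_cmult: "L4 M f \<Longrightarrow> L4 M (\<lambda>x. c * f x)"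
  by (auto simp: L4_def power_mult_distrib)

lemma L4_sum: "finite I \<Longrightarrow> (\<And>i. i \<in> I \<Longrightarrow> L4 M (f i)) \<Longrightarrow> L4 M (\<lambda>x. \<Sum>i\<in>I. f i x)"
  by (induction I rule: finite_induct) (auto intro: L4_const L4_add)

text \<open>Independence and centering remove the off-diagonal terms of the squared sum, so its mean
  grows linearly in the number of summands and not quadratically. This is the source of every law of
  large numbers below.\<close>

lemma expectation_square_sum_indep_le:
  fixes Z :: "'i \<Rightarrow> 'a \<Rightarrow> real" and v :: real
  assumes I: "finite I" and ind: "indep_vars (\<lambda>_. borel) Z I"
    and sq: "\<And>i. i \<in> I \<Longrightarrow> integrable M (\<lambda>x. (Z i x)\<^sup>2)"
    and mean: "\<And>i. i \<in> I \<Longrightarrow> expectation (Z i) = 0"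
    and v: "\<And>i. i \<in> I \<Longrightarrow> expectation (\<lambda>x. (Z i x)\<^sup>2) \<le> v"
  shows "integrable M (\<lambda>x. (\<Sum>i\<in>I. Z i x)\<^sup>2)"
    and "expectation (\<lambda>x. (\<Sum>i\<in>I. Z i x)\<^sup>2) \<le> card I * v"
proof -
  have meas: "Z i \<in> borel_measurable M" if "i \<in> I" for i
    using ind that by (auto simp: indep_vars_def)
  have int: "integrable M (Z i)" if "i \<in> I" for i
  proof (rule Bochner_Integration.integrable_bound)
    show "integrable M (\<lambda>x. 1 + (Z i x)\<^sup>2)" using sq[OF that] by auto
    show "AE x in M. norm (Z i x) \<le> norm (1 + (Z i x)\<^sup>2)"
      by (intro AE_I2 norm_le_one_plus_square)
  qed (use meas that in auto)
  have cross: "integrable M (\<lambda>x. Z i x * Z j x) \<and> expectation (\<lambda>x. Z i x * Z j x) = 0"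
    if "i \<in> I" "j \<in> I" "i \<noteq> j" for i j
  proof -
    have ij: "indep_vars (\<lambda>_. borel) Z {i, j}"
      by (rule indep_vars_subset[OF ind]) (use that in auto)
    have "integrable M (\<lambda>x. \<Prod>k\<in>{i, j}. Z k x)"
      by (rule indep_vars_integrable[OF _ ij]) (use int that in auto)
    moreover have "expectation (\<lambda>x. \<Prod>k\<in>{i, j}. Z k x) = (\<Prod>k\<in>{i, j}. expectation (Z k))"
      by (rule indep_vars_lebesgue_integral[OF _ ij]) (use int that in auto)
    ultimately show ?thesis using that mean by simp
  qed
  have all: "integrable M (\<lambda>x. Z i x * Z j x)" if "i \<in> I" "j \<in> I" for i j
    using cross[OF that] sq[OF that(1)] by (cases "i = j") (auto simp: power2_eq_square)
  have eq: "(\<lambda>x. (\<Sum>i\<in>I. Z i x)\<^sup>2) = (\<lambda>x. \<Sum>i\<in>I. \<Sum>j\<in>I. Z i x * Z j x)"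
    by (simp add: power2_eq_square sum_product)
  show "integrable M (\<lambda>x. (\<Sum>i\<in>I. Z i x)\<^sup>2)" unfolding eq using all by auto
  have "expectation (\<lambda>x. (\<Sum>i\<in>I. Z i x)\<^sup>2) = (\<Sum>i\<in>I. \<Sum>j\<in>I. expectation (\<lambda>x. Z i x * Z j x))"
    unfolding eq using all by (simp add: Bochner_Integration.integral_sum)
  also have "\<dots> = (\<Sum>i\<in>I. \<Sum>j\<in>I. if j = i then expectation (\<lambda>x. Z i x * Z i x) else 0)"
    using cross by (intro sum.cong refl) auto
  also have "\<dots> = (\<Sum>i\<in>I. expectation (\<lambda>x. (Z i x)\<^sup>2))"
    using I by (simp add: power2_eq_square)
  also have "\<dots> \<le> card I * v" by (rule sum_bounded_above) (use v in auto)
  finally show "expectation (\<lambda>x. (\<Sum>i\<in>I. Z i x)\<^sup>2) \<le> card I * v" .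
qed

end

section \<open>Marginals, products and independence in product measures\<close>

lemma integral_prob_PiM_component:
  fixes f :: "'a \<Rightarrow> real"
  assumes M: "\<And>i. i \<in> I \<Longrightarrow> prob_space (M i)" and i: "i \<in> I" and f: "f \<in> borel_measurable (M i)"
  shows "integrable (PiM I M) (\<lambda>x. f (x i)) \<longleftrightarrow> integrable (M i) f"
    and "(\<integral>x. f (x i) \<partial>PiM I M) = (\<integral>x. f x \<partial>M i)"
proof -
  have 1: "(\<lambda>x. x i) \<in> measurable (PiM I M) (M i)" using i by measurable
  show "integrable (PiM I M) (\<lambda>x. f (x i)) \<longleftrightarrow> integrable (M i) f"
    using integrable_distr_eq[OF 1 f] distr_PiM_component[where M = M, OF M i] by simp
  show "(\<integral>x. f (x i) \<partial>PiM I M) = (\<integral>x. f x \<partial>M i)"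
    using integral_distr[OF 1 f] distr_PiM_component[where M = M, OF M i] by simp
qed

text \<open>The joint law of the coordinates is the product measure itself, and the marginals are
  its factors; independence is this equality of laws.\<close>

lemma indep_vars_PiM_projections:
  assumes M: "\<And>i. i \<in> I \<Longrightarrow> prob_space (M i)" and ne: "I \<noteq> {}"
  shows "prob_space.indep_vars (PiM I M) M (\<lambda>i x. x i) I"
proof -
  interpret P: prob_space "PiM I M" by (rule prob_space_PiM[OF M])
  show ?thesis
  proof -
    have "distr (PiM I M) (PiM I M) (\<lambda>x. \<lambda>i\<in>I. x i) = distr (PiM I M) (PiM I M) (\<lambda>x. x)"
      by (intro distr_cong) (auto simp: space_PiM)
    also have "\<dots> = PiM I M" by simp
    also have "\<dots> = PiM I (\<lambda>i. distr (PiM I M) (M i) (\<lambda>x. x i))"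
      by (intro PiM_cong refl) (simp add: distr_PiM_component[where M = M, OF M])
    finally show ?thesis
      by (subst P.indep_vars_iff_distr_eq_PiM'[OF ne]) auto
  qed
qed

text \<open>Rectangles generate the product sigma-algebra and are stable under intersection, so
  independence may be tested on them. There every probability splits into one factor for
  \<open>M1\<close> and one for \<open>M2\<close>, and each factor splits over the indices.\<close>

lemma indep_vars_pair:
  assumes M1: "prob_space M1" and M2: "prob_space M2" and False: "I \<noteq> {}" and I: "finite I"
    and U: "prob_space.indep_vars M1 N1 U I" and V: "prob_space.indep_vars M2 N2 V I"
  shows "prob_space.indep_vars (M1 \<Otimes>\<^sub>M M2) (\<lambda>i. N1 i \<Otimes>\<^sub>M N2 i) (\<lambda>i \<omega>. (U i (fst \<omega>), V i (snd \<omega>))) I"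
proof -
  interpret M1: prob_space M1 by fact
  interpret M2: prob_space M2 by fact
  interpret P: pair_prob_space M1 M2 ..
  have Um: "U i \<in> measurable M1 (N1 i)" and Vm: "V i \<in> measurable M2 (N2 i)" if "i \<in> I" for i
    using U V that by (auto simp: M1.indep_vars_def M2.indep_vars_def)
  show ?thesis
  proof -
    let ?E = "\<lambda>i. {A \<times> B | A B. A \<in> sets (N1 i) \<and> B \<in> sets (N2 i)}"
    have rect: "(\<lambda>\<omega>. (U i (fst \<omega>), V i (snd \<omega>))) -` (A \<times> B) \<inter> space (M1 \<Otimes>\<^sub>M M2)
        = (U i -` A \<inter> space M1) \<times> (V i -` B \<inter> space M2)" for i A B
      by (auto simp: space_pair_measure)
    show ?thesis
    proof (subst P.indep_vars_finite[OF False I, where E = ?E])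
      fix i assume i: "i \<in> I"
      show "sets (N1 i \<Otimes>\<^sub>M N2 i) = sigma_sets (space (N1 i \<Otimes>\<^sub>M N2 i)) (?E i)"
        unfolding space_pair_measure by (rule sets_pair_measure)
      show "P.random_variable (N1 i \<Otimes>\<^sub>M N2 i) (\<lambda>\<omega>. (U i (fst \<omega>), V i (snd \<omega>)))"
        using Um[OF i] Vm[OF i] by measurable
      show "Int_stable (?E i)" by (rule Int_stable_pair_measure_generator)
      show "space (N1 i \<Otimes>\<^sub>M N2 i) \<in> ?E i" by (auto simp: space_pair_measure)
      show "?E i \<subseteq> Pow (space (N1 i \<Otimes>\<^sub>M N2 i))"
        unfolding space_pair_measure by (rule pair_measure_closed)
    next
      show "\<forall>A\<in>Pi I ?E. P.prob (\<Inter>j\<in>I. (\<lambda>\<omega>. (U j (fst \<omega>), V j (snd \<omega>))) -` A j \<inter> space (M1 \<Otimes>\<^sub>M M2))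
        = (\<Prod>j\<in>I. P.prob ((\<lambda>\<omega>. (U j (fst \<omega>), V j (snd \<omega>))) -` A j \<inter> space (M1 \<Otimes>\<^sub>M M2)))"
      proof
        fix A assume A: "A \<in> Pi I ?E"
        have "\<forall>i\<in>I. \<exists>C D. A i = C \<times> D \<and> C \<in> sets (N1 i) \<and> D \<in> sets (N2 i)" using A by auto
        then obtain C D where CD: "\<And>i. i \<in> I \<Longrightarrow> A i = C i \<times> D i"
          "\<And>i. i \<in> I \<Longrightarrow> C i \<in> sets (N1 i)" "\<And>i. i \<in> I \<Longrightarrow> D i \<in> sets (N2 i)" by metis
        have mC: "U i -` C i \<inter> space M1 \<in> sets M1" and mD: "V i -` D i \<inter> space M2 \<in> sets M2" if "i \<in> I" for i
          using Um Vm CD that by (auto intro: measurable_sets)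
        have times: "P.prob (X \<times> Y) = M1.prob X * M2.prob Y" if "X \<in> sets M1" "Y \<in> sets M2" for X Y
          using that by (simp add: measure_def M2.emeasure_pair_measure_Times enn2real_mult)
        have "(\<Inter>j\<in>I. (\<lambda>\<omega>. (U j (fst \<omega>), V j (snd \<omega>))) -` A j \<inter> space (M1 \<Otimes>\<^sub>M M2))
            = (\<Inter>j\<in>I. U j -` C j \<inter> space M1) \<times> (\<Inter>j\<in>I. V j -` D j \<inter> space M2)"
          using False CD(1) by (auto simp: space_pair_measure)
        hence "P.prob (\<Inter>j\<in>I. (\<lambda>\<omega>. (U j (fst \<omega>), V j (snd \<omega>))) -` A j \<inter> space (M1 \<Otimes>\<^sub>M M2))
            = M1.prob (\<Inter>j\<in>I. U j -` C j \<inter> space M1) * M2.prob (\<Inter>j\<in>I. V j -` D j \<inter> space M2)"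
          by (simp only:) (intro times sets.finite_INT mC mD False I)
        also have "\<dots> = (\<Prod>j\<in>I. M1.prob (U j -` C j \<inter> space M1)) * (\<Prod>j\<in>I. M2.prob (V j -` D j \<inter> space M2))"
          using M1.indep_varsD_finite[OF U False I, of C] M2.indep_varsD_finite[OF V False I, of D] CD by simp
        also have "\<dots> = (\<Prod>j\<in>I. P.prob ((\<lambda>\<omega>. (U j (fst \<omega>), V j (snd \<omega>))) -` A j \<inter> space (M1 \<Otimes>\<^sub>M M2)))"
          unfolding prod.distrib[symmetric]
          by (intro prod.cong refl) (simp add: CD(1) rect times mC mD)
        finally show "P.prob (\<Inter>j\<in>I. (\<lambda>\<omega>. (U j (fst \<omega>), V j (snd \<omega>))) -` A j \<inter> space (M1 \<Otimes>\<^sub>M M2)) = \<dots>" .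
      qed
    qed
  qed
qed

lemma pair_prob_fst:
  fixes f :: "'a \<Rightarrow> real"
  assumes "prob_space N" and f: "f \<in> borel_measurable M"
  shows "integrable (M \<Otimes>\<^sub>M N) (\<lambda>p. f (fst p)) \<longleftrightarrow> integrable M f"
    and "(\<integral>p. f (fst p) \<partial>(M \<Otimes>\<^sub>M N)) = (\<integral>x. f x \<partial>M)"
  using integrable_distr_eq[OF measurable_fst[of _ N] f] integral_distr[OF measurable_fst[of _ N] f]
    prob_space.distr_pair_fst[OF assms(1), of M] by simp_all

lemma distr_pair_snd:
  assumes "prob_space M" "sigma_finite_measure N" shows "distr (M \<Otimes>\<^sub>M N) N snd = N"
proof (intro measure_eqI)
  interpret M: prob_space M by fact
  interpret N: sigma_finite_measure N by fact
  fix A assume A: "A \<in> sets (distr (M \<Otimes>\<^sub>M N) N snd)"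
  hence "emeasure (distr (M \<Otimes>\<^sub>M N) N snd) A = emeasure (M \<Otimes>\<^sub>M N) (space M \<times> A)"
    by (auto simp add: emeasure_distr space_pair_measure dest: sets.sets_into_space
        intro!: arg_cong2[where f=emeasure])
  with A show "emeasure (distr (M \<Otimes>\<^sub>M N) N snd) A = emeasure N A"
    by (simp add: N.emeasure_pair_measure_Times M.emeasure_space_1)
qed simp

lemma pair_prob_snd:
  fixes f :: "'b \<Rightarrow> real"
  assumes "prob_space M" "prob_space N" and f: "f \<in> borel_measurable N"
  shows "integrable (M \<Otimes>\<^sub>M N) (\<lambda>p. f (snd p)) \<longleftrightarrow> integrable N f"
    and "(\<integral>p. f (snd p) \<partial>(M \<Otimes>\<^sub>M N)) = (\<integral>x. f x \<partial>N)"
  using integrable_distr_eq[OF measurable_snd[of M] f] integral_distr[OF measurable_snd[of M] f]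
    distr_pair_snd[OF assms(1) prob_space_imp_sigma_finite[OF assms(2)]] by simp_all

lemma pair_prob_mult:
  fixes f :: "'a \<Rightarrow> real" and g :: "'b \<Rightarrow> real"
  assumes M: "prob_space M" and N: "prob_space N" and f: "integrable M f" and g: "integrable N g"
  shows "(\<integral>p. f (fst p) * g (snd p) \<partial>(M \<Otimes>\<^sub>M N)) = (\<integral>x. f x \<partial>M) * (\<integral>x. g x \<partial>N)"
proof -
  interpret M: prob_space M by fact
  interpret N: prob_space N by fact
  interpret P: pair_prob_space M N ..
  have [measurable]: "f \<in> borel_measurable M" "g \<in> borel_measurable N" using f g by auto
  have int: "integrable (M \<Otimes>\<^sub>M N) (\<lambda>p. f (fst p) * g (snd p))"
    by (rule P.Fubini_integrable) (use f g in \<open>auto simp: abs_mult\<close>)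
  show ?thesis using P.integral_fst'[OF int] by simp
qed

lemma L4_pair_fst: "prob_space N \<Longrightarrow> L4 M f \<Longrightarrow> L4 (M \<Otimes>\<^sub>M N) (\<lambda>p. f (fst p))"
  using pair_prob_fst(1)[of N "\<lambda>x. f x ^ 4" M] by (auto simp: L4_def)

lemma L4_pair_snd: "prob_space M \<Longrightarrow> prob_space N \<Longrightarrow> L4 N f \<Longrightarrow> L4 (M \<Otimes>\<^sub>M N) (\<lambda>p. f (snd p))"
  using pair_prob_snd(1)[of M N "\<lambda>x. f x ^ 4"] by (auto simp: L4_def)

section \<open>Linear functionals of the noise\<close>

definition nlin :: "real \<Rightarrow> real \<Rightarrow> real \<Rightarrow> real \<times> real \<times> real \<Rightarrow> real" where
  "nlin a b c p = a * fst p + b * fst (snd p) + c * snd (snd p)"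

text \<open>The bilinear form of the covariance matrix of a noise triple, with diagonal blocks
  \<open>N\<close> and K_W.\<close>

definition ncov :: "real \<Rightarrow> real \<Rightarrow> real \<Rightarrow> real \<Rightarrow> real \<Rightarrow> real \<Rightarrow> real \<Rightarrow> real \<Rightarrow> real \<Rightarrow> real \<Rightarrow> real" where
  "ncov N s1 s2 r a b c a' b' c' =
     N * a * a' + s1\<^sup>2 * b * b' + s2\<^sup>2 * c * c' + r * s1 * s2 * (b * c' + c * b')"

lemma L4_std_gauss: "L4 std_gauss (\<lambda>x. x)"
  by (simp add: L4_def)

lemma noise_map_measurable:
  "(\<lambda>(a, b, c). (sqrt N * a, s1 * b, s2 * (r * b + sqrt (1 - r\<^sup>2) * c)))
    \<in> measurable (std_gauss \<Otimes>\<^sub>M std_gauss \<Otimes>\<^sub>M std_gauss) (borel :: (real \<times> real \<times> real) measure)"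
  by measurable

lemma prob_space_noise_law: "prob_space (noise_law N s1 s2 r)"
proof -
  interpret g: prob_space std_gauss by (rule prob_space_std_gauss)
  interpret gg: pair_prob_space std_gauss std_gauss ..
  interpret ggg: pair_prob_space std_gauss "std_gauss \<Otimes>\<^sub>M std_gauss" ..
  show ?thesis unfolding noise_law_def
    by (rule ggg.prob_space_distr[OF noise_map_measurable])
qed

lemma sets_noise_law [measurable_cong, simp]: "sets (noise_law N s1 s2 r) = sets borel"
  by (simp add: noise_law_def)

lemma space_noise_law [simp]: "space (noise_law N s1 s2 r) = UNIV"
  by (simp add: noise_law_def)

lemma measurable_nlin [measurable]: "nlin a b c \<in> borel_measurable borel"
  unfolding nlin_def borel_prod[symmetric] by measurable

lemma std_gauss_triple_moments:
  fixes p q s p' q' s' :: real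
  defines "G \<equiv> std_gauss \<Otimes>\<^sub>M std_gauss \<Otimes>\<^sub>M std_gauss"
  shows "L4 G (\<lambda>x. p * fst x + q * fst (snd x) + s * snd (snd x))"
    and "(\<integral>x. p * fst x + q * fst (snd x) + s * snd (snd x) \<partial>G) = 0"
    and "(\<integral>x. (p * fst x + q * fst (snd x) + s * snd (snd x))
          * (p' * fst x + q' * fst (snd x) + s' * snd (snd x)) \<partial>G) = p * p' + q * q' + s * s'"
proof -
  let ?g = std_gauss
  interpret g: prob_space std_gauss by (rule prob_space_std_gauss)
  interpret gg: pair_prob_space std_gauss std_gauss ..
  interpret ggg: pair_prob_space std_gauss "std_gauss \<Otimes>\<^sub>M std_gauss" ..
  interpret G: prob_space G unfolding G_def by (rule ggg.prob_space_axioms)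
  note pg = g.prob_space_axioms and pgg = gg.prob_space_axioms
  define X where "X = (\<lambda>x::real \<times> real \<times> real. fst x)"
  define Y where "Y = (\<lambda>x::real \<times> real \<times> real. fst (snd x))"
  define Z where "Z = (\<lambda>x::real \<times> real \<times> real. snd (snd x))"
  have 1: "L4 (?g \<Otimes>\<^sub>M ?g) fst" "L4 (?g \<Otimes>\<^sub>M ?g) snd"
    using L4_pair_fst[OF pg L4_std_gauss] L4_pair_snd[OF pg pg L4_std_gauss] by simp_all
  have X: "L4 G X" unfolding X_def G_def by (rule L4_pair_fst[OF pgg L4_std_gauss])
  have Y: "L4 G Y" and Z: "L4 G Z"
    unfolding Y_def Z_def G_def
    using L4_pair_snd[OF pg pgg 1(1)] L4_pair_snd[OF pg pgg 1(2)] by simp_all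
  have m: "(\<integral>x. fst x \<partial>(?g \<Otimes>\<^sub>M ?g)) = 0" "(\<integral>x. snd x \<partial>(?g \<Otimes>\<^sub>M ?g)) = 0"
    using pair_prob_fst(2)[OF pg, of "\<lambda>x. x" ?g] pair_prob_snd(2)[OF pg pg, of "\<lambda>x. x"]
    by (simp_all add: std_gauss_mean)
  have s: "(\<integral>x. (fst x)\<^sup>2 \<partial>(?g \<Otimes>\<^sub>M ?g)) = 1" "(\<integral>x. (snd x)\<^sup>2 \<partial>(?g \<Otimes>\<^sub>M ?g)) = 1"
    using pair_prob_fst(2)[OF pg, of "\<lambda>x. x\<^sup>2" ?g] pair_prob_snd(2)[OF pg pg, of "\<lambda>x. x\<^sup>2"]
    by (simp_all add: std_gauss_second_moment)
  have c: "(\<integral>x. fst x * snd x \<partial>(?g \<Otimes>\<^sub>M ?g)) = 0"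
    using pair_prob_mult[OF pg pg g.L4_integrable[OF L4_std_gauss] g.L4_integrable[OF L4_std_gauss]]
    by (simp add: std_gauss_mean)
  have EX: "G.expectation X = 0" unfolding X_def G_def
    using pair_prob_fst(2)[OF pgg, of "\<lambda>x. x" ?g] by (simp add: std_gauss_mean)
  have EY: "G.expectation Y = 0" "G.expectation Z = 0" unfolding Y_def Z_def G_def
    using pair_prob_snd(2)[OF pg pgg, of fst] pair_prob_snd(2)[OF pg pgg, of snd] m by simp_all
  have XX: "G.expectation (\<lambda>x. X x * X x) = 1" unfolding X_def G_def
    using pair_prob_fst(2)[OF pgg, of "\<lambda>x. x\<^sup>2" ?g] std_gauss_second_moment by (simp add: power2_eq_square)
  have YY: "G.expectation (\<lambda>x. Y x * Y x) = 1" "G.expectation (\<lambda>x. Z x * Z x) = 1"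
    "G.expectation (\<lambda>x. Y x * Z x) = 0" unfolding Y_def Z_def G_def
    using pair_prob_snd(2)[OF pg pgg, of "\<lambda>x. (fst x)\<^sup>2"] pair_prob_snd(2)[OF pg pgg, of "\<lambda>x. (snd x)\<^sup>2"]
      pair_prob_snd(2)[OF pg pgg, of "\<lambda>x. fst x * snd x"] s c by (simp_all add: power2_eq_square)
  have XY: "G.expectation (\<lambda>x. X x * Y x) = 0" "G.expectation (\<lambda>x. X x * Z x) = 0"
    unfolding X_def Y_def Z_def G_def
    using pair_prob_mult[OF pg pgg g.L4_integrable[OF L4_std_gauss] gg.L4_integrable[OF 1(1)]]
     pair_prob_mult[OF pg pgg g.L4_integrable[OF L4_std_gauss] gg.L4_integrable[OF 1(2)]]
    by (simp_all add: std_gauss_mean)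
  note [simp] = X[THEN G.L4_integrable] Y[THEN G.L4_integrable] Z[THEN G.L4_integrable]
    G.L4_integrable_mult[OF X X] G.L4_integrable_mult[OF X Y] G.L4_integrable_mult[OF X Z]
    G.L4_integrable_mult[OF Y Y] G.L4_integrable_mult[OF Y Z] G.L4_integrable_mult[OF Z Z]
  have "L4 G (\<lambda>x. p * X x + q * Y x + s * Z x)"
    by (intro G.L4_add G.L4_cmult X Y Z)
  thus "L4 G (\<lambda>x. p * fst x + q * fst (snd x) + s * snd (snd x))" by (simp add: X_def Y_def Z_def)
  have "G.expectation (\<lambda>x. p * X x + q * Y x + s * Z x) = 0"
    by (simp add: EX EY)
  thus "(\<integral>x. p * fst x + q * fst (snd x) + s * snd (snd x) \<partial>G) = 0" by (simp add: X_def Y_def Z_def)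
  have "(\<lambda>x. (p * X x + q * Y x + s * Z x) * (p' * X x + q' * Y x + s' * Z x))
    = (\<lambda>x. (p * p') * (X x * X x) + (q * q') * (Y x * Y x) + (s * s') * (Z x * Z x)
        + (p * q' + q * p') * (X x * Y x) + (p * s' + s * p') * (X x * Z x) + (q * s' + s * q') * (Y x * Z x))"
    by (simp add: algebra_simps)
  hence "G.expectation (\<lambda>x. (p * X x + q * Y x + s * Z x) * (p' * X x + q' * Y x + s' * Z x))
    = p * p' + q * q' + s * s'"
    by (simp add: XX YY XY)
  thus "(\<integral>x. (p * fst x + q * fst (snd x) + s * snd (snd x))
          * (p' * fst x + q' * fst (snd x) + s' * snd (snd x)) \<partial>G) = p * p' + q * q' + s * s'"
    by (simp add: X_def Y_def Z_def)
qed

lemma noise_law_moments: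
  fixes N s1 s2 r :: real
  assumes N: "N \<ge> 0" and r: "r\<^sup>2 \<le> 1"
  defines "M \<equiv> noise_law N s1 s2 r"
  shows "L4 M (nlin a b c)"
    and "(\<integral>x. nlin a b c x \<partial>M) = 0"
    and "(\<integral>x. nlin a b c x * nlin a' b' c' x \<partial>M) = ncov N s1 s2 r a b c a' b' c'"
proof -
  let ?G = "std_gauss \<Otimes>\<^sub>M std_gauss \<Otimes>\<^sub>M std_gauss"
  define \<phi> where "\<phi> = (\<lambda>(a, b, c). (sqrt N * a, s1 * b, s2 * (r * b + sqrt (1 - r\<^sup>2) * c)))"
  have \<phi>: "\<phi> \<in> measurable ?G borel" unfolding \<phi>_def by (rule noise_map_measurable)
  have M: "M = distr ?G borel \<phi>" by (simp add: M_def noise_law_def \<phi>_def)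
  \<comment> \<open>A linear functional of the noise pulls back to one of three independent standard
    normals, whose moments are known.\<close>
  have lin: "nlin a b c (\<phi> x) = (a * sqrt N) * fst x + (b * s1 + c * s2 * r) * fst (snd x)
      + (c * s2 * sqrt (1 - r\<^sup>2)) * snd (snd x)" for a b c x
    by (cases x) (simp add: \<phi>_def nlin_def algebra_simps)
  note mom = std_gauss_triple_moments[where p = "a * sqrt N" and q = "b * s1 + c * s2 * r" and s = "c * s2 * sqrt (1 - r\<^sup>2)",
      folded lin]
  show "L4 M (nlin a b c)" unfolding L4_def
  proof
    show "nlin a b c \<in> borel_measurable M" unfolding M by simp
    have "integrable ?G (\<lambda>x. nlin a b c (\<phi> x) ^ 4)" using mom(1) by (simp add: L4_def)
    thus "integrable M (\<lambda>x. nlin a b c x ^ 4)" unfolding M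
      by (subst integrable_distr_eq[OF \<phi>]) auto
  qed
  show "(\<integral>x. nlin a b c x \<partial>M) = 0" unfolding M
    by (subst integral_distr[OF \<phi>]) (use mom(2) in auto)
  have "(\<integral>x. nlin a b c x * nlin a' b' c' x \<partial>M)
    = a * sqrt N * (a' * sqrt N) + (b * s1 + c * s2 * r) * (b' * s1 + c' * s2 * r)
     + c * s2 * sqrt (1 - r\<^sup>2) * (c' * s2 * sqrt (1 - r\<^sup>2))" unfolding M
    by (subst integral_distr[OF \<phi>])
       (use mom(3)[of "a' * sqrt N" "b' * s1 + c' * s2 * r" "c' * s2 * sqrt (1 - r\<^sup>2)", folded lin] in auto)
  also have "a * sqrt N * (a' * sqrt N) = N * a * a'" using N by simp
  also have "c * s2 * sqrt (1 - r\<^sup>2) * (c' * s2 * sqrt (1 - r\<^sup>2)) = c * c' * s2\<^sup>2 * (1 - r\<^sup>2)"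
    using r by (simp add: power2_eq_square)
  finally show "(\<integral>x. nlin a b c x * nlin a' b' c' x \<partial>M) = ncov N s1 s2 r a b c a' b' c'"
    by (simp add: ncov_def algebra_simps power2_eq_square)
qed

section \<open>Linear functionals of one block of the noise\<close>

abbreviation noise_prod :: "real \<Rightarrow> real \<Rightarrow> real \<Rightarrow> real \<Rightarrow> nat \<Rightarrow> (nat \<Rightarrow> real \<times> real \<times> real) measure" where
  "noise_prod N s1 s2 r n \<equiv> PiM {..<n} (\<lambda>_. noise_law N s1 s2 r)"

lemma prob_space_noise_prod: "prob_space (noise_prod N s1 s2 r n)"
  by (intro prob_space_PiM prob_space_noise_law)

definition blin :: "nat \<Rightarrow> (nat \<Rightarrow> real) \<Rightarrow> (nat \<Rightarrow> real) \<Rightarrow> (nat \<Rightarrow> real) \<Rightarrow> nat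
    \<Rightarrow> (nat \<Rightarrow> real \<times> real \<times> real) \<Rightarrow> real" where
  "blin \<eta> \<alpha> \<beta> \<gamma> l g = (\<Sum>j<\<eta>. nlin (\<alpha> j) (\<beta> j) (\<gamma> j) (g (l * \<eta> + j)))"

lemma block_index_less: "l < L \<Longrightarrow> j < \<eta> \<Longrightarrow> L * \<eta> \<le> n \<Longrightarrow> l * \<eta> + j < n" for l L j \<eta> n :: nat
proof -
  assume a: "l < L" "j < \<eta>" "L * \<eta> \<le> n"
  have "(l + 1) * \<eta> \<le> L * \<eta>" using a by (intro mult_right_mono) auto
  thus ?thesis using a by (simp add: algebra_simps)
qed

lemma blin_measurable [measurable]:
  assumes "l < L" "L * \<eta> \<le> n"
  shows "blin \<eta> \<alpha> \<beta> \<gamma> l \<in> borel_measurable (noise_prod N s1 s2 r n)"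
  unfolding blin_def[abs_def]
proof (intro borel_measurable_sum)
  fix j assume "j \<in> {..<\<eta>}"
  hence "l * \<eta> + j \<in> {..<n}" using block_index_less assms by auto
  hence "(\<lambda>g. g (l * \<eta> + j)) \<in> measurable (noise_prod N s1 s2 r n) (noise_law N s1 s2 r)"
    by (rule measurable_component_singleton)
  thus "(\<lambda>g. nlin (\<alpha> j) (\<beta> j) (\<gamma> j) (g (l * \<eta> + j))) \<in> borel_measurable (noise_prod N s1 s2 r n)"
    by (rule measurable_compose) measurable
qed

text \<open>The coordinates of a block of an IID sequence have the law of a sequence of length
  \<open>\<eta>\<close>, so block moments depend neither on \<open>l\<close> nor on
  \<open>n\<close>.\<close>

lemma noise_prod_block:
  fixes f :: "(nat \<Rightarrow> real \<times> real \<times> real) \<Rightarrow> real"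
  assumes "l < L" "L * \<eta> \<le> n" and f: "f \<in> borel_measurable (noise_prod N s1 s2 r \<eta>)"
  shows "integrable (noise_prod N s1 s2 r n) (\<lambda>g. f (\<lambda>j\<in>{..<\<eta>}. g (l * \<eta> + j)))
      \<longleftrightarrow> integrable (noise_prod N s1 s2 r \<eta>) f"
    and "(\<integral>g. f (\<lambda>j\<in>{..<\<eta>}. g (l * \<eta> + j)) \<partial>noise_prod N s1 s2 r n) = (\<integral>h. f h \<partial>noise_prod N s1 s2 r \<eta>)"
proof -
  let ?t = "\<lambda>g. \<lambda>j\<in>{..<\<eta>}. g (l * \<eta> + j)"
  have inj: "inj_on (\<lambda>j. l * \<eta> + j) {..<\<eta>}" "(\<lambda>j. l * \<eta> + j) \<in> {..<\<eta>} \<rightarrow> {..<n}"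
    using block_index_less[OF assms(1) _ assms(2)] by (auto simp: inj_on_def)
  have d: "distr (noise_prod N s1 s2 r n) (noise_prod N s1 s2 r \<eta>) ?t = noise_prod N s1 s2 r \<eta>"
    using distr_PiM_reindex[where M = "\<lambda>_. noise_law N s1 s2 r", OF prob_space_noise_law inj] by simp
  have t: "?t \<in> measurable (noise_prod N s1 s2 r n) (noise_prod N s1 s2 r \<eta>)"
    using inj(2) by (intro measurable_restrict measurable_component_singleton) auto
  show "integrable (noise_prod N s1 s2 r n) (\<lambda>g. f (?t g)) \<longleftrightarrow> integrable (noise_prod N s1 s2 r \<eta>) f"
    using integrable_distr_eq[OF t f] d by simp
  show "(\<integral>g. f (?t g) \<partial>noise_prod N s1 s2 r n) = (\<integral>h. f h \<partial>noise_prod N s1 s2 r \<eta>)"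
    using integral_distr[OF t f] d by simp
qed

lemma blin_shift: "blin \<eta> \<alpha> \<beta> \<gamma> l g = blin \<eta> \<alpha> \<beta> \<gamma> 0 (\<lambda>j\<in>{..<\<eta>}. g (l * \<eta> + j))"
  by (simp add: blin_def)

lemma blin_moments0:
  assumes N: "N \<ge> 0" and r: "r\<^sup>2 \<le> 1"
  shows "L4 (noise_prod N s1 s2 r \<eta>) (blin \<eta> \<alpha> \<beta> \<gamma> 0)"
    and "(\<integral>g. blin \<eta> \<alpha> \<beta> \<gamma> 0 g \<partial>noise_prod N s1 s2 r \<eta>) = 0"
    and "(\<integral>g. blin \<eta> \<alpha> \<beta> \<gamma> 0 g * blin \<eta> \<alpha>' \<beta>' \<gamma>' 0 g \<partial>noise_prod N s1 s2 r \<eta>)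
      = (\<Sum>j<\<eta>. ncov N s1 s2 r (\<alpha> j) (\<beta> j) (\<gamma> j) (\<alpha>' j) (\<beta>' j) (\<gamma>' j))"
proof -
  let ?M = "noise_prod N s1 s2 r \<eta>" and ?N = "noise_law N s1 s2 r"
  interpret M: prob_space ?M by (rule prob_space_noise_prod)
  note mom = noise_law_moments[OF N r, where ?s1.0=s1 and ?s2.0=s2]
  define f where "f = (\<lambda>j. nlin (\<alpha> j) (\<beta> j) (\<gamma> j))"
  define f' where "f' = (\<lambda>j. nlin (\<alpha>' j) (\<beta>' j) (\<gamma>' j))"
  have b: "blin \<eta> \<alpha> \<beta> \<gamma> 0 = (\<lambda>g. \<Sum>j<\<eta>. f j (g j))" "blin \<eta> \<alpha>' \<beta>' \<gamma>' 0 = (\<lambda>g. \<Sum>j<\<eta>. f' j (g j))"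
    by (auto simp: blin_def f_def f'_def)
  have comp: "L4 ?M (\<lambda>g. nlin a b c (g j))" "M.expectation (\<lambda>g. nlin a b c (g j)) = 0"
    "M.expectation (\<lambda>g. nlin a b c (g j) * nlin a' b' c' (g j)) = ncov N s1 s2 r a b c a' b' c'"
    if "j < \<eta>" for j a b c a' b' c'
  proof -
    note pc = integral_prob_PiM_component[where M = "\<lambda>_. ?N" and I = "{..<\<eta>}" and i = j, OF prob_space_noise_law]
    show "L4 ?M (\<lambda>g. nlin a b c (g j))"
      using pc(1)[of "\<lambda>x. nlin a b c x ^ 4"] mom(1)[of a b c] that by (auto simp: L4_def)
    show "M.expectation (\<lambda>g. nlin a b c (g j)) = 0"
      using pc(2)[of "nlin a b c"] mom(2)[of a b c] that by auto
    show "M.expectation (\<lambda>g. nlin a b c (g j) * nlin a' b' c' (g j)) = ncov N s1 s2 r a b c a' b' c'"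
      using pc(2)[of "\<lambda>x. nlin a b c x * nlin a' b' c' x"] mom(3)[of a b c a' b' c'] that by auto
  qed
  have L: "L4 ?M (\<lambda>g. f j (g j))" "L4 ?M (\<lambda>g. f' j (g j))" if "j < \<eta>" for j
    unfolding f_def f'_def by (rule comp(1)[OF that])+
  show "L4 ?M (blin \<eta> \<alpha> \<beta> \<gamma> 0)" unfolding b by (intro M.L4_sum L) auto
  show "M.expectation (blin \<eta> \<alpha> \<beta> \<gamma> 0) = 0"
    unfolding b using L comp(2) by (subst Bochner_Integration.integral_sum) (auto intro: M.L4_integrable simp: f_def)
  \<comment> \<open>Distinct coordinates are independent and centered, so only the diagonal
    survives.\<close>
  have cross: "M.expectation (\<lambda>g. f i (g i) * f' j (g j)) =
      (if i = j then ncov N s1 s2 r (\<alpha> j) (\<beta> j) (\<gamma> j) (\<alpha>' j) (\<beta>' j) (\<gamma>' j) else 0)"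
    if ij: "i < \<eta>" "j < \<eta>" for i j
  proof (cases "i = j")
    case True thus ?thesis using comp(3)[OF ij(2)] by (simp add: f_def f'_def)
  next
    case False
    have "M.indep_vars (\<lambda>_. ?N) (\<lambda>k g. g k) {..<\<eta>}"
      by (rule indep_vars_PiM_projections) (use ij prob_space_noise_law in auto)
    hence "M.indep_vars (\<lambda>_. ?N) (\<lambda>k g. g k) {i, j}" by (rule M.indep_vars_subset) (use ij in auto)
    hence ind: "M.indep_vars (\<lambda>_. borel) (\<lambda>k g. (if k = i then f i else f' j) (g k)) {i, j}"
      by (rule M.indep_vars_compose2) (auto simp: f_def f'_def)
    have "M.expectation (\<lambda>g. \<Prod>k\<in>{i, j}. (if k = i then f i else f' j) (g k))
       = (\<Prod>k\<in>{i, j}. M.expectation (\<lambda>g. (if k = i then f i else f' j) (g k)))"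
      by (rule M.indep_vars_lebesgue_integral[OF _ ind]) (use L ij in \<open>auto intro: M.L4_integrable\<close>)
    thus ?thesis using False comp(2)[OF ij(1)] by (simp add: f_def)
  qed
  have "M.expectation (\<lambda>g. blin \<eta> \<alpha> \<beta> \<gamma> 0 g * blin \<eta> \<alpha>' \<beta>' \<gamma>' 0 g)
      = M.expectation (\<lambda>g. \<Sum>i<\<eta>. \<Sum>j<\<eta>. f i (g i) * f' j (g j))"
    unfolding b by (simp add: sum_product)
  also have "\<dots> = (\<Sum>i<\<eta>. M.expectation (\<lambda>g. \<Sum>j<\<eta>. f i (g i) * f' j (g j)))"
    by (rule Bochner_Integration.integral_sum) (use M.L4_integrable_mult[OF L(1) L(2)] in auto)
  also have "\<dots> = (\<Sum>i<\<eta>. \<Sum>j<\<eta>. M.expectation (\<lambda>g. f i (g i) * f' j (g j)))"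
    by (intro sum.cong refl Bochner_Integration.integral_sum) (use M.L4_integrable_mult[OF L(1) L(2)] in auto)
  also have "\<dots> = (\<Sum>i<\<eta>. \<Sum>j<\<eta>. (if i = j then ncov N s1 s2 r (\<alpha> j) (\<beta> j) (\<gamma> j) (\<alpha>' j) (\<beta>' j) (\<gamma>' j) else 0))"
    by (intro sum.cong refl cross) auto
  also have "\<dots> = (\<Sum>j<\<eta>. ncov N s1 s2 r (\<alpha> j) (\<beta> j) (\<gamma> j) (\<alpha>' j) (\<beta>' j) (\<gamma>' j))" by simp
  finally show "M.expectation (\<lambda>g. blin \<eta> \<alpha> \<beta> \<gamma> 0 g * blin \<eta> \<alpha>' \<beta>' \<gamma>' 0 g) = \<dots>" .
qed

text \<open>Identifying the fourth moment with that of block zero makes the later Chebyshev bound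
  uniform in the block and in the blocklength.\<close>

lemma blin_moments:
  assumes N: "N \<ge> 0" and r: "r\<^sup>2 \<le> 1" and l: "l < L" "L * \<eta> \<le> n"
  shows "L4 (noise_prod N s1 s2 r n) (blin \<eta> \<alpha> \<beta> \<gamma> l)"
    and "(\<integral>g. blin \<eta> \<alpha> \<beta> \<gamma> l g \<partial>noise_prod N s1 s2 r n) = 0"
    and "(\<integral>g. blin \<eta> \<alpha> \<beta> \<gamma> l g * blin \<eta> \<alpha>' \<beta>' \<gamma>' l g \<partial>noise_prod N s1 s2 r n)
      = (\<Sum>j<\<eta>. ncov N s1 s2 r (\<alpha> j) (\<beta> j) (\<gamma> j) (\<alpha>' j) (\<beta>' j) (\<gamma>' j))"
    and "(\<integral>g. blin \<eta> \<alpha> \<beta> \<gamma> l g ^ 4 \<partial>noise_prod N s1 s2 r n) = (\<integral>g. blin \<eta> \<alpha> \<beta> \<gamma> 0 g ^ 4 \<partial>noise_prod N s1 s2 r \<eta>)"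
proof -
  note m0 = blin_moments0[OF N r, where ?s1.0=s1 and ?s2.0=s2 and \<eta>=\<eta>]
  have meas: "blin \<eta> \<alpha> \<beta> \<gamma> 0 \<in> borel_measurable (noise_prod N s1 s2 r \<eta>)" for \<alpha> \<beta> \<gamma>
    using m0(1) by auto
  note [measurable] = meas
  note nb = noise_prod_block[OF l, where N=N and ?s1.0=s1 and ?s2.0=s2 and r=r]
  show "L4 (noise_prod N s1 s2 r n) (blin \<eta> \<alpha> \<beta> \<gamma> l)" unfolding L4_def
  proof
    show "blin \<eta> \<alpha> \<beta> \<gamma> l \<in> borel_measurable (noise_prod N s1 s2 r n)" by (rule blin_measurable[OF l])
    show "integrable (noise_prod N s1 s2 r n) (\<lambda>g. blin \<eta> \<alpha> \<beta> \<gamma> l g ^ 4)"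
      unfolding blin_shift[of _ _ _ _ l] using nb(1)[of "\<lambda>h. blin \<eta> \<alpha> \<beta> \<gamma> 0 h ^ 4"] m0(1)[of \<alpha> \<beta> \<gamma>]
      by (auto simp: L4_def)
  qed
  show "(\<integral>g. blin \<eta> \<alpha> \<beta> \<gamma> l g \<partial>noise_prod N s1 s2 r n) = 0"
    unfolding blin_shift[of _ _ _ _ l] using nb(2)[of "blin \<eta> \<alpha> \<beta> \<gamma> 0"] m0(2)[of \<alpha> \<beta> \<gamma>] by auto
  show "(\<integral>g. blin \<eta> \<alpha> \<beta> \<gamma> l g * blin \<eta> \<alpha>' \<beta>' \<gamma>' l g \<partial>noise_prod N s1 s2 r n)
      = (\<Sum>j<\<eta>. ncov N s1 s2 r (\<alpha> j) (\<beta> j) (\<gamma> j) (\<alpha>' j) (\<beta>' j) (\<gamma>' j))"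
    unfolding blin_shift[of _ _ _ _ l]
    using nb(2)[of "\<lambda>h. blin \<eta> \<alpha> \<beta> \<gamma> 0 h * blin \<eta> \<alpha>' \<beta>' \<gamma>' 0 h"] m0(3)[of \<alpha> \<beta> \<gamma> \<alpha>' \<beta>' \<gamma>'] by auto
  show "(\<integral>g. blin \<eta> \<alpha> \<beta> \<gamma> l g ^ 4 \<partial>noise_prod N s1 s2 r n) = (\<integral>g. blin \<eta> \<alpha> \<beta> \<gamma> 0 g ^ 4 \<partial>noise_prod N s1 s2 r \<eta>)"
    unfolding blin_shift[of _ _ _ _ l] by (rule nb(2)) auto
qed

text \<open>Different blocks read disjoint sets of coordinates. The two functionals are kept as a
  pair because they may be dependent within a block.\<close>

lemma indep_vars_blin:
  assumes \<eta>: "0 < \<eta>" and L: "0 < L" "L * \<eta> \<le> n"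
  shows "prob_space.indep_vars (noise_prod N s1 s2 r n) (\<lambda>_. borel \<Otimes>\<^sub>M borel)
    (\<lambda>l g. (blin \<eta> \<alpha> \<beta> \<gamma> l g, blin \<eta> \<alpha>' \<beta>' \<gamma>' l g)) {..<L}"
proof -
  let ?N = "noise_law N s1 s2 r"
  interpret M: prob_space "noise_prod N s1 s2 r n" by (rule prob_space_noise_prod)
  define K where "K = (\<lambda>l. {l * \<eta> ..< l * \<eta> + \<eta>})"
  show ?thesis
  proof -
    have "0 < L * \<eta>" using L \<eta> by simp
    hence ne: "{..<n} \<noteq> {}" using L(2) by (metis lessThan_iff empty_iff less_le_trans)
    have 1: "M.indep_vars (\<lambda>_. ?N) (\<lambda>k g. g k) {..<n}"
      by (rule indep_vars_PiM_projections[OF prob_space_noise_law ne])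
    have sub: "K l \<subseteq> {..<n}" if "l < L" for l
    proof
      fix t assume "t \<in> K l"
      thus "t \<in> {..<n}" using block_index_less[OF that _ L(2), of "t - l * \<eta>"] by (auto simp: K_def)
    qed
    have disj: "disjoint_family_on K {..<L}"
    proof (unfold disjoint_family_on_def, intro ballI impI)
      fix i j :: nat assume "i \<noteq> j"
      { fix i j :: nat assume "i < j"
        hence "(i + 1) * \<eta> \<le> j * \<eta>" by (intro mult_right_mono) auto
        hence "K i \<inter> K j = {}" by (auto simp: K_def algebra_simps) }
      thus "K i \<inter> K j = {}" using \<open>i \<noteq> j\<close> by (metis inf_commute nat_neq_iff)
    qed
    have 2: "M.indep_vars (\<lambda>l. PiM (K l) (\<lambda>_. ?N)) (\<lambda>l g. restrict (\<lambda>i. g i) (K l)) {..<L}"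
      by (rule M.indep_vars_restrict[OF 1 _ disj]) (use sub in auto)
    have "M.indep_vars (\<lambda>_. borel \<Otimes>\<^sub>M borel)
      (\<lambda>l g. (\<lambda>h. (blin \<eta> \<alpha> \<beta> \<gamma> l h, blin \<eta> \<alpha>' \<beta>' \<gamma>' l h)) (restrict (\<lambda>i. g i) (K l))) {..<L}"
    proof (rule M.indep_vars_compose2[OF 2])
      fix l
      have [measurable]: "blin \<eta> \<alpha> \<beta> \<gamma> l \<in> borel_measurable (PiM (K l) (\<lambda>_. ?N))" for \<alpha> \<beta> \<gamma>
        unfolding blin_def[abs_def]
      proof (intro borel_measurable_sum)
        fix j assume "j \<in> {..<\<eta>}"
        hence "(\<lambda>g. g (l * \<eta> + j)) \<in> measurable (PiM (K l) (\<lambda>_. ?N)) ?N"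
          by (intro measurable_component_singleton) (auto simp: K_def)
        thus "(\<lambda>g. nlin (\<alpha> j) (\<beta> j) (\<gamma> j) (g (l * \<eta> + j))) \<in> borel_measurable (PiM (K l) (\<lambda>_. ?N))"
          by (rule measurable_compose) measurable
      qed
      show "(\<lambda>h. (blin \<eta> \<alpha> \<beta> \<gamma> l h, blin \<eta> \<alpha>' \<beta>' \<gamma>' l h)) \<in> measurable (PiM (K l) (\<lambda>_. ?N)) (borel \<Otimes>\<^sub>M borel)"
        by measurable
    qed
    also have "(\<lambda>l g. (\<lambda>h. (blin \<eta> \<alpha> \<beta> \<gamma> l h, blin \<eta> \<alpha>' \<beta>' \<gamma>' l h)) (restrict (\<lambda>i. g i) (K l)))
      = (\<lambda>l g. (blin \<eta> \<alpha> \<beta> \<gamma> l g, blin \<eta> \<alpha>' \<beta>' \<gamma>' l g))"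
      by (auto simp: blin_def K_def fun_eq_iff)
    finally show ?thesis .
  qed
qed

section \<open>Empirical second moments\<close>

text \<open>Numbering the inputs and the filtered noises turns the second moments of a block into a
  4 x 4 table. Every index from 3 on reads the last letter.\<close>

definition letter :: "nat \<Rightarrow> real \<times> real \<times> real \<times> real \<Rightarrow> real" where
  "letter a e = (case e of (x1, x2, v1, v2) \<Rightarrow>
     if a = 0 then x1 else if a = 1 then x2 else if a = 2 then v1 else v2)"

text \<open>On indices below 4 this is the block diagonal matrix with blocks I and G.\<close>

definition letter_cov :: "real \<Rightarrow> real \<Rightarrow> real \<Rightarrow> nat \<Rightarrow> nat \<Rightarrow> real" where
  "letter_cov g1 g2 h a b =
     (if a < 2 \<or> b < 2 then (if a = b then 1 else 0)
      else if a = b then (if a = 2 then g1 else g2) else h)"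

lemma letter_measurable [measurable]:
  "letter a \<in> borel_measurable (borel \<Otimes>\<^sub>M borel \<Otimes>\<^sub>M borel \<Otimes>\<^sub>M borel)"
  unfolding letter_def[abs_def] by measurable

abbreviation word_space :: "nat \<Rightarrow> (nat \<Rightarrow> real) measure" where
  "word_space L \<equiv> PiM {..<L} (\<lambda>_. std_gauss)"

lemma prob_space_word_space: "prob_space (word_space L)"
  by (intro prob_space_PiM prob_space_std_gauss)

text \<open>The argument lists, for each use of a block, both inputs followed by both matched-filter noises.\<close>
definition discrepancy :: "(nat \<Rightarrow> nat \<Rightarrow> real) \<Rightarrow> nat \<Rightarrow> (nat \<Rightarrow> real \<times> real \<times> real \<times> real) \<Rightarrow> real" where
  "discrepancy K L e =
     (\<Sum>a<4. \<Sum>b<4. (\<Sum>l<L. letter a (e l) * letter b (e l) - K a b)\<^sup>2)"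

lemma discrepancy_nonneg: "0 \<le> discrepancy K L e"
  by (simp add: discrepancy_def sum_nonneg)

text \<open>Two functionals of the noise of a block, given by their coefficients on Z, W1 and W2;
  \<open>g1\<close>, \<open>g2\<close> and \<open>h\<close> are the entries of their covariance
  matrix G. Encoders do not occur here, so the coding argument can be carried out before the
  feedback scheme is introduced.\<close>

locale noise_filters =
  fixes N s1 s2 r :: real and \<eta> :: nat
    and \<alpha>1 \<beta>1 \<gamma>1 \<alpha>2 \<beta>2 \<gamma>2 :: "nat \<Rightarrow> real" and g1 g2 h :: real
  assumes N: "0 \<le> N" and r: "r\<^sup>2 \<le> 1" and \<eta>: "0 < \<eta>"
    and cov11: "(\<Sum>j<\<eta>. ncov N s1 s2 r (\<alpha>1 j) (\<beta>1 j) (\<gamma>1 j) (\<alpha>1 j) (\<beta>1 j) (\<gamma>1 j)) = g1"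
    and cov22: "(\<Sum>j<\<eta>. ncov N s1 s2 r (\<alpha>2 j) (\<beta>2 j) (\<gamma>2 j) (\<alpha>2 j) (\<beta>2 j) (\<gamma>2 j)) = g2"
    and cov12: "(\<Sum>j<\<eta>. ncov N s1 s2 r (\<alpha>1 j) (\<beta>1 j) (\<gamma>1 j) (\<alpha>2 j) (\<beta>2 j) (\<gamma>2 j)) = h"
begin

definition v1 where "v1 l g = blin \<eta> \<alpha>1 \<beta>1 \<gamma>1 l g"
definition v2 where "v2 l g = blin \<eta> \<alpha>2 \<beta>2 \<gamma>2 l g"

abbreviation noise :: "nat \<Rightarrow> (nat \<Rightarrow> real \<times> real \<times> real) measure" where
  "noise n \<equiv> noise_prod N s1 s2 r n"

definition letters :: "(nat \<Rightarrow> real) \<Rightarrow> (nat \<Rightarrow> real) \<Rightarrow> (nat \<Rightarrow> real \<times> real \<times> real) \<Rightarrow> nat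
    \<Rightarrow> real \<times> real \<times> real \<times> real" where
  "letters x1 x2 g l = (x1 l, x2 l, v1 l g, v2 l g)"

text \<open>A sum in place of a maximum: each letter is of one of these three kinds, and all terms
  are nonnegative.\<close>

definition m4 where
  "m4 = (\<integral>x. x ^ 4 \<partial>std_gauss) + (\<integral>g. v1 0 g ^ 4 \<partial>noise \<eta>) + (\<integral>g. v2 0 g ^ 4 \<partial>noise \<eta>)"

text \<open>\<open>letter\<close> identifies all indices from 3 on while \<open>letter_cov\<close>
  compares its indices, hence \<open>min a 3\<close> and \<open>min b 3\<close> in the
  covariance.\<close>

lemma letter_moments:
  assumes l: "l < L" "L * \<eta> \<le> n"
  defines "\<Omega> \<equiv> word_space L \<Otimes>\<^sub>M word_space L \<Otimes>\<^sub>M noise n"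
  defines "e \<equiv> \<lambda>a \<omega>. letter a (letters (fst \<omega>) (fst (snd \<omega>)) (snd (snd \<omega>)) l)"
  shows "L4 \<Omega> (e a)" and "(\<integral>\<omega>. e a \<omega> ^ 4 \<partial>\<Omega>) \<le> m4"
    and "(\<integral>\<omega>. e a \<omega> * e b \<omega> \<partial>\<Omega>) = letter_cov g1 g2 h (min a 3) (min b 3)"
proof -
  let ?W = "word_space L" and ?N = "noise n"
  have W: "prob_space ?W" by (rule prob_space_word_space)
  have Nn: "prob_space ?N" by (rule prob_space_noise_prod)
  have WN: "prob_space (?W \<Otimes>\<^sub>M ?N)" by (rule prob_space_pair[OF W Nn])
  have O: "prob_space \<Omega>" unfolding \<Omega>_def by (rule prob_space_pair[OF W WN])
  interpret W: prob_space ?W by (rule W)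
  interpret Nn: prob_space ?N by (rule Nn)
  interpret WN: prob_space "?W \<Otimes>\<^sub>M ?N" by (rule WN)
  interpret O: prob_space \<Omega> by (rule O)
  define x where "x = (\<lambda>w :: nat \<Rightarrow> real. w l)"
  have pc: "integrable ?W (\<lambda>w. f (w l)) = integrable std_gauss f"
    "(\<integral>w. f (w l) \<partial>?W) = (\<integral>x. f x \<partial>std_gauss)" if "f \<in> borel_measurable borel" for f :: "real \<Rightarrow> real"
    using integral_prob_PiM_component[where M = "\<lambda>_. std_gauss" and I = "{..<L}" and i = l and f = f,
      OF prob_space_std_gauss] that l by auto
  have "(\<lambda>w. w l) \<in> measurable ?W std_gauss" using l by (intro measurable_component_singleton) auto
  hence xm: "x \<in> borel_measurable ?W" unfolding x_def
    by (rule measurable_compose[where g = "\<lambda>x. x"]) measurable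
  have xL: "L4 ?W x" using pc(1)[of "\<lambda>x. x ^ 4"] xm by (auto simp: L4_def x_def)
  have xE: "W.expectation x = 0" using pc(2)[of "\<lambda>x. x"] by (simp add: x_def std_gauss_mean)
  have xx: "W.expectation (\<lambda>w. x w * x w) = 1"
    using pc(2)[of "\<lambda>x. x\<^sup>2"] std_gauss_second_moment by (simp add: x_def power2_eq_square)
  have x4: "W.expectation (\<lambda>w. x w ^ 4) = (\<integral>x. x ^ 4 \<partial>std_gauss)"
    using pc(2)[of "\<lambda>x. x ^ 4"] by (simp add: x_def)
  note bm = blin_moments[OF N r l, where ?s1.0=s1 and ?s2.0=s2]
  have vL: "L4 ?N (v1 l)" "L4 ?N (v2 l)" unfolding v1_def[abs_def] v2_def[abs_def] by (rule bm(1))+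
  have vE: "Nn.expectation (v1 l) = 0" "Nn.expectation (v2 l) = 0"
    unfolding v1_def[abs_def] v2_def[abs_def] by (rule bm(2))+
  have vv: "Nn.expectation (\<lambda>g. v1 l g * v1 l g) = g1" "Nn.expectation (\<lambda>g. v2 l g * v2 l g) = g2"
    "Nn.expectation (\<lambda>g. v1 l g * v2 l g) = h"
    unfolding v1_def[abs_def] v2_def[abs_def] bm(3) by (rule cov11 cov22 cov12)+
  have v4: "Nn.expectation (\<lambda>g. v1 l g ^ 4) = (\<integral>g. v1 0 g ^ 4 \<partial>noise \<eta>)"
    "Nn.expectation (\<lambda>g. v2 l g ^ 4) = (\<integral>g. v2 0 g ^ 4 \<partial>noise \<eta>)"
    unfolding v1_def[abs_def] v2_def[abs_def] by (rule bm(4))+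
  note ms [measurable] = xm vL[THEN L4_measurable]
  have q2: "L4 (?W \<Otimes>\<^sub>M ?N) (\<lambda>p. x (fst p))" "L4 (?W \<Otimes>\<^sub>M ?N) (\<lambda>p. v1 l (snd p))" "L4 (?W \<Otimes>\<^sub>M ?N) (\<lambda>p. v2 l (snd p))"
    by (intro L4_pair_fst L4_pair_snd W Nn xL vL)+
  define e0 where "e0 = (\<lambda>\<omega> :: (nat \<Rightarrow> real) \<times> (nat \<Rightarrow> real) \<times> (nat \<Rightarrow> real \<times> real \<times> real). x (fst \<omega>))"
  define e1 where "e1 = (\<lambda>\<omega> :: (nat \<Rightarrow> real) \<times> (nat \<Rightarrow> real) \<times> (nat \<Rightarrow> real \<times> real \<times> real). x (fst (snd \<omega>)))"
  define e2 where "e2 = (\<lambda>\<omega> :: (nat \<Rightarrow> real) \<times> (nat \<Rightarrow> real) \<times> (nat \<Rightarrow> real \<times> real \<times> real). v1 l (snd (snd \<omega>)))"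
  define e3 where "e3 = (\<lambda>\<omega> :: (nat \<Rightarrow> real) \<times> (nat \<Rightarrow> real) \<times> (nat \<Rightarrow> real \<times> real \<times> real). v2 l (snd (snd \<omega>)))"
  have eL: "L4 \<Omega> e0" "L4 \<Omega> e1" "L4 \<Omega> e2" "L4 \<Omega> e3"
    unfolding \<Omega>_def e0_def e1_def e2_def e3_def
    using L4_pair_fst[OF WN xL] L4_pair_snd[OF W WN q2(1)] L4_pair_snd[OF W WN q2(2)] L4_pair_snd[OF W WN q2(3)]
    by simp_all
  have e: "e a = (if a = 0 then e0 else if a = 1 then e1 else if a = 2 then e2 else e3)" for a
    by (auto simp: e_def letter_def letters_def e0_def e1_def e2_def e3_def x_def fun_eq_iff)
  show "L4 \<Omega> (e a)" unfolding e using eL by simp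
  have P1: "(\<integral>\<omega>. f (fst \<omega>) \<partial>\<Omega>) = (\<integral>w. f w \<partial>?W)" if "f \<in> borel_measurable ?W" for f :: "_ \<Rightarrow> real"
    unfolding \<Omega>_def by (rule pair_prob_fst(2)[OF WN that])
  have P2: "(\<integral>\<omega>. f (snd \<omega>) \<partial>\<Omega>) = (\<integral>w. f w \<partial>(?W \<Otimes>\<^sub>M ?N))" if "f \<in> borel_measurable (?W \<Otimes>\<^sub>M ?N)" for f :: "_ \<Rightarrow> real"
    unfolding \<Omega>_def by (rule pair_prob_snd(2)[OF W WN that])
  have P21: "(\<integral>\<omega>. f (fst (snd \<omega>)) \<partial>\<Omega>) = (\<integral>w. f w \<partial>?W)" if [measurable]: "f \<in> borel_measurable ?W" for f :: "_ \<Rightarrow> real"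
    using P2[of "\<lambda>p. f (fst p)"] pair_prob_fst(2)[OF Nn that] by simp
  have P22: "(\<integral>\<omega>. f (snd (snd \<omega>)) \<partial>\<Omega>) = (\<integral>w. f w \<partial>?N)" if [measurable]: "f \<in> borel_measurable ?N" for f :: "_ \<Rightarrow> real"
    using P2[of "\<lambda>p. f (snd p)"] pair_prob_snd(2)[OF W Nn that] by simp
  have nn: "0 \<le> (\<integral>x. x ^ 4 \<partial>std_gauss)" "0 \<le> (\<integral>g. v1 0 g ^ 4 \<partial>noise \<eta>)" "0 \<le> (\<integral>g. v2 0 g ^ 4 \<partial>noise \<eta>)"
    by (auto intro!: integral_nonneg_AE)
  have "O.expectation (\<lambda>\<omega>. e0 \<omega> ^ 4) \<le> m4" "O.expectation (\<lambda>\<omega>. e1 \<omega> ^ 4) \<le> m4"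
    "O.expectation (\<lambda>\<omega>. e2 \<omega> ^ 4) \<le> m4" "O.expectation (\<lambda>\<omega>. e3 \<omega> ^ 4) \<le> m4"
    using P1[of "\<lambda>w. x w ^ 4"] P21[of "\<lambda>w. x w ^ 4"] P22[of "\<lambda>w. v1 l w ^ 4"] P22[of "\<lambda>w. v2 l w ^ 4"] nn
    unfolding e0_def e1_def e2_def e3_def m4_def by (simp_all add: x4 v4)
  thus "O.expectation (\<lambda>\<omega>. e a \<omega> ^ 4) \<le> m4" unfolding e by simp
  have d: "O.expectation (\<lambda>\<omega>. e0 \<omega> * e0 \<omega>) = 1" "O.expectation (\<lambda>\<omega>. e1 \<omega> * e1 \<omega>) = 1"
    "O.expectation (\<lambda>\<omega>. e2 \<omega> * e2 \<omega>) = g1" "O.expectation (\<lambda>\<omega>. e3 \<omega> * e3 \<omega>) = g2"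
    "O.expectation (\<lambda>\<omega>. e2 \<omega> * e3 \<omega>) = h"
    using P1[of "\<lambda>w. x w * x w"] P21[of "\<lambda>w. x w * x w"] P22[of "\<lambda>w. v1 l w * v1 l w"]
      P22[of "\<lambda>w. v2 l w * v2 l w"] P22[of "\<lambda>w. v1 l w * v2 l w"]
    unfolding e0_def e1_def e2_def e3_def by (simp_all add: xx vv)
  \<comment> \<open>The letter of the first user is centered and independent of everything else, so
    all its mixed moments vanish.\<close>
  have "O.expectation (\<lambda>\<omega>. x (fst \<omega>) * f (snd \<omega>)) = 0" if "integrable (?W \<Otimes>\<^sub>M ?N) f" for f
    unfolding \<Omega>_def pair_prob_mult[OF W WN W.L4_integrable[OF xL] that] by (simp add: xE)
  from this[OF q2(1)[THEN WN.L4_integrable]] this[OF q2(2)[THEN WN.L4_integrable]] this[OF q2(3)[THEN WN.L4_integrable]]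
  have c0: "O.expectation (\<lambda>\<omega>. e0 \<omega> * e1 \<omega>) = 0" "O.expectation (\<lambda>\<omega>. e0 \<omega> * e2 \<omega>) = 0" "O.expectation (\<lambda>\<omega>. e0 \<omega> * e3 \<omega>) = 0"
    unfolding e0_def e1_def e2_def e3_def by simp_all
  have "WN.expectation (\<lambda>p. x (fst p) * f (snd p)) = 0" if "integrable ?N f" for f
    unfolding pair_prob_mult[OF W Nn W.L4_integrable[OF xL] that] by (simp add: xE)
  from this[OF vL(1)[THEN Nn.L4_integrable]] this[OF vL(2)[THEN Nn.L4_integrable]]
  have c1: "O.expectation (\<lambda>\<omega>. e1 \<omega> * e2 \<omega>) = 0" "O.expectation (\<lambda>\<omega>. e1 \<omega> * e3 \<omega>) = 0"
    using P2[of "\<lambda>p. x (fst p) * v1 l (snd p)"] P2[of "\<lambda>p. x (fst p) * v2 l (snd p)"]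
    unfolding e1_def e2_def e3_def by simp_all
  have sym: "O.expectation (\<lambda>\<omega>. u \<omega> * v \<omega>) = O.expectation (\<lambda>\<omega>. v \<omega> * u \<omega>)" for u v :: "_ \<Rightarrow> real"
    by (simp add: mult.commute)
  note tab = d c0 c1 c0[unfolded sym[of e0]] c1[unfolded sym[of e1]] d(5)[unfolded sym[of e2]]
  have cases4: "a = 0 \<or> a = 1 \<or> a = 2 \<or> (a \<noteq> 0 \<and> a \<noteq> 1 \<and> a \<noteq> 2 \<and> min a 3 = 3)" for a :: nat by auto
  show "O.expectation (\<lambda>\<omega>. e a \<omega> * e b \<omega>) = letter_cov g1 g2 h (min a 3) (min b 3)"
    using cases4[of a] cases4[of b] unfolding e
    by (elim disjE conjE) (simp_all add: tab letter_cov_def)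
qed

lemma indep_letters:
  assumes L: "0 < L" "L * \<eta> \<le> n"
  shows "prob_space.indep_vars (word_space L \<Otimes>\<^sub>M word_space L \<Otimes>\<^sub>M noise n)
    (\<lambda>_. borel \<Otimes>\<^sub>M borel \<Otimes>\<^sub>M borel \<Otimes>\<^sub>M borel)
    (\<lambda>l \<omega>. letters (fst \<omega>) (fst (snd \<omega>)) (snd (snd \<omega>)) l) {..<L}"
proof -
  let ?W = "word_space L" and ?N = "noise n"
  have W: "prob_space ?W" by (rule prob_space_word_space)
  have Nn: "prob_space ?N" by (rule prob_space_noise_prod)
  have WN: "prob_space (?W \<Otimes>\<^sub>M ?N)" by (rule prob_space_pair[OF W Nn])
  interpret W: prob_space ?W by (rule W)
  have ne: "{..<L} \<noteq> {}" using L by auto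
  have "W.indep_vars (\<lambda>_. std_gauss) (\<lambda>l w. w l) {..<L}"
    by (rule indep_vars_PiM_projections[OF prob_space_std_gauss ne])
  hence x: "W.indep_vars (\<lambda>_. borel) (\<lambda>l w. w l) {..<L}"
    by (rule W.indep_vars_compose2[where Y = "\<lambda>_ x. x"]) simp
  have v: "prob_space.indep_vars ?N (\<lambda>_. borel \<Otimes>\<^sub>M borel) (\<lambda>l g. (v1 l g, v2 l g)) {..<L}"
    unfolding v1_def v2_def by (rule indep_vars_blin[OF \<eta> L])
  from indep_vars_pair[OF W WN ne _ x indep_vars_pair[OF W Nn ne _ x v]]
  show ?thesis by (simp add: letters_def)
qed

lemma discrepancy_measurable [measurable]:
  assumes "L * \<eta> \<le> n"
  shows "(\<lambda>\<omega>. discrepancy K L (letters (fst \<omega>) (fst (snd \<omega>)) (snd (snd \<omega>))))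
    \<in> borel_measurable (word_space L \<Otimes>\<^sub>M word_space L \<Otimes>\<^sub>M noise n)"
  unfolding discrepancy_def
proof (intro borel_measurable_sum borel_measurable_power)
  fix l a b assume "l \<in> {..<L}"
  hence l: "l < L" by simp
  note [measurable] = L4_measurable[OF letter_moments(1)[OF l assms]]
  show "(\<lambda>\<omega>. letter a (letters (fst \<omega>) (fst (snd \<omega>)) (snd (snd \<omega>)) l)
      * letter b (letters (fst \<omega>) (fst (snd \<omega>)) (snd (snd \<omega>)) l) - K a b)
    \<in> borel_measurable (word_space L \<Otimes>\<^sub>M word_space L \<Otimes>\<^sub>M noise n)"
    by measurable
qed

text \<open>Sixteen entries, each with a second moment per block of at most \<open>2 * m4\<close>
  plus twice a squared covariance; the squares are summed to obtain one bound for all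
  entries.\<close>

definition dvar where
  "dvar = 16 * (2 * m4 + 2 * (\<Sum>a<4. \<Sum>b<4. (letter_cov g1 g2 h a b)\<^sup>2))"

lemma dvar_nonneg: "0 \<le> dvar"
  by (auto simp: dvar_def m4_def intro!: add_nonneg_nonneg sum_nonneg integral_nonneg_AE)

text \<open>Each entry is the square of a sum of \<open>L\<close> independent centered terms and
  hence of order \<open>L\<close> in the mean. Division by the squared threshold
  \<open>(real L * \<tau>)\<^sup>2\<close> will leave order 1 / L.\<close>

lemma discrepancy_mean:
  assumes L: "0 < L" "L * \<eta> \<le> n"
  shows "(\<integral>\<^sup>+\<omega>. ennreal (discrepancy (letter_cov g1 g2 h) L
        (letters (fst \<omega>) (fst (snd \<omega>)) (snd (snd \<omega>)))) \<partial>(word_space L \<Otimes>\<^sub>M word_space L \<Otimes>\<^sub>M noise n))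
    \<le> ennreal (dvar * real L)"
proof -
  define \<Omega> where "\<Omega> = word_space L \<Otimes>\<^sub>M word_space L \<Otimes>\<^sub>M noise n"
  define E where "E = (\<lambda>l \<omega>. letters (fst \<omega>) (fst (snd \<omega>)) (snd (snd \<omega>)) l)"
  define K where "K = letter_cov g1 g2 h"
  define Z where "Z = (\<lambda>a b l \<omega>. letter a (E l \<omega>) * letter b (E l \<omega>) - K a b)"
  interpret O: prob_space \<Omega> unfolding \<Omega>_def
    by (intro prob_space_pair prob_space_word_space prob_space_noise_prod)
  define v where "v = 2 * m4 + 2 * (\<Sum>a<4. \<Sum>b<4. (K a b)\<^sup>2)"
  have Zs: "integrable \<Omega> (\<lambda>\<omega>. (\<Sum>l<L. Z a b l \<omega>)\<^sup>2)
      \<and> O.expectation (\<lambda>\<omega>. (\<Sum>l<L. Z a b l \<omega>)\<^sup>2) \<le> real L * v"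
    if ab: "a < 4" "b < 4" for a b
  proof -
    have ind: "O.indep_vars (\<lambda>_. borel) (Z a b) {..<L}"
      unfolding Z_def E_def \<Omega>_def
      by (rule prob_space.indep_vars_compose2[OF _ indep_letters[OF L], 
            where Y = "\<lambda>_ e. letter a e * letter b e - K a b"])
         (auto simp: O.prob_space_axioms[unfolded \<Omega>_def])
    have m: "min a 3 = a" "min b 3 = b" using ab by auto
    have one: "integrable \<Omega> (\<lambda>\<omega>. (Z a b l \<omega>)\<^sup>2) \<and> O.expectation (Z a b l) = 0
       \<and> O.expectation (\<lambda>\<omega>. (Z a b l \<omega>)\<^sup>2) \<le> v" if "l < L" for l
    proof -
      note lm = letter_moments[OF that L(2), folded \<Omega>_def, folded E_def]
      have la: "L4 \<Omega> (\<lambda>\<omega>. letter a (E l \<omega>))" for a using lm(1)[of a] by (simp add: E_def)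
      have l4: "O.expectation (\<lambda>\<omega>. letter a (E l \<omega>) ^ 4) \<le> m4" for a using lm(2)[of a] by (simp add: E_def)
      have [simp]: "integrable \<Omega> (\<lambda>\<omega>. letter a (E l \<omega>) ^ 4)" for a using la[of a] by (simp add: L4_def)
      have int: "integrable \<Omega> (\<lambda>\<omega>. letter a (E l \<omega>) * letter b (E l \<omega>))"
        "integrable \<Omega> (\<lambda>\<omega>. (letter a (E l \<omega>) * letter b (E l \<omega>))\<^sup>2)"
        by (rule O.L4_integrable_mult[OF la la]) (rule O.L4_integrable_mult_square[OF la la])
      have "O.expectation (\<lambda>\<omega>. letter a (E l \<omega>) * letter b (E l \<omega>)) = K a b"
        using lm(3)[of a b] m by (simp add: E_def K_def)
      hence z: "O.expectation (Z a b l) = 0" unfolding Z_def using int by (simp add: O.prob_space)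
      have sq: "(\<lambda>\<omega>. (Z a b l \<omega>)\<^sup>2) = (\<lambda>\<omega>. (letter a (E l \<omega>) * letter b (E l \<omega>))\<^sup>2
          - 2 * K a b * (letter a (E l \<omega>) * letter b (E l \<omega>)) + (K a b)\<^sup>2)"
        by (simp add: Z_def power2_diff algebra_simps)
      have i2: "integrable \<Omega> (\<lambda>\<omega>. (Z a b l \<omega>)\<^sup>2)" unfolding sq using int by auto
      have "O.expectation (\<lambda>\<omega>. (Z a b l \<omega>)\<^sup>2)
          \<le> O.expectation (\<lambda>\<omega>. letter a (E l \<omega>) ^ 4 + letter b (E l \<omega>) ^ 4 + 2 * (K a b)\<^sup>2)"
      proof (rule integral_mono[OF i2])
        show "integrable \<Omega> (\<lambda>\<omega>. letter a (E l \<omega>) ^ 4 + letter b (E l \<omega>) ^ 4 + 2 * (K a b)\<^sup>2)" by simp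
        fix \<omega>
        \<comment> \<open>With \<open>p\<close> a product of two letters,
          \<open>2 * p\<^sup>2\<close> is at most the sum of their fourth powers; this is where
          \<open>2 * m4\<close> comes from.\<close>
        have "(p - k)\<^sup>2 \<le> 2 * p\<^sup>2 + 2 * k\<^sup>2" for p k :: real
          using zero_le_power2[of "p + k"] by (simp add: power2_sum power2_diff)
        from this[of "letter a (E l \<omega>) * letter b (E l \<omega>)" "K a b"] square_product_le[of "letter a (E l \<omega>)" "letter b (E l \<omega>)"]
        show "(Z a b l \<omega>)\<^sup>2 \<le> letter a (E l \<omega>) ^ 4 + letter b (E l \<omega>) ^ 4 + 2 * (K a b)\<^sup>2"
          unfolding Z_def add_divide_distrib by linarith
      qed
      also have "\<dots> \<le> 2 * m4 + 2 * (K a b)\<^sup>2"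
        using l4[of a] l4[of b] by (simp add: O.prob_space)
      also have "(K a b)\<^sup>2 \<le> (\<Sum>b<4. (K a b)\<^sup>2)" using ab by (intro member_le_sum) auto
      also have "(\<Sum>b<4. (K a b)\<^sup>2) \<le> (\<Sum>a<4. \<Sum>b<4. (K a b)\<^sup>2)"
        using ab by (intro member_le_sum[of a "{..<4}" "\<lambda>a. \<Sum>b<4. (K a b)\<^sup>2"]) (auto intro: sum_nonneg)
      finally show ?thesis using i2 z by (simp add: v_def)
    qed
    show ?thesis
      using O.expectation_square_sum_indep_le[OF _ ind, of v] one by simp
  qed
  have eq: "discrepancy K L (letters (fst \<omega>) (fst (snd \<omega>)) (snd (snd \<omega>)))
      = (\<Sum>a<4. \<Sum>b<4. (\<Sum>l<L. Z a b l \<omega>)\<^sup>2)" for \<omega>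
    by (simp add: discrepancy_def Z_def E_def)
  have "(\<integral>\<^sup>+\<omega>. ennreal (\<Sum>a<4. \<Sum>b<4. (\<Sum>l<L. Z a b l \<omega>)\<^sup>2) \<partial>\<Omega>)
      = ennreal (O.expectation (\<lambda>\<omega>. \<Sum>a<4. \<Sum>b<4. (\<Sum>l<L. Z a b l \<omega>)\<^sup>2))"
    by (intro nn_integral_eq_integral Bochner_Integration.integrable_sum) (use Zs in \<open>auto intro!: sum_nonneg\<close>)
  also have "O.expectation (\<lambda>\<omega>. \<Sum>a<4. \<Sum>b<4. (\<Sum>l<L. Z a b l \<omega>)\<^sup>2)
      = (\<Sum>a<4. O.expectation (\<lambda>\<omega>. \<Sum>b<4. (\<Sum>l<L. Z a b l \<omega>)\<^sup>2))"
    by (rule Bochner_Integration.integral_sum) (use Zs in auto)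
  also have "\<dots> = (\<Sum>a<4. \<Sum>b<4. O.expectation (\<lambda>\<omega>. (\<Sum>l<L. Z a b l \<omega>)\<^sup>2))"
    by (intro sum.cong refl Bochner_Integration.integral_sum) (use Zs in auto)
  also have "\<dots> \<le> (\<Sum>a<4::nat. \<Sum>b<4::nat. real L * v)"
    using Zs by (intro sum_mono) auto
  also have "\<dots> = dvar * real L" by (simp add: dvar_def v_def K_def)
  finally show ?thesis unfolding K_def[symmetric] \<Omega>_def[symmetric] eq by (simp add: ennreal_leI)
qed

end

section \<open>Information densities and typicality\<close>

lemma (in prob_space) nn_integral_less_imp_exists:
  assumes "f \<in> borel_measurable M" "(\<integral>\<^sup>+x. f x \<partial>M) < b"
  shows "\<exists>x\<in>space M. f x < b"
proof (rule ccontr)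
  assume "\<not> ?thesis"
  hence "(\<integral>\<^sup>+x. b \<partial>M) \<le> (\<integral>\<^sup>+x. f x \<partial>M)" by (intro nn_integral_mono) (auto simp: not_less)
  thus False using assms(2) by (simp add: emeasure_space_1)
qed

lemma nn_integral_PiM_component:
  assumes M: "\<And>i. i \<in> I \<Longrightarrow> prob_space (M i)" and i: "i \<in> I" and f: "f \<in> borel_measurable (M i)"
  shows "(\<integral>\<^sup>+x. f (x i) \<partial>PiM I M) = (\<integral>\<^sup>+x. f x \<partial>M i)"
proof -
  have 1: "(\<lambda>x. x i) \<in> measurable (PiM I M) (M i)" using i by measurable
  show ?thesis using nn_integral_distr[OF 1, of f] f distr_PiM_component[where M = M, OF M i] by simp
qed

text \<open>Integrating coordinate \<open>j\<close> innermost reduces an inequality of means to one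
  in which all other coordinates are frozen. In the application \<open>j\<close> is the index of a
  wrong codeword.\<close>

lemma nn_integral_PiM_coordinate_mono:
  assumes M: "\<And>i. prob_space (M i)" and I: "finite I" "j \<in> I"
    and F: "F \<in> borel_measurable (PiM I M)" and H: "H \<in> borel_measurable (PiM I M)"
    and le: "\<And>x. (\<integral>\<^sup>+y. F (x(j := y)) \<partial>M j) \<le> (\<integral>\<^sup>+y. H (x(j := y)) \<partial>M j)"
  shows "(\<integral>\<^sup>+x. F x \<partial>PiM I M) \<le> (\<integral>\<^sup>+x. H x \<partial>PiM I M)"
proof -
  interpret product_sigma_finite M
    using M by (auto simp: product_sigma_finite_def intro: prob_space_imp_sigma_finite)
  have ins: "insert j (I - {j}) = I" using I by auto
  have *: "(\<integral>\<^sup>+x. f x \<partial>PiM I M) = (\<integral>\<^sup>+x. (\<integral>\<^sup>+y. f (x(j := y)) \<partial>M j) \<partial>PiM (I - {j}) M)"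
    if "f \<in> borel_measurable (PiM I M)" for f
    using product_nn_integral_insert[of "I - {j}" j f, unfolded ins] that I by simp
  show ?thesis unfolding *[OF F] *[OF H] by (intro nn_integral_mono le)
qed

text \<open>The first factor is integrated innermost: the codebook of the first user is averaged
  while the other codebook and the noise are frozen.\<close>

lemma nn_integral_triple_mono1:
  assumes M1: "prob_space M1" and M2: "prob_space M2" and M3: "prob_space M3"
    and F: "F \<in> borel_measurable (M1 \<Otimes>\<^sub>M M2 \<Otimes>\<^sub>M M3)" and H: "H \<in> borel_measurable (M1 \<Otimes>\<^sub>M M2 \<Otimes>\<^sub>M M3)"
    and le: "\<And>y z. y \<in> space M2 \<Longrightarrow> z \<in> space M3 \<Longrightarrow>
      (\<integral>\<^sup>+x. F (x, y, z) \<partial>M1) \<le> (\<integral>\<^sup>+x. H (x, y, z) \<partial>M1)"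
  shows "(\<integral>\<^sup>+\<omega>. F \<omega> \<partial>(M1 \<Otimes>\<^sub>M M2 \<Otimes>\<^sub>M M3)) \<le> (\<integral>\<^sup>+\<omega>. H \<omega> \<partial>(M1 \<Otimes>\<^sub>M M2 \<Otimes>\<^sub>M M3))"
proof -
  interpret M1: prob_space M1 by fact
  interpret M23: prob_space "M2 \<Otimes>\<^sub>M M3" by (rule prob_space_pair[OF M2 M3])
  interpret P: pair_prob_space M1 "M2 \<Otimes>\<^sub>M M3" ..
  show ?thesis
    unfolding P.nn_integral_snd[OF F, symmetric] P.nn_integral_snd[OF H, symmetric]
  proof (rule nn_integral_mono)
    fix p assume "p \<in> space (M2 \<Otimes>\<^sub>M M3)"
    thus "(\<integral>\<^sup>+x. F (x, p) \<partial>M1) \<le> (\<integral>\<^sup>+x. H (x, p) \<partial>M1)"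
      using le[of "fst p" "snd p"] by (auto simp: space_pair_measure)
  qed
qed

text \<open>The same reduction for the codebook of the second user. It stands between the first
  codebook and the noise, so the two inner integrals have to be exchanged.\<close>

lemma nn_integral_triple_mono2:
  assumes M1: "prob_space M1" and M2: "prob_space M2" and M3: "prob_space M3"
    and F: "F \<in> borel_measurable (M1 \<Otimes>\<^sub>M M2 \<Otimes>\<^sub>M M3)" and H: "H \<in> borel_measurable (M1 \<Otimes>\<^sub>M M2 \<Otimes>\<^sub>M M3)"
    and le: "\<And>x z. x \<in> space M1 \<Longrightarrow> z \<in> space M3 \<Longrightarrow>
      (\<integral>\<^sup>+y. F (x, y, z) \<partial>M2) \<le> (\<integral>\<^sup>+y. H (x, y, z) \<partial>M2)"
  shows "(\<integral>\<^sup>+\<omega>. F \<omega> \<partial>(M1 \<Otimes>\<^sub>M M2 \<Otimes>\<^sub>M M3)) \<le> (\<integral>\<^sup>+\<omega>. H \<omega> \<partial>(M1 \<Otimes>\<^sub>M M2 \<Otimes>\<^sub>M M3))"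
proof -
  interpret M1: prob_space M1 by fact
  interpret M2: prob_space M2 by fact
  interpret M3: prob_space M3 by fact
  interpret M23: prob_space "M2 \<Otimes>\<^sub>M M3" by (rule prob_space_pair[OF M2 M3])
  interpret P: pair_prob_space M1 "M2 \<Otimes>\<^sub>M M3" ..
  interpret Q: pair_prob_space M2 M3 ..
  have *: "(\<integral>\<^sup>+\<omega>. f \<omega> \<partial>(M1 \<Otimes>\<^sub>M M2 \<Otimes>\<^sub>M M3)) = (\<integral>\<^sup>+x. (\<integral>\<^sup>+z. (\<integral>\<^sup>+y. f (x, y, z) \<partial>M2) \<partial>M3) \<partial>M1)"
    if f [measurable]: "f \<in> borel_measurable (M1 \<Otimes>\<^sub>M M2 \<Otimes>\<^sub>M M3)" for f :: "_ \<Rightarrow> ennreal"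
  proof -
    have "(\<integral>\<^sup>+\<omega>. f \<omega> \<partial>(M1 \<Otimes>\<^sub>M M2 \<Otimes>\<^sub>M M3)) = (\<integral>\<^sup>+x. (\<integral>\<^sup>+p. f (x, p) \<partial>(M2 \<Otimes>\<^sub>M M3)) \<partial>M1)"
      by (rule M23.nn_integral_fst[OF f, symmetric])
    also have "\<dots> = (\<integral>\<^sup>+x. (\<integral>\<^sup>+z. (\<integral>\<^sup>+y. f (x, y, z) \<partial>M2) \<partial>M3) \<partial>M1)"
    proof (intro nn_integral_cong)
      fix x assume "x \<in> space M1"
      hence "(\<lambda>p. f (x, p)) \<in> borel_measurable (M2 \<Otimes>\<^sub>M M3)" by measurable
      from Q.nn_integral_snd[OF this]
      show "(\<integral>\<^sup>+p. f (x, p) \<partial>(M2 \<Otimes>\<^sub>M M3)) = (\<integral>\<^sup>+z. (\<integral>\<^sup>+y. f (x, y, z) \<partial>M2) \<partial>M3)" by simp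
    qed
    finally show ?thesis .
  qed
  show ?thesis unfolding *[OF F] *[OF H] by (intro nn_integral_mono le)
qed

text \<open>The letters of a word are independent, so the mean factorizes into means that are all
  one, whatever output sequence \<open>s\<close> is fixed beforehand.\<close>

lemma word_exp_idens:
  assumes "1 + g > 0"
  shows "(\<integral>\<^sup>+y. ennreal (exp (\<Sum>l<L. idens g (s l) (y l))) \<partial>word_space L) = 1"
proof -
  interpret product_sigma_finite "\<lambda>_::nat. std_gauss"
    using prob_space_std_gauss by (auto simp: product_sigma_finite_def intro: prob_space_imp_sigma_finite)
  have m: "(\<lambda>x. ennreal (exp (idens g (s l) x))) \<in> borel_measurable std_gauss" for l
    unfolding idens_def by measurable
  have "(\<integral>\<^sup>+y. ennreal (exp (\<Sum>l<L. idens g (s l) (y l))) \<partial>word_space L)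
      = (\<integral>\<^sup>+y. (\<Prod>l<L. ennreal (exp (idens g (s l) (y l)))) \<partial>word_space L)"
    by (simp add: exp_sum prod_ennreal)
  also have "\<dots> = (\<Prod>l<L. \<integral>\<^sup>+x. ennreal (exp (idens g (s l) x)) \<partial>std_gauss)"
    by (rule product_nn_integral_prod) (use m in auto)
  also have "\<dots> = 1" by (simp add: exp_idens_mean[OF assms])
  finally show ?thesis .
qed

lemma ncov_nonneg:
  assumes "0 \<le> N" "r\<^sup>2 \<le> 1" shows "0 \<le> ncov N s1 s2 r a b c a b c"
proof -
  have "ncov N s1 s2 r a b c a b c = N * a\<^sup>2 + (s1 * b + r * s2 * c)\<^sup>2 + (1 - r\<^sup>2) * (s2 * c)\<^sup>2"
    by (simp add: ncov_def power2_eq_square algebra_simps)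
  also have "\<dots> \<ge> 0" using assms by (intro add_nonneg_nonneg mult_nonneg_nonneg) auto
  finally show ?thesis .
qed

section \<open>Positivity of I + G, the acceptance rule and typical sequences\<close>

context noise_filters
begin

lemma g1_nonneg: "0 \<le> g1" and g2_nonneg: "0 \<le> g2"
  unfolding cov11[symmetric] cov22[symmetric] by (intro sum_nonneg ncov_nonneg N r)+

text \<open>This is the variance of the functional with coefficients
  \<open>\<alpha>1 + t * \<alpha>2\<close> and so on, that is, of
  \<open>v1 + t * v2\<close>.\<close>

lemma gram_nonneg: "0 \<le> g1 + 2 * t * h + t\<^sup>2 * g2"
proof -
  have "0 \<le> (\<Sum>j<\<eta>. ncov N s1 s2 r (\<alpha>1 j + t * \<alpha>2 j) (\<beta>1 j + t * \<beta>2 j) (\<gamma>1 j + t * \<gamma>2 j)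
      (\<alpha>1 j + t * \<alpha>2 j) (\<beta>1 j + t * \<beta>2 j) (\<gamma>1 j + t * \<gamma>2 j))"
    by (intro sum_nonneg ncov_nonneg N r)
  also have "\<dots> = (\<Sum>j<\<eta>. ncov N s1 s2 r (\<alpha>1 j) (\<beta>1 j) (\<gamma>1 j) (\<alpha>1 j) (\<beta>1 j) (\<gamma>1 j)
      + 2 * t * ncov N s1 s2 r (\<alpha>1 j) (\<beta>1 j) (\<gamma>1 j) (\<alpha>2 j) (\<beta>2 j) (\<gamma>2 j)
      + t\<^sup>2 * ncov N s1 s2 r (\<alpha>2 j) (\<beta>2 j) (\<gamma>2 j) (\<alpha>2 j) (\<beta>2 j) (\<gamma>2 j))"
    by (intro sum.cong refl) (simp add: ncov_def power2_eq_square algebra_simps)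
  also have "\<dots> = g1 + 2 * t * h + t\<^sup>2 * g2"
    by (simp add: sum.distrib cov11 cov12 cov22 flip: sum_distrib_left)
  finally show ?thesis .
qed

definition dd where "dd = (1 + g1) * (1 + g2) - h\<^sup>2"

text \<open>G is a covariance matrix, so I + G is positive definite.\<close>

lemma dd_pos: "0 < dd"
proof -
  define q where "q = 1 + g2"
  have q: "q > 0" "g2 = q - 1" using g2_nonneg by (auto simp: q_def)
  \<comment> \<open>At \<open>- t\<close> the quadratic polynomial
    \<open>1 + g1 + 2 * y * h + y\<^sup>2 * q\<close> in \<open>y\<close> attains its minimum, which
    is the determinant divided by \<open>q\<close>.\<close>
  define t where "t = h / q"
  have h: "h = t * q" using q by (simp add: t_def)
  have "0 \<le> g1 - 2 * t * h + t\<^sup>2 * g2" using gram_nonneg[of "- t"] by simp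
  also have "\<dots> = g1 - t\<^sup>2 * q - t\<^sup>2" by (simp add: h q power2_eq_square algebra_simps)
  finally have "g1 \<ge> t\<^sup>2 * q" using zero_le_power2[of t] by linarith
  hence "(1 + g1) * q \<ge> (1 + t\<^sup>2 * q) * q" using q by (intro mult_right_mono) auto
  moreover have "(1 + t\<^sup>2 * q) * q = q + h\<^sup>2" by (simp add: h power2_eq_square algebra_simps)
  ultimately show ?thesis using q(1) unfolding dd_def q_def[symmetric] by linarith
qed

text \<open>Information density of the first word when the second word is known: its interference is
  subtracted from the output. \<open>S2\<close> exchanges the roles of the users, and
  \<open>S12\<close> treats both words as unknown.\<close>

definition S1 :: "nat \<Rightarrow> (nat \<Rightarrow> real) \<Rightarrow> (nat \<Rightarrow> real) \<Rightarrow> (nat \<Rightarrow> real) \<Rightarrow> real" where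
  "S1 L x1 x2 t1 = (\<Sum>l<L. idens g1 (t1 l - h * x2 l) (x1 l))"
definition S2 :: "nat \<Rightarrow> (nat \<Rightarrow> real) \<Rightarrow> (nat \<Rightarrow> real) \<Rightarrow> (nat \<Rightarrow> real) \<Rightarrow> real" where
  "S2 L x1 x2 t2 = (\<Sum>l<L. idens g2 (t2 l - h * x1 l) (x2 l))"
definition S12 :: "nat \<Rightarrow> (nat \<Rightarrow> real) \<Rightarrow> (nat \<Rightarrow> real) \<Rightarrow> (nat \<Rightarrow> real) \<Rightarrow> (nat \<Rightarrow> real) \<Rightarrow> real" where
  "S12 L x1 x2 t1 t2 = (\<Sum>l<L. idens2 g1 g2 h (t1 l) (t2 l) (x1 l) (x2 l))"

text \<open>\<open>T1\<close> and \<open>T2\<close> are the two components of G \<xi> + v for the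
  transmitted words.\<close>

definition T1 :: "(nat \<Rightarrow> real) \<Rightarrow> (nat \<Rightarrow> real) \<Rightarrow> (nat \<Rightarrow> real \<times> real \<times> real) \<Rightarrow> nat \<Rightarrow> real" where
  "T1 x1 x2 g l = g1 * x1 l + h * x2 l + v1 l g"
definition T2 :: "(nat \<Rightarrow> real) \<Rightarrow> (nat \<Rightarrow> real) \<Rightarrow> (nat \<Rightarrow> real \<times> real \<times> real) \<Rightarrow> nat \<Rightarrow> real" where
  "T2 x1 x2 g l = h * x1 l + g2 * x2 l + v2 l g"

text \<open>The means of the three densities under the true joint law: mutual informations per
  block, in nats.\<close>

definition I1 where "I1 = ln (1 + g1) / 2"
definition I2 where "I2 = ln (1 + g2) / 2"
definition I12 where "I12 = ln dd / 2"

definition accept :: "real \<Rightarrow> nat \<Rightarrow> (nat \<Rightarrow> real) \<Rightarrow> (nat \<Rightarrow> real) \<Rightarrow> (nat \<Rightarrow> real) \<Rightarrow> (nat \<Rightarrow> real) \<Rightarrow> bool" where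
  "accept \<epsilon> L x1 x2 t1 t2 \<longleftrightarrow> S1 L x1 x2 t1 > real L * (I1 - \<epsilon>) \<and> S2 L x1 x2 t2 > real L * (I2 - \<epsilon>)
     \<and> S12 L x1 x2 t1 t2 > real L * (I12 - \<epsilon>)"

definition lform :: "(nat \<Rightarrow> real) \<Rightarrow> real \<times> real \<times> real \<times> real \<Rightarrow> real" where
  "lform p e = (\<Sum>a<4. p a * letter a e)"

text \<open>The mean that \<open>letter_cov\<close> predicts for the product of two linear
  forms.\<close>

definition lcov :: "(nat \<Rightarrow> real) \<Rightarrow> (nat \<Rightarrow> real) \<Rightarrow> real" where
  "lcov p q = (\<Sum>a<4. \<Sum>b<4. p a * q b * letter_cov g1 g2 h a b)"

lemma discrepancy_entry:
  assumes "discrepancy K L e < d\<^sup>2" "0 \<le> d" "a < 4" "b < 4"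
  shows "\<bar>\<Sum>l<L. letter a (e l) * letter b (e l) - K a b\<bar> \<le> d"
proof -
  have "(\<Sum>l<L. letter a (e l) * letter b (e l) - K a b)\<^sup>2
     \<le> (\<Sum>b<4. (\<Sum>l<L. letter a (e l) * letter b (e l) - K a b)\<^sup>2)"
    using assms by (intro member_le_sum[of b "{..<4}" "\<lambda>b. (\<Sum>l<L. letter a (e l) * letter b (e l) - K a b)\<^sup>2"]) auto
  also have "\<dots> \<le> discrepancy K L e" unfolding discrepancy_def using assms
    by (intro member_le_sum[of a "{..<4}" "\<lambda>a. \<Sum>b<4. (\<Sum>l<L. letter a (e l) * letter b (e l) - K a b)\<^sup>2"])
       (auto intro: sum_nonneg)
  also have "\<dots> < d\<^sup>2" by fact
  finally show ?thesis using assms(2) by (metis abs_le_square_iff abs_of_nonneg less_imp_le)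
qed

text \<open>The deviation is a bilinear combination of the errors of the empirical second moments,
  and each of these errors is at most \<open>d\<close>.\<close>

lemma lform_product_approx:
  assumes "discrepancy (letter_cov g1 g2 h) L e < d\<^sup>2" "0 \<le> d"
  shows "\<bar>(\<Sum>l<L. lform p (e l) * lform q (e l)) - real L * lcov p q\<bar>
    \<le> (\<Sum>a<4. \<bar>p a\<bar>) * (\<Sum>a<4. \<bar>q a\<bar>) * d"
proof -
  let ?K = "letter_cov g1 g2 h"
  have "(\<Sum>l<L. lform p (e l) * lform q (e l)) - real L * lcov p q
    = (\<Sum>l<L. lform p (e l) * lform q (e l) - lcov p q)" by (simp add: sum_subtractf)
  also have "\<dots> = (\<Sum>l<L. \<Sum>a<4. \<Sum>b<4. p a * q b * (letter a (e l) * letter b (e l) - ?K a b))"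
    by (intro sum.cong refl)
       (simp add: lform_def lcov_def sum_product right_diff_distrib sum_subtractf mult_ac)
  also have "\<dots> = (\<Sum>a<4. \<Sum>l<L. \<Sum>b<4. p a * q b * (letter a (e l) * letter b (e l) - ?K a b))"
    by (rule sum.swap)
  also have "\<dots> = (\<Sum>a<4. \<Sum>b<4. \<Sum>l<L. p a * q b * (letter a (e l) * letter b (e l) - ?K a b))"
    by (intro sum.cong refl sum.swap)
  also have "\<dots> = (\<Sum>a<4. \<Sum>b<4. p a * q b * (\<Sum>l<L. letter a (e l) * letter b (e l) - ?K a b))"
    by (simp add: sum_distrib_left)
  also have "\<bar>\<dots>\<bar> \<le> (\<Sum>a<4. \<Sum>b<4. \<bar>p a * q b * (\<Sum>l<L. letter a (e l) * letter b (e l) - ?K a b)\<bar>)"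
    by (intro order_trans[OF sum_abs] sum_mono sum_abs)
  also have "\<dots> \<le> (\<Sum>a<4. \<Sum>b<4. \<bar>p a\<bar> * \<bar>q b\<bar> * d)"
    unfolding abs_mult by (intro sum_mono mult_left_mono discrepancy_entry[OF assms]) auto
  also have "\<dots> = (\<Sum>a<4. \<bar>p a\<bar>) * (\<Sum>a<4. \<bar>q a\<bar>) * d"
    by (subst sum_product) (simp only: sum_distrib_right)
  finally show ?thesis .
qed


definition pick :: "real \<Rightarrow> real \<Rightarrow> real \<Rightarrow> real \<Rightarrow> nat \<Rightarrow> real" where
  "pick a b c d i = (if i = 0 then a else if i = 1 then b else if i = 2 then c else d)"

lemma lform_pick: "lform (pick a b c d) (letters x1 x2 g l) = a * x1 l + b * x2 l + c * v1 l g + d * v2 l g"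
  by (simp add: lform_def pick_def letter_def letters_def numeral_eq_Suc)

lemma lcov_pick: "lcov (pick a b c d) (pick a' b' c' d') =
    a * a' + b * b' + c * c' * g1 + (c * d' + d * c') * h + d * d' * g2"
  by (simp add: lcov_def pick_def letter_cov_def numeral_eq_Suc algebra_simps)

lemma pick_norm: "(\<Sum>i<4. \<bar>pick a b c d i\<bar>) = \<bar>a\<bar> + \<bar>b\<bar> + \<bar>c\<bar> + \<bar>d\<bar>"
  by (simp add: pick_def numeral_eq_Suc)

text \<open>Each density minus its mean is a quadratic form in the letters whose expectation under
  \<open>letter_cov\<close> is zero. Its empirical sum is therefore controlled by the second-moment
  errors alone, with a threshold \<tau> that depends on neither the words nor the noise.\<close>

lemma accept_if_typical:
  assumes "0 < \<epsilon>"
  shows "\<exists>\<tau>>0. \<forall>L>0. \<forall>x1 x2 g.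
    discrepancy (letter_cov g1 g2 h) L (letters x1 x2 g) < (real L * \<tau>)\<^sup>2
    \<longrightarrow> accept \<epsilon> L x1 x2 (T1 x1 x2 g) (T2 x1 x2 g)"
proof -
  \<comment> \<open>Bounds the sum of the absolute coefficients of every linear form used
    below.\<close>
  define B where "B = 2 + \<bar>g1\<bar> + \<bar>g2\<bar> + \<bar>h\<bar>"
  \<comment> \<open>Bounds, for each of the three densities, the sum of the absolute coefficients in
    its expansion into products of linear forms.\<close>
  define C where "C = 2 + \<bar>g1\<bar> + \<bar>h\<bar> + \<bar>g2\<bar> + 1 / (2 * (1 + g1)) + 1 / (2 * (1 + g2))
     + ((1 + g2) + 2 * \<bar>h\<bar> + (1 + g1)) / (2 * dd)"
  \<comment> \<open>Makes the total error bound half of the tolerance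
    \<open>real L * \<epsilon>\<close>, which leaves a strict inequality.\<close>
  define \<tau> where "\<tau> = \<epsilon> / (2 * (B * B * C))"
  have B: "B > 0" by (simp add: B_def)
  have fr: "0 \<le> 1 / (2 * (1 + g1))" "0 \<le> 1 / (2 * (1 + g2))" "0 \<le> ((1 + g2) + 2 * \<bar>h\<bar> + (1 + g1)) / (2 * dd)"
    using g1_nonneg g2_nonneg dd_pos by (auto intro!: divide_nonneg_pos)
  have C: "C > 0" using fr unfolding C_def by linarith
  have BC: "B * B * C > 0" using B C by simp
  have "\<tau> > 0" using BC assms by (simp add: \<tau>_def)
  moreover have "accept \<epsilon> L x1 x2 (T1 x1 x2 g) (T2 x1 x2 g)"
    if L: "L > 0" and disc: "discrepancy (letter_cov g1 g2 h) L (letters x1 x2 g) < (real L * \<tau>)\<^sup>2" for L x1 x2 g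
  proof -
    define M where "M = (\<lambda>p q. (\<Sum>l<L. lform p (letters x1 x2 g l) * lform q (letters x1 x2 g l)) - real L * lcov p q)"
    define d where "d = B * B * (real L * \<tau>)"
    have d0: "0 \<le> d" using B \<open>\<tau> > 0\<close> by (simp add: d_def)
    have Cd: "C * d < real L * \<epsilon>"
    proof -
      have "2 * (C * d) = real L * \<epsilon>" using BC C B unfolding d_def \<tau>_def by (simp add: field_simps)
      moreover have "0 < real L * \<epsilon>" using L assms by simp
      ultimately show ?thesis by linarith
    qed
    have M: "\<bar>M p q\<bar> \<le> d" if "(\<Sum>a<4. \<bar>p a\<bar>) \<le> B" "(\<Sum>a<4. \<bar>q a\<bar>) \<le> B" for p q
    proof -
      have "\<bar>M p q\<bar> \<le> (\<Sum>a<4. \<bar>p a\<bar>) * (\<Sum>a<4. \<bar>q a\<bar>) * (real L * \<tau>)"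
        unfolding M_def by (rule lform_product_approx[OF disc]) (use \<open>\<tau> > 0\<close> in simp)
      also have "\<dots> \<le> d" unfolding d_def using that B \<open>\<tau> > 0\<close>
        by (intro mult_right_mono mult_mono) (auto intro: sum_nonneg)
      finally show ?thesis .
    qed
    \<comment> \<open>\<open>px\<close> stands for the inputs, \<open>ps\<close> for the outputs
      without the interference of the other user, \<open>pt\<close> for the full outputs.\<close>
    define px1 where "px1 = pick 1 0 0 0"
    define px2 where "px2 = pick 0 1 0 0"
    define ps1 where "ps1 = pick g1 0 1 0"
    define ps2 where "ps2 = pick 0 g2 0 1"
    define pt1 where "pt1 = pick g1 h 1 0"
    define pt2 where "pt2 = pick h g2 0 1"
    note pd = px1_def px2_def ps1_def ps2_def pt1_def pt2_def
    have nb: "(\<Sum>a<4. \<bar>px1 a\<bar>) \<le> B" "(\<Sum>a<4. \<bar>px2 a\<bar>) \<le> B" "(\<Sum>a<4. \<bar>ps1 a\<bar>) \<le> B" "(\<Sum>a<4. \<bar>ps2 a\<bar>) \<le> B"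
      "(\<Sum>a<4. \<bar>pt1 a\<bar>) \<le> B" "(\<Sum>a<4. \<bar>pt2 a\<bar>) \<le> B"
      unfolding pd pick_norm B_def by auto
    have cm: "\<bar>c * M p q\<bar> \<le> \<bar>c\<bar> * d" if "(\<Sum>a<4. \<bar>p a\<bar>) \<le> B" "(\<Sum>a<4. \<bar>q a\<bar>) \<le> B" for c p q
      using M[OF that] unfolding abs_mult by (intro mult_left_mono) auto
    define c1 where "c1 = 1 / (2 * (1 + g1))"
    define c2 where "c2 = 1 / (2 * (1 + g2))"
    define c3 where "c3 = 1 / (2 * dd)"
    have c0: "0 \<le> c1" "0 \<le> c2" "0 \<le> c3" using g1_nonneg g2_nonneg dd_pos by (auto simp: c1_def c2_def c3_def)
    have C': "C = 2 + \<bar>g1\<bar> + \<bar>h\<bar> + \<bar>g2\<bar> + c1 + c2 + ((1 + g2) * c3 + 2 * \<bar>h\<bar> * c3 + (1 + g1) * c3)"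
      unfolding C_def c1_def c2_def c3_def by (simp add: add_divide_distrib)
    have e1: "idens g1 (T1 x1 x2 g l - h * x2 l) (x1 l) - I1 =
        lform px1 (letters x1 x2 g l) * lform ps1 (letters x1 x2 g l)
        - g1 / 2 * (lform px1 (letters x1 x2 g l) * lform px1 (letters x1 x2 g l))
        - c1 * (lform ps1 (letters x1 x2 g l) * lform ps1 (letters x1 x2 g l))" for l
      unfolding pd lform_pick by (simp add: idens_def I1_def T1_def c1_def power2_eq_square)
    \<comment> \<open>The clean output has variance \<open>g1 * (1 + g1)\<close> and covariance
      \<open>g1\<close> with the input, so the three terms contribute g1, -g1/2 and -g1/2.\<close>
    have z1: "lcov px1 ps1 - g1 / 2 * lcov px1 px1 - c1 * lcov ps1 ps1 = 0"
    proof -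
      have "c1 * (g1 * g1 + g1) = g1 / 2" using g1_nonneg by (simp add: c1_def field_simps)
      thus ?thesis unfolding pd lcov_pick by simp
    qed
    have s1: "S1 L x1 x2 (T1 x1 x2 g) - real L * I1 = M px1 ps1 - g1 / 2 * M px1 px1 - c1 * M ps1 ps1"
    proof -
      have "S1 L x1 x2 (T1 x1 x2 g) - real L * I1 = (\<Sum>l<L. idens g1 (T1 x1 x2 g l - h * x2 l) (x1 l) - I1)"
        by (simp add: S1_def sum_subtractf)
      also have "\<dots> = M px1 ps1 - g1 / 2 * M px1 px1 - c1 * M ps1 ps1
          + real L * (lcov px1 ps1 - g1 / 2 * lcov px1 px1 - c1 * lcov ps1 ps1)"
        unfolding e1 M_def sum_subtractf sum.distrib sum_distrib_left[symmetric] right_diff_distrib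
        by (simp add: algebra_simps)
      finally show ?thesis unfolding z1 by simp
    qed
    have e2: "idens g2 (T2 x1 x2 g l - h * x1 l) (x2 l) - I2 =
        lform px2 (letters x1 x2 g l) * lform ps2 (letters x1 x2 g l)
        - g2 / 2 * (lform px2 (letters x1 x2 g l) * lform px2 (letters x1 x2 g l))
        - c2 * (lform ps2 (letters x1 x2 g l) * lform ps2 (letters x1 x2 g l))" for l
      unfolding pd lform_pick by (simp add: idens_def I2_def T2_def c2_def power2_eq_square)
    have z2: "lcov px2 ps2 - g2 / 2 * lcov px2 px2 - c2 * lcov ps2 ps2 = 0"
    proof -
      have "c2 * (g2 * g2 + g2) = g2 / 2" using g2_nonneg by (simp add: c2_def field_simps)
      thus ?thesis unfolding pd lcov_pick by simp
    qed
    have s2: "S2 L x1 x2 (T2 x1 x2 g) - real L * I2 = M px2 ps2 - g2 / 2 * M px2 px2 - c2 * M ps2 ps2"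
    proof -
      have "S2 L x1 x2 (T2 x1 x2 g) - real L * I2 = (\<Sum>l<L. idens g2 (T2 x1 x2 g l - h * x1 l) (x2 l) - I2)"
        by (simp add: S2_def sum_subtractf)
      also have "\<dots> = M px2 ps2 - g2 / 2 * M px2 px2 - c2 * M ps2 ps2
          + real L * (lcov px2 ps2 - g2 / 2 * lcov px2 px2 - c2 * lcov ps2 ps2)"
        unfolding e2 M_def sum_subtractf sum.distrib sum_distrib_left[symmetric] right_diff_distrib
        by (simp add: algebra_simps)
      finally show ?thesis unfolding z2 by simp
    qed
    have e12: "idens2 g1 g2 h (T1 x1 x2 g l) (T2 x1 x2 g l) (x1 l) (x2 l) - I12 =
        lform px1 (letters x1 x2 g l) * lform pt1 (letters x1 x2 g l)
        + lform px2 (letters x1 x2 g l) * lform pt2 (letters x1 x2 g l)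
        - g1 / 2 * (lform px1 (letters x1 x2 g l) * lform px1 (letters x1 x2 g l))
        - h * (lform px1 (letters x1 x2 g l) * lform px2 (letters x1 x2 g l))
        - g2 / 2 * (lform px2 (letters x1 x2 g l) * lform px2 (letters x1 x2 g l))
        - (1 + g2) * c3 * (lform pt1 (letters x1 x2 g l) * lform pt1 (letters x1 x2 g l))
        + 2 * h * c3 * (lform pt1 (letters x1 x2 g l) * lform pt2 (letters x1 x2 g l))
        - (1 + g1) * c3 * (lform pt2 (letters x1 x2 g l) * lform pt2 (letters x1 x2 g l))" for l
    proof -
      have l: "lform px1 (letters x1 x2 g l) = x1 l" "lform px2 (letters x1 x2 g l) = x2 l"
        "lform pt1 (letters x1 x2 g l) = T1 x1 x2 g l" "lform pt2 (letters x1 x2 g l) = T2 x1 x2 g l"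
        unfolding pd lform_pick by (simp_all add: T1_def T2_def)
      have "idens2 g1 g2 h t1 t2 x y - I12 = x * t1 + y * t2 - (g1 * x\<^sup>2 + 2 * h * x * y + g2 * y\<^sup>2) / 2
        - ((1 + g2) * t1\<^sup>2 - 2 * h * t1 * t2 + (1 + g1) * t2\<^sup>2) * c3" for t1 t2 x y
        using g2_nonneg dd_pos by (subst idens2_eq) (auto simp: dd_def I12_def c3_def)
      from this[of "T1 x1 x2 g l" "T2 x1 x2 g l" "x1 l" "x2 l"] show ?thesis unfolding l
        by (simp only:) (simp add: power2_eq_square algebra_simps add_divide_distrib)
    qed
    have z12: "lcov px1 pt1 + lcov px2 pt2 - g1 / 2 * lcov px1 px1 - h * lcov px1 px2 - g2 / 2 * lcov px2 px2
        - (1 + g2) * c3 * lcov pt1 pt1 + 2 * h * c3 * lcov pt1 pt2 - (1 + g1) * c3 * lcov pt2 pt2 = 0"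
    proof -
      \<comment> \<open>The output has covariance G + G^2. Half of its quadratic form with the
        inverse of I + G thus has as mean half the trace of G.\<close>
      have "(1 + g2) * c3 * (g1 * g1 + h * h + g1) - 2 * h * c3 * (g1 * h + h * g2 + h) + (1 + g1) * c3 * (h * h + g2 * g2 + g2)
         = c3 * ((g1 + g2) * dd)" by (simp add: dd_def power2_eq_square algebra_simps)
      also have "\<dots> = (g1 + g2) / 2" using dd_pos by (simp add: c3_def)
      finally show ?thesis unfolding pd lcov_pick by (simp add: algebra_simps add_divide_distrib)
    qed
    have s12: "S12 L x1 x2 (T1 x1 x2 g) (T2 x1 x2 g) - real L * I12 =
        M px1 pt1 + M px2 pt2 - g1 / 2 * M px1 px1 - h * M px1 px2 - g2 / 2 * M px2 px2
        - (1 + g2) * c3 * M pt1 pt1 + 2 * h * c3 * M pt1 pt2 - (1 + g1) * c3 * M pt2 pt2"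
    proof -
      have "S12 L x1 x2 (T1 x1 x2 g) (T2 x1 x2 g) - real L * I12
        = (\<Sum>l<L. idens2 g1 g2 h (T1 x1 x2 g l) (T2 x1 x2 g l) (x1 l) (x2 l) - I12)"
        by (simp add: S12_def sum_subtractf)
      also have "\<dots> = M px1 pt1 + M px2 pt2 - g1 / 2 * M px1 px1 - h * M px1 px2 - g2 / 2 * M px2 px2
        - (1 + g2) * c3 * M pt1 pt1 + 2 * h * c3 * M pt1 pt2 - (1 + g1) * c3 * M pt2 pt2
        + real L * (lcov px1 pt1 + lcov px2 pt2 - g1 / 2 * lcov px1 px1 - h * lcov px1 px2 - g2 / 2 * lcov px2 px2
        - (1 + g2) * c3 * lcov pt1 pt1 + 2 * h * c3 * lcov pt1 pt2 - (1 + g1) * c3 * lcov pt2 pt2)"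
        unfolding e12 M_def sum_subtractf sum.distrib sum_distrib_left[symmetric] right_diff_distrib
        by (simp add: algebra_simps)
      finally show ?thesis unfolding z12 by simp
    qed
    define A1 where "A1 = \<bar>g1 / 2\<bar> * d"
    define A2 where "A2 = \<bar>g2 / 2\<bar> * d"
    define A3 where "A3 = \<bar>h\<bar> * d"
    define A4 where "A4 = \<bar>c1\<bar> * d"
    define A5 where "A5 = \<bar>c2\<bar> * d"
    define A6 where "A6 = \<bar>(1 + g2) * c3\<bar> * d"
    define A7 where "A7 = \<bar>2 * h * c3\<bar> * d"
    define A8 where "A8 = \<bar>(1 + g1) * c3\<bar> * d"
    note Ad = A1_def A2_def A3_def A4_def A5_def A6_def A7_def A8_def
    have nn: "0 \<le> A1" "0 \<le> A2" "0 \<le> A3" "0 \<le> A4" "0 \<le> A5" "0 \<le> A6" "0 \<le> A7" "0 \<le> A8"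
      unfolding Ad using d0 by (simp_all only: mult_nonneg_nonneg abs_ge_zero)
    have ab: "\<bar>c1\<bar> = c1" "\<bar>c2\<bar> = c2" "\<bar>(1 + g2) * c3\<bar> = (1 + g2) * c3" "\<bar>(1 + g1) * c3\<bar> = (1 + g1) * c3"
      "\<bar>2 * h * c3\<bar> = 2 * \<bar>h\<bar> * c3"
      using c0 g1_nonneg g2_nonneg by (auto simp: abs_mult)
    have Cd': "2 * d + 2 * A1 + A3 + 2 * A2 + A4 + A5 + A6 + A7 + A8 < real L * \<epsilon>"
      using Cd unfolding C' Ad ab by (simp add: algebra_simps)
    have Ml: "- d \<le> M p q" "M p q \<le> d" if "(\<Sum>a<4. \<bar>p a\<bar>) \<le> B" "(\<Sum>a<4. \<bar>q a\<bar>) \<le> B" for p q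
      using M[OF that] by (simp_all add: abs_le_iff)
    have cl: "- (\<bar>c\<bar> * d) \<le> c * M p q" "c * M p q \<le> \<bar>c\<bar> * d"
      if "(\<Sum>a<4. \<bar>p a\<bar>) \<le> B" "(\<Sum>a<4. \<bar>q a\<bar>) \<le> B" for c p q
      using cm[OF that, of c] by (simp_all only: abs_le_iff) linarith
    have "S1 L x1 x2 (T1 x1 x2 g) - real L * I1 > - (real L * \<epsilon>)"
      unfolding s1 using Ml(1)[OF nb(1) nb(3)] cl(2)[OF nb(1) nb(1), of "g1 / 2", folded A1_def]
        cl(2)[OF nb(3) nb(3), of c1, folded A4_def] nn d0 Cd'
      by linarith
    moreover have "S2 L x1 x2 (T2 x1 x2 g) - real L * I2 > - (real L * \<epsilon>)"
      unfolding s2 using Ml(1)[OF nb(2) nb(4)] cl(2)[OF nb(2) nb(2), of "g2 / 2", folded A2_def]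
        cl(2)[OF nb(4) nb(4), of c2, folded A5_def] nn d0 Cd'
      by linarith
    moreover have "S12 L x1 x2 (T1 x1 x2 g) (T2 x1 x2 g) - real L * I12 > - (real L * \<epsilon>)"
      unfolding s12 using Ml(1)[OF nb(1) nb(5)] Ml(1)[OF nb(2) nb(6)] cl(2)[OF nb(1) nb(1), of "g1 / 2", folded A1_def]
        cl(2)[OF nb(1) nb(2), of h, folded A3_def] cl(2)[OF nb(2) nb(2), of "g2 / 2", folded A2_def]
        cl(2)[OF nb(5) nb(5), of "(1 + g2) * c3", folded A6_def] cl(1)[OF nb(5) nb(6), of "2 * h * c3", folded A7_def]
        cl(2)[OF nb(6) nb(6), of "(1 + g1) * c3", folded A8_def] nn d0 Cd'
      by linarith
    ultimately show ?thesis unfolding accept_def by (simp add: right_diff_distrib)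
  qed
  ultimately show ?thesis by blast
qed

end

section \<open>Random codebooks\<close>

abbreviation codebook :: "nat \<Rightarrow> nat \<Rightarrow> (nat \<Rightarrow> nat \<Rightarrow> real) measure" where
  "codebook k L \<equiv> PiM {..<k} (\<lambda>_. word_space L)"

lemma prob_space_codebook: "prob_space (codebook k L)"
  by (intro prob_space_PiM prob_space_word_space)

lemma word_component_measurable:
  assumes "l < L" shows "(\<lambda>w. w l) \<in> borel_measurable (word_space L)"
proof -
  have "(\<lambda>w. w l) \<in> measurable (word_space L) std_gauss"
    using assms by (intro measurable_component_singleton) auto
  thus ?thesis by (rule measurable_compose[where g = "\<lambda>x. x"]) measurable
qed

lemma codebook_component_measurable:
  assumes "m < k" "l < L" shows "(\<lambda>c. c m l) \<in> borel_measurable (codebook k L)"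
proof -
  have "(\<lambda>c. c m) \<in> measurable (codebook k L) (word_space L)"
    using assms by (intro measurable_component_singleton) auto
  thus ?thesis by (rule measurable_compose[OF _ word_component_measurable[OF assms(2)]])
qed

lemma idens_measurable [measurable (raw)]:
  assumes "f \<in> borel_measurable M" "f' \<in> borel_measurable M"
  shows "(\<lambda>x. idens g (f x) (f' x)) \<in> borel_measurable M"
  unfolding idens_def using assms by measurable

text \<open>The shift \<open>c\<close> becomes the acceptance threshold: the shifted exponential
  dominates the indicator that the density exceeds it.\<close>

lemma exp_shift_integral:
  fixes F :: "'a \<Rightarrow> real"
  assumes "F \<in> borel_measurable M" "(\<integral>\<^sup>+x. ennreal (exp (F x)) \<partial>M) \<le> 1"
  shows "(\<integral>\<^sup>+x. ennreal (exp (F x - c)) \<partial>M) \<le> ennreal (exp (- c))"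
proof -
  have "(\<integral>\<^sup>+x. ennreal (exp (F x - c)) \<partial>M) = (\<integral>\<^sup>+x. ennreal (exp (- c)) * ennreal (exp (F x)) \<partial>M)"
    by (intro nn_integral_cong) (simp add: ennreal_mult[symmetric] exp_add[symmetric])
  also have "\<dots> = ennreal (exp (- c)) * (\<integral>\<^sup>+x. ennreal (exp (F x)) \<partial>M)"
    using assms(1) by (intro nn_integral_cmult) measurable
  also have "\<dots> \<le> ennreal (exp (- c)) * 1" using assms(2) by (intro mult_left_mono) auto
  finally show ?thesis by simp
qed

context noise_filters
begin

section \<open>The joint space of both codebooks and the noise\<close>

abbreviation cspace :: "nat \<Rightarrow> nat \<Rightarrow> nat \<Rightarrow> nat
    \<Rightarrow> ((nat \<Rightarrow> nat \<Rightarrow> real) \<times> (nat \<Rightarrow> nat \<Rightarrow> real) \<times> (nat \<Rightarrow> real \<times> real \<times> real)) measure" where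
  "cspace k1 k2 L n \<equiv> codebook k1 L \<Otimes>\<^sub>M codebook k2 L \<Otimes>\<^sub>M noise n"

lemma v_measurable:
  assumes "l < L" "L * \<eta> \<le> n"
  shows "v1 l \<in> borel_measurable (noise n)" "v2 l \<in> borel_measurable (noise n)"
  unfolding v1_def[abs_def] v2_def[abs_def] by (rule blin_measurable[OF assms])+

lemma cspace_measurable:
  assumes "l < L" "L * \<eta> \<le> n" 
  shows "m < k1 \<Longrightarrow> (\<lambda>\<omega>. fst \<omega> m l) \<in> borel_measurable (cspace k1 k2 L n)"
    and "m < k2 \<Longrightarrow> (\<lambda>\<omega>. fst (snd \<omega>) m l) \<in> borel_measurable (cspace k1 k2 L n)"
    and "(\<lambda>\<omega>. v1 l (snd (snd \<omega>))) \<in> borel_measurable (cspace k1 k2 L n)"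
    and "(\<lambda>\<omega>. v2 l (snd (snd \<omega>))) \<in> borel_measurable (cspace k1 k2 L n)"
proof -
  show "m < k1 \<Longrightarrow> (\<lambda>\<omega>. fst \<omega> m l) \<in> borel_measurable (cspace k1 k2 L n)"
    by (rule measurable_compose[OF measurable_fst codebook_component_measurable]) (use assms in auto)
  show "m < k2 \<Longrightarrow> (\<lambda>\<omega>. fst (snd \<omega>) m l) \<in> borel_measurable (cspace k1 k2 L n)"
    by (rule measurable_compose[OF measurable_snd measurable_compose[OF measurable_fst codebook_component_measurable]])
       (use assms in auto)
  note [measurable] = v_measurable[OF assms]
  show "(\<lambda>\<omega>. v1 l (snd (snd \<omega>))) \<in> borel_measurable (cspace k1 k2 L n)"
    "(\<lambda>\<omega>. v2 l (snd (snd \<omega>))) \<in> borel_measurable (cspace k1 k2 L n)" by measurable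
qed

lemma T_measurable:
  assumes "l < L" "L * \<eta> \<le> n" "m1 < k1" "m2 < k2"
  shows "(\<lambda>\<omega>. T1 (fst \<omega> m1) (fst (snd \<omega>) m2) (snd (snd \<omega>)) l) \<in> borel_measurable (cspace k1 k2 L n)"
    and "(\<lambda>\<omega>. T2 (fst \<omega> m1) (fst (snd \<omega>) m2) (snd (snd \<omega>)) l) \<in> borel_measurable (cspace k1 k2 L n)"
  unfolding T1_def T2_def using cspace_measurable[OF assms(1,2)] assms(3,4) by measurable

lemma S_measurable:
  assumes "L * \<eta> \<le> n" "m1 < k1" "m2 < k2" "m < k1" "m' < k2"
  shows "(\<lambda>\<omega>. S1 L (fst \<omega> m) (fst (snd \<omega>) m') (T1 (fst \<omega> m1) (fst (snd \<omega>) m2) (snd (snd \<omega>))))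
      \<in> borel_measurable (cspace k1 k2 L n)"
    and "(\<lambda>\<omega>. S2 L (fst \<omega> m) (fst (snd \<omega>) m') (T2 (fst \<omega> m1) (fst (snd \<omega>) m2) (snd (snd \<omega>))))
      \<in> borel_measurable (cspace k1 k2 L n)"
    and "(\<lambda>\<omega>. S12 L (fst \<omega> m) (fst (snd \<omega>) m') (T1 (fst \<omega> m1) (fst (snd \<omega>) m2) (snd (snd \<omega>)))
       (T2 (fst \<omega> m1) (fst (snd \<omega>) m2) (snd (snd \<omega>)))) \<in> borel_measurable (cspace k1 k2 L n)"
  unfolding S1_def S2_def S12_def idens2_def
  by (intro borel_measurable_sum borel_measurable_add idens_measurable borel_measurable_diff
        borel_measurable_times borel_measurable_divide borel_measurable_const T_measurable cspace_measurable;
      use assms in auto)+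

text \<open>The hypothesis on \<open>s\<close> says that the output does not involve word
  \<open>m\<close>. With all other words frozen, the claim becomes \<open>word_exp_idens\<close> for
  this single word.\<close>

lemma codebook_exp_idens:
  assumes m: "m < k" and g: "1 + g > 0" and s: "\<And>c y. s (c(m := y)) = s c"
    and meas: "(\<lambda>c. \<Sum>l<L. idens g (s c l) (c m l)) \<in> borel_measurable (codebook k L)"
  shows "(\<integral>\<^sup>+c. ennreal (exp (\<Sum>l<L. idens g (s c l) (c m l))) \<partial>codebook k L) \<le> 1"
proof -
  interpret prob_space "codebook k L" by (rule prob_space_codebook)
  interpret W: prob_space "word_space L" by (rule prob_space_word_space)
  have "(\<integral>\<^sup>+c. ennreal (exp (\<Sum>l<L. idens g (s c l) (c m l))) \<partial>codebook k L) \<le> (\<integral>\<^sup>+c. 1 \<partial>codebook k L)"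
  proof (rule nn_integral_PiM_coordinate_mono[where j = m])
    show "prob_space (word_space L)" by (rule prob_space_word_space)
    show "(\<lambda>c. ennreal (exp (\<Sum>l<L. idens g (s c l) (c m l)))) \<in> borel_measurable (codebook k L)"
      using meas by measurable
    show "(\<integral>\<^sup>+y. ennreal (exp (\<Sum>l<L. idens g (s (c(m := y)) l) ((c(m := y)) m l))) \<partial>word_space L)
        \<le> (\<integral>\<^sup>+y. 1 \<partial>word_space L)" for c
      by (simp add: s word_exp_idens[OF g] W.emeasure_space_1)
  qed (use m in auto)
  thus ?thesis by (simp add: emeasure_space_1)
qed

text \<open>Since \<open>m \<noteq> m1\<close>, neither the output nor the subtracted interference
  involves word \<open>m\<close>. The second word is the transmitted one: this is the error in which
  only the first message is wrong.\<close>

lemma mean_exp_S1: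
  assumes n: "L * \<eta> \<le> n" and m: "m1 < k1" "m2 < k2" "m < k1" "m \<noteq> m1"
  shows "(\<integral>\<^sup>+\<omega>. ennreal (exp (S1 L (fst \<omega> m) (fst (snd \<omega>) m2) (T1 (fst \<omega> m1) (fst (snd \<omega>) m2) (snd (snd \<omega>)))))
      \<partial>cspace k1 k2 L n) \<le> 1"
proof -
  interpret \<Omega>: prob_space "cspace k1 k2 L n"
    by (intro prob_space_pair prob_space_codebook prob_space_noise_prod)
  interpret C1: prob_space "codebook k1 L" by (rule prob_space_codebook)
  note meas = S_measurable(1)[OF n m(1,2,3,2)]
  have "(\<integral>\<^sup>+\<omega>. ennreal (exp (S1 L (fst \<omega> m) (fst (snd \<omega>) m2) (T1 (fst \<omega> m1) (fst (snd \<omega>) m2) (snd (snd \<omega>)))))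
      \<partial>cspace k1 k2 L n) \<le> (\<integral>\<^sup>+\<omega>. 1 \<partial>cspace k1 k2 L n)"
  proof (rule nn_integral_triple_mono1)
    show "(\<lambda>\<omega>. ennreal (exp (S1 L (fst \<omega> m) (fst (snd \<omega>) m2) (T1 (fst \<omega> m1) (fst (snd \<omega>) m2) (snd (snd \<omega>))))))
      \<in> borel_measurable (cspace k1 k2 L n)" using meas by measurable
    fix c2 g assume cg: "c2 \<in> space (codebook k2 L)" "g \<in> space (noise n)"
    have "(\<lambda>c. S1 L (c m) (c2 m2) (T1 (c m1) (c2 m2) g)) \<in> borel_measurable (codebook k1 L)"
      using measurable_compose[OF measurable_Pair2'[of "(c2, g)" "codebook k2 L \<Otimes>\<^sub>M noise n" "codebook k1 L"] meas] cg
      by (simp add: space_pair_measure)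
    hence "(\<integral>\<^sup>+c. ennreal (exp (S1 L (c m) (c2 m2) (T1 (c m1) (c2 m2) g))) \<partial>codebook k1 L) \<le> 1"
      unfolding S1_def
      by (intro codebook_exp_idens[where s = "\<lambda>c l. T1 (c m1) (c2 m2) g l - h * c2 m2 l"])
         (use m g1_nonneg in auto)
    thus "(\<integral>\<^sup>+x. ennreal (exp (S1 L (fst (x, c2, g) m) (fst (snd (x, c2, g)) m2)
        (T1 (fst (x, c2, g) m1) (fst (snd (x, c2, g)) m2) (snd (snd (x, c2, g)))))) \<partial>codebook k1 L)
      \<le> (\<integral>\<^sup>+x. 1 \<partial>codebook k1 L)" by (simp add: C1.emeasure_space_1)
  qed (auto intro: prob_space_codebook prob_space_noise_prod)
  thus ?thesis by (simp add: \<Omega>.emeasure_space_1)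
qed

lemma mean_exp_S2:
  assumes n: "L * \<eta> \<le> n" and m: "m1 < k1" "m2 < k2" "m < k2" "m \<noteq> m2"
  shows "(\<integral>\<^sup>+\<omega>. ennreal (exp (S2 L (fst \<omega> m1) (fst (snd \<omega>) m) (T2 (fst \<omega> m1) (fst (snd \<omega>) m2) (snd (snd \<omega>)))))
      \<partial>cspace k1 k2 L n) \<le> 1"
proof -
  interpret \<Omega>: prob_space "cspace k1 k2 L n"
    by (intro prob_space_pair prob_space_codebook prob_space_noise_prod)
  interpret C2: prob_space "codebook k2 L" by (rule prob_space_codebook)
  note meas = S_measurable(2)[OF n m(1,2,1,3)]
  have "(\<integral>\<^sup>+\<omega>. ennreal (exp (S2 L (fst \<omega> m1) (fst (snd \<omega>) m) (T2 (fst \<omega> m1) (fst (snd \<omega>) m2) (snd (snd \<omega>)))))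
      \<partial>cspace k1 k2 L n) \<le> (\<integral>\<^sup>+\<omega>. 1 \<partial>cspace k1 k2 L n)"
  proof (rule nn_integral_triple_mono2)
    show "(\<lambda>\<omega>. ennreal (exp (S2 L (fst \<omega> m1) (fst (snd \<omega>) m) (T2 (fst \<omega> m1) (fst (snd \<omega>) m2) (snd (snd \<omega>))))))
      \<in> borel_measurable (cspace k1 k2 L n)" using meas by measurable
    fix c1 g assume cg: "c1 \<in> space (codebook k1 L)" "g \<in> space (noise n)"
    have "(\<lambda>c. (c1, c, g)) \<in> measurable (codebook k2 L) (cspace k1 k2 L n)"
      using cg by measurable
    from measurable_compose[OF this meas]
    have "(\<lambda>c. S2 L (c1 m1) (c m) (T2 (c1 m1) (c m2) g)) \<in> borel_measurable (codebook k2 L)"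
      by simp
    hence "(\<integral>\<^sup>+c. ennreal (exp (S2 L (c1 m1) (c m) (T2 (c1 m1) (c m2) g))) \<partial>codebook k2 L) \<le> 1"
      unfolding S2_def
      by (intro codebook_exp_idens[where s = "\<lambda>c l. T2 (c1 m1) (c m2) g l - h * c1 m1 l"])
         (use m g2_nonneg in auto)
    thus "(\<integral>\<^sup>+y. ennreal (exp (S2 L (fst (c1, y, g) m1) (fst (snd (c1, y, g)) m)
        (T2 (fst (c1, y, g) m1) (fst (snd (c1, y, g)) m2) (snd (snd (c1, y, g)))))) \<partial>codebook k2 L)
      \<le> (\<integral>\<^sup>+y. 1 \<partial>codebook k2 L)" by (simp add: C2.emeasure_space_1)
  qed (auto intro: prob_space_codebook prob_space_noise_prod)
  thus ?thesis by (simp add: \<Omega>.emeasure_space_1)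
qed

text \<open>The wrong word of the second user is averaged out first; what remains is a scalar information
  density of the wrong word of the first user.\<close>
lemma mean_exp_S12:
  assumes n: "L * \<eta> \<le> n" and m: "m1 < k1" "m2 < k2" "m < k1" "m \<noteq> m1" "m' < k2" "m' \<noteq> m2"
  shows "(\<integral>\<^sup>+\<omega>. ennreal (exp (S12 L (fst \<omega> m) (fst (snd \<omega>) m') (T1 (fst \<omega> m1) (fst (snd \<omega>) m2) (snd (snd \<omega>)))
        (T2 (fst \<omega> m1) (fst (snd \<omega>) m2) (snd (snd \<omega>))))) \<partial>cspace k1 k2 L n) \<le> 1"
proof -
  interpret \<Omega>: prob_space "cspace k1 k2 L n"
    by (intro prob_space_pair prob_space_codebook prob_space_noise_prod)
  interpret C1: prob_space "codebook k1 L" by (rule prob_space_codebook)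
  interpret W: prob_space "word_space L" by (rule prob_space_word_space)
  \<comment> \<open>The gain of \<open>x1\<close> once \<open>x2\<close> has been averaged out;
    \<open>1 + g'\<close> is the Schur complement of \<open>1 + g2\<close> in I + G.\<close>
  define g' where "g' = g1 - h\<^sup>2 / (1 + g2)"
  have g': "1 + g' > 0"
  proof -
    have "1 + g' = dd / (1 + g2)" using g2_nonneg by (simp add: g'_def dd_def field_simps)
    thus ?thesis using dd_pos g2_nonneg by simp
  qed
  note meas = S_measurable(3)[OF n m(1,2,3,5)]
  let ?t = "\<lambda>\<omega> l. T1 (fst \<omega> m1) (fst (snd \<omega>) m2) (snd (snd \<omega>)) l - h * T2 (fst \<omega> m1) (fst (snd \<omega>) m2) (snd (snd \<omega>)) l / (1 + g2)"
  let ?H = "\<lambda>\<omega>. \<Sum>l<L. idens g' (?t \<omega> l) (fst \<omega> m l)"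
  have measH: "?H \<in> borel_measurable (cspace k1 k2 L n)"
    by (intro borel_measurable_sum idens_measurable borel_measurable_diff
        borel_measurable_times borel_measurable_divide borel_measurable_const T_measurable cspace_measurable;
      use n m in auto)
  have "(\<integral>\<^sup>+\<omega>. ennreal (exp (S12 L (fst \<omega> m) (fst (snd \<omega>) m') (T1 (fst \<omega> m1) (fst (snd \<omega>) m2) (snd (snd \<omega>)))
        (T2 (fst \<omega> m1) (fst (snd \<omega>) m2) (snd (snd \<omega>))))) \<partial>cspace k1 k2 L n)
      \<le> (\<integral>\<^sup>+\<omega>. ennreal (exp (?H \<omega>)) \<partial>cspace k1 k2 L n)"
  proof (rule nn_integral_triple_mono2)
    show "(\<lambda>\<omega>. ennreal (exp (S12 L (fst \<omega> m) (fst (snd \<omega>) m') (T1 (fst \<omega> m1) (fst (snd \<omega>) m2) (snd (snd \<omega>)))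
        (T2 (fst \<omega> m1) (fst (snd \<omega>) m2) (snd (snd \<omega>)))))) \<in> borel_measurable (cspace k1 k2 L n)"
      using meas by measurable
    show "(\<lambda>\<omega>. ennreal (exp (?H \<omega>))) \<in> borel_measurable (cspace k1 k2 L n)" using measH by measurable
    fix c1 g assume cg: "c1 \<in> space (codebook k1 L)" "g \<in> space (noise n)"
    have pr: "(\<lambda>c. (c1, c, g)) \<in> measurable (codebook k2 L) (cspace k1 k2 L n)"
      using cg by measurable
    have a: "(\<lambda>c. S12 L (c1 m) (c m') (T1 (c1 m1) (c m2) g) (T2 (c1 m1) (c m2) g)) \<in> borel_measurable (codebook k2 L)"
      using measurable_compose[OF pr meas] by simp
    have b: "(\<lambda>c. \<Sum>l<L. idens g' (T1 (c1 m1) (c m2) g l - h * T2 (c1 m1) (c m2) g l / (1 + g2)) (c1 m l))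
        \<in> borel_measurable (codebook k2 L)"
      using measurable_compose[OF pr measH] by simp
    have "(\<integral>\<^sup>+c. ennreal (exp (S12 L (c1 m) (c m') (T1 (c1 m1) (c m2) g) (T2 (c1 m1) (c m2) g))) \<partial>codebook k2 L)
      \<le> (\<integral>\<^sup>+c. ennreal (exp (\<Sum>l<L. idens g' (T1 (c1 m1) (c m2) g l - h * T2 (c1 m1) (c m2) g l / (1 + g2)) (c1 m l))) \<partial>codebook k2 L)"
    proof (rule nn_integral_PiM_coordinate_mono[where j = m'])
      show "prob_space (word_space L)" by (rule prob_space_word_space)
      show "(\<lambda>c. ennreal (exp (S12 L (c1 m) (c m') (T1 (c1 m1) (c m2) g) (T2 (c1 m1) (c m2) g)))) \<in> borel_measurable (codebook k2 L)"
        using a by measurable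
      show "(\<lambda>c. ennreal (exp (\<Sum>l<L. idens g' (T1 (c1 m1) (c m2) g l - h * T2 (c1 m1) (c m2) g l / (1 + g2)) (c1 m l))))
          \<in> borel_measurable (codebook k2 L)" using b by measurable
      fix c
      define A where "A = (\<Sum>l<L. idens g' (T1 (c1 m1) (c m2) g l - h * T2 (c1 m1) (c m2) g l / (1 + g2)) (c1 m l))"
      \<comment> \<open>The wrong word \<open>y\<close> of the second user occurs only in the second
        factor, whose mean is one by \<open>word_exp_idens\<close>.\<close>
      have "exp (S12 L (c1 m) y (T1 (c1 m1) (c m2) g) (T2 (c1 m1) (c m2) g))
        = exp A * exp (\<Sum>l<L. idens g2 (T2 (c1 m1) (c m2) g l - h * c1 m l) (y l))" for y
        by (simp add: S12_def idens2_def A_def g'_def sum.distrib exp_add[symmetric] add.commute)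
      hence "(\<integral>\<^sup>+y. ennreal (exp (S12 L (c1 m) y (T1 (c1 m1) (c m2) g) (T2 (c1 m1) (c m2) g))) \<partial>word_space L)
        = (\<integral>\<^sup>+y. ennreal (exp A) * ennreal (exp (\<Sum>l<L. idens g2 (T2 (c1 m1) (c m2) g l - h * c1 m l) (y l))) \<partial>word_space L)"
        by (simp add: ennreal_mult)
      also have "\<dots> = ennreal (exp A) * 1"
      proof (subst nn_integral_cmult)
        show "(\<lambda>y. ennreal (exp (\<Sum>l<L. idens g2 (T2 (c1 m1) (c m2) g l - h * c1 m l) (y l)))) \<in> borel_measurable (word_space L)"
          by (intro measurable_compose[OF _ measurable_ennreal] measurable_compose[OF _ borel_measurable_exp]
            borel_measurable_sum idens_measurable borel_measurable_const word_component_measurable) auto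
      qed (use g2_nonneg in \<open>simp add: word_exp_idens\<close>)
      finally show "(\<integral>\<^sup>+y. ennreal (exp (S12 L (c1 m) ((c(m' := y)) m') (T1 (c1 m1) ((c(m' := y)) m2) g) (T2 (c1 m1) ((c(m' := y)) m2) g))) \<partial>word_space L)
       \<le> (\<integral>\<^sup>+y. ennreal (exp (\<Sum>l<L. idens g' (T1 (c1 m1) ((c(m' := y)) m2) g l - h * T2 (c1 m1) ((c(m' := y)) m2) g l / (1 + g2)) (c1 m l))) \<partial>word_space L)"
        using m(6) by (simp add: A_def W.emeasure_space_1)
    qed (use m in auto)
    thus "(\<integral>\<^sup>+y. ennreal (exp (S12 L (fst (c1, y, g) m) (fst (snd (c1, y, g)) m') (T1 (fst (c1, y, g) m1) (fst (snd (c1, y, g)) m2) (snd (snd (c1, y, g))))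
        (T2 (fst (c1, y, g) m1) (fst (snd (c1, y, g)) m2) (snd (snd (c1, y, g)))))) \<partial>codebook k2 L)
      \<le> (\<integral>\<^sup>+y. ennreal (exp (?H (c1, y, g))) \<partial>codebook k2 L)" by simp
  qed (auto intro: prob_space_codebook prob_space_noise_prod)
  also have "\<dots> \<le> (\<integral>\<^sup>+\<omega>. 1 \<partial>cspace k1 k2 L n)"
  proof (rule nn_integral_triple_mono1)
    show "(\<lambda>\<omega>. ennreal (exp (?H \<omega>))) \<in> borel_measurable (cspace k1 k2 L n)" using measH by measurable
    fix c2 g assume cg: "c2 \<in> space (codebook k2 L)" "g \<in> space (noise n)"
    have "(\<lambda>c. (c, c2, g)) \<in> measurable (codebook k1 L) (cspace k1 k2 L n)"
      using cg by measurable
    from measurable_compose[OF this measH]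
    have "(\<lambda>c. \<Sum>l<L. idens g' (T1 (c m1) (c2 m2) g l - h * T2 (c m1) (c2 m2) g l / (1 + g2)) (c m l))
       \<in> borel_measurable (codebook k1 L)" by simp
    hence "(\<integral>\<^sup>+c. ennreal (exp (\<Sum>l<L. idens g' (T1 (c m1) (c2 m2) g l - h * T2 (c m1) (c2 m2) g l / (1 + g2)) (c m l))) \<partial>codebook k1 L) \<le> 1"
      by (intro codebook_exp_idens[where s = "\<lambda>c l. T1 (c m1) (c2 m2) g l - h * T2 (c m1) (c2 m2) g l / (1 + g2)"])
         (use m g' in auto)
    thus "(\<integral>\<^sup>+x. ennreal (exp (?H (x, c2, g))) \<partial>codebook k1 L) \<le> (\<integral>\<^sup>+x. 1 \<partial>codebook k1 L)"
      by (simp add: C1.emeasure_space_1)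
  qed (auto intro: prob_space_codebook prob_space_noise_prod)
  finally show ?thesis by (simp add: \<Omega>.emeasure_space_1)
qed


text \<open>Only the words \<open>m1\<close> and \<open>m2\<close> are involved, and together with
  the noise they have the law considered in \<open>discrepancy_mean\<close>; all other words
  integrate out.\<close>

lemma mean_discrepancy_codebook:
  assumes L: "0 < L" and n: "L * \<eta> \<le> n" and m: "m1 < k1" "m2 < k2"
  shows "(\<lambda>\<omega>. discrepancy K L (letters (fst \<omega> m1) (fst (snd \<omega>) m2) (snd (snd \<omega>))))
      \<in> borel_measurable (cspace k1 k2 L n)"
    and "(\<integral>\<^sup>+\<omega>. ennreal (discrepancy (letter_cov g1 g2 h) L (letters (fst \<omega> m1) (fst (snd \<omega>) m2) (snd (snd \<omega>))))
      \<partial>cspace k1 k2 L n) \<le> ennreal (dvar * real L)"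
proof -
  let ?W = "word_space L" and ?C1 = "codebook k1 L" and ?C2 = "codebook k2 L" and ?N = "noise n"
  have p1: "(\<lambda>c. c m1) \<in> measurable ?C1 ?W" using m by (intro measurable_component_singleton) auto
  have p2: "(\<lambda>c. c m2) \<in> measurable ?C2 ?W" using m by (intro measurable_component_singleton) auto
  have proj: "(\<lambda>\<omega>. (fst \<omega> m1, fst (snd \<omega>) m2, snd (snd \<omega>))) \<in> measurable (cspace k1 k2 L n) (?W \<Otimes>\<^sub>M ?W \<Otimes>\<^sub>M ?N)"
    by (intro measurable_Pair measurable_compose[OF measurable_fst p1]
        measurable_compose[OF measurable_snd measurable_compose[OF measurable_fst p2]]
        measurable_compose[OF measurable_snd measurable_snd])
  show meas: "(\<lambda>\<omega>. discrepancy K L (letters (fst \<omega> m1) (fst (snd \<omega>) m2) (snd (snd \<omega>))))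
      \<in> borel_measurable (cspace k1 k2 L n)" for K
    using measurable_compose[OF proj discrepancy_measurable[OF n, of K]] by simp
  interpret W: prob_space ?W by (rule prob_space_word_space)
  interpret C1: prob_space ?C1 by (rule prob_space_codebook)
  interpret C2: prob_space ?C2 by (rule prob_space_codebook)
  interpret N: prob_space ?N by (rule prob_space_noise_prod)
  interpret CN: prob_space "?C2 \<Otimes>\<^sub>M ?N" by (intro prob_space_pair prob_space_codebook prob_space_noise_prod)
  interpret WN: prob_space "?W \<Otimes>\<^sub>M ?N" by (intro prob_space_pair prob_space_word_space prob_space_noise_prod)
  define f where "f = (\<lambda>\<omega>. ennreal (discrepancy (letter_cov g1 g2 h) L (letters (fst \<omega>) (fst (snd \<omega>)) (snd (snd \<omega>)))))"
  have f [measurable]: "f \<in> borel_measurable (?W \<Otimes>\<^sub>M ?W \<Otimes>\<^sub>M ?N)"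
    unfolding f_def using discrepancy_measurable[OF n] by measurable
  have "(\<integral>\<^sup>+\<omega>. f (fst \<omega> m1, fst (snd \<omega>) m2, snd (snd \<omega>)) \<partial>cspace k1 k2 L n)
      = (\<integral>\<^sup>+c1. (\<integral>\<^sup>+p. f (c1 m1, fst p m2, snd p) \<partial>(?C2 \<Otimes>\<^sub>M ?N)) \<partial>?C1)"
    using CN.nn_integral_fst[OF measurable_compose[OF proj f]] by simp
  also have "\<dots> = (\<integral>\<^sup>+c1. (\<integral>\<^sup>+p. f (c1 m1, p) \<partial>(?W \<Otimes>\<^sub>M ?N)) \<partial>?C1)"
  proof (rule nn_integral_cong)
    fix c1 assume "c1 \<in> space ?C1"
    hence c1: "c1 m1 \<in> space ?W" using measurable_space[OF p1] by simp
    have fc [measurable]: "(\<lambda>p. f (c1 m1, p)) \<in> borel_measurable (?W \<Otimes>\<^sub>M ?N)" using c1 by measurable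
    have proj2: "(\<lambda>p. (fst p m2, snd p)) \<in> measurable (?C2 \<Otimes>\<^sub>M ?N) (?W \<Otimes>\<^sub>M ?N)"
      by (intro measurable_Pair measurable_compose[OF measurable_fst p2] measurable_snd)
    have "(\<integral>\<^sup>+p. f (c1 m1, fst p m2, snd p) \<partial>(?C2 \<Otimes>\<^sub>M ?N)) = (\<integral>\<^sup>+c2. (\<integral>\<^sup>+g. f (c1 m1, c2 m2, g) \<partial>?N) \<partial>?C2)"
      using N.nn_integral_fst[OF measurable_compose[OF proj2 fc]] by simp
    also have "\<dots> = (\<integral>\<^sup>+x2. (\<integral>\<^sup>+g. f (c1 m1, x2, g) \<partial>?N) \<partial>?W)"
      using m(2) by (intro nn_integral_PiM_component[where M = "\<lambda>_. ?W", OF prob_space_word_space]) auto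
    also have "\<dots> = (\<integral>\<^sup>+p. f (c1 m1, p) \<partial>(?W \<Otimes>\<^sub>M ?N))"
      by (rule N.nn_integral_fst[OF fc])
    finally show "(\<integral>\<^sup>+p. f (c1 m1, fst p m2, snd p) \<partial>(?C2 \<Otimes>\<^sub>M ?N)) = (\<integral>\<^sup>+p. f (c1 m1, p) \<partial>(?W \<Otimes>\<^sub>M ?N))" .
  qed
  also have "\<dots> = (\<integral>\<^sup>+x1. (\<integral>\<^sup>+p. f (x1, p) \<partial>(?W \<Otimes>\<^sub>M ?N)) \<partial>?W)"
    using m(1) by (intro nn_integral_PiM_component[where M = "\<lambda>_. ?W", OF prob_space_word_space]) auto
  also have "\<dots> = (\<integral>\<^sup>+\<omega>. f \<omega> \<partial>(?W \<Otimes>\<^sub>M ?W \<Otimes>\<^sub>M ?N))" by (rule WN.nn_integral_fst[OF f])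
  also have "\<dots> \<le> ennreal (dvar * real L)" unfolding f_def by (rule discrepancy_mean[OF L n])
  finally show "(\<integral>\<^sup>+\<omega>. ennreal (discrepancy (letter_cov g1 g2 h) L (letters (fst \<omega> m1) (fst (snd \<omega>) m2) (snd (snd \<omega>))))
      \<partial>cspace k1 k2 L n) \<le> ennreal (dvar * real L)" by (simp add: f_def)
qed

text \<open>Dominates the indicator of a decoding error for the message pair \<open>(m1, m2)\<close>: the first
  summand is at least one when the transmitted pair is rejected (Chebyshev), the others when a
  competing pair is accepted (union bound and exponential Markov inequality).\<close>
definition penalty :: "real \<Rightarrow> real \<Rightarrow> nat \<Rightarrow> nat \<Rightarrow> nat \<Rightarrow> nat \<Rightarrow> nat
    \<Rightarrow> (nat \<Rightarrow> nat \<Rightarrow> real) \<Rightarrow> (nat \<Rightarrow> nat \<Rightarrow> real) \<Rightarrow> (nat \<Rightarrow> real \<times> real \<times> real) \<Rightarrow> ennreal" where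
  "penalty \<epsilon> \<tau> L k1 k2 m1 m2 c1 c2 g =
     ennreal (discrepancy (letter_cov g1 g2 h) L (letters (c1 m1) (c2 m2) g) / (real L * \<tau>)\<^sup>2)
     + (\<Sum>m\<in>{..<k1} - {m1}. ennreal (exp (S1 L (c1 m) (c2 m2) (T1 (c1 m1) (c2 m2) g) - real L * (I1 - \<epsilon>))))
     + (\<Sum>m\<in>{..<k2} - {m2}. ennreal (exp (S2 L (c1 m1) (c2 m) (T2 (c1 m1) (c2 m2) g) - real L * (I2 - \<epsilon>))))
     + (\<Sum>m\<in>{..<k1} - {m1}. \<Sum>m'\<in>{..<k2} - {m2}.
          ennreal (exp (S12 L (c1 m) (c2 m') (T1 (c1 m1) (c2 m2) g) (T2 (c1 m1) (c2 m2) g) - real L * (I12 - \<epsilon>))))"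

text \<open>Bounds the mean of \<open>penalty\<close> term by term: the Chebyshev term of order 1 /
  L, then the number of competitors of each kind times the exponential of minus their
  threshold.\<close>

definition pbound :: "real \<Rightarrow> real \<Rightarrow> nat \<Rightarrow> nat \<Rightarrow> nat \<Rightarrow> real" where
  "pbound \<epsilon> \<tau> L k1 k2 = dvar * real L / (real L * \<tau>)\<^sup>2
     + real (k1 - 1) * exp (- (real L * (I1 - \<epsilon>))) + real (k2 - 1) * exp (- (real L * (I2 - \<epsilon>)))
     + real (k1 - 1) * real (k2 - 1) * exp (- (real L * (I12 - \<epsilon>)))"

lemma penalty_mean:
  assumes L: "0 < L" and n: "L * \<eta> \<le> n" and m: "m1 < k1" "m2 < k2" and \<tau>: "0 < \<tau>"
  shows "(\<lambda>\<omega>. penalty \<epsilon> \<tau> L k1 k2 m1 m2 (fst \<omega>) (fst (snd \<omega>)) (snd (snd \<omega>)))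
      \<in> borel_measurable (cspace k1 k2 L n)" (is ?meas)
    and "(\<integral>\<^sup>+\<omega>. penalty \<epsilon> \<tau> L k1 k2 m1 m2 (fst \<omega>) (fst (snd \<omega>)) (snd (snd \<omega>)) \<partial>cspace k1 k2 L n)
      \<le> ennreal (pbound \<epsilon> \<tau> L k1 k2)"
proof -
  let ?P = "cspace k1 k2 L n"
  let ?D = "\<lambda>\<omega>. ennreal (discrepancy (letter_cov g1 g2 h) L (letters (fst \<omega> m1) (fst (snd \<omega>) m2) (snd (snd \<omega>))) / (real L * \<tau>)\<^sup>2)"
  let ?A = "\<lambda>m \<omega>. ennreal (exp (S1 L (fst \<omega> m) (fst (snd \<omega>) m2) (T1 (fst \<omega> m1) (fst (snd \<omega>) m2) (snd (snd \<omega>))) - real L * (I1 - \<epsilon>)))"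
  let ?B = "\<lambda>m \<omega>. ennreal (exp (S2 L (fst \<omega> m1) (fst (snd \<omega>) m) (T2 (fst \<omega> m1) (fst (snd \<omega>) m2) (snd (snd \<omega>))) - real L * (I2 - \<epsilon>)))"
  let ?C = "\<lambda>m m' \<omega>. ennreal (exp (S12 L (fst \<omega> m) (fst (snd \<omega>) m') (T1 (fst \<omega> m1) (fst (snd \<omega>) m2) (snd (snd \<omega>)))
        (T2 (fst \<omega> m1) (fst (snd \<omega>) m2) (snd (snd \<omega>))) - real L * (I12 - \<epsilon>)))"
  have D: "?D \<in> borel_measurable ?P"
    using mean_discrepancy_codebook(1)[OF L n m] by measurable
  have A: "?A m \<in> borel_measurable ?P" if "m \<in> {..<k1} - {m1}" for m
    by (intro measurable_compose[OF _ measurable_ennreal] measurable_compose[OF _ borel_measurable_exp]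
        borel_measurable_diff borel_measurable_const S_measurable) (use n that m in auto)
  have B: "?B m' \<in> borel_measurable ?P" if "m' \<in> {..<k2} - {m2}" for m'
    by (intro measurable_compose[OF _ measurable_ennreal] measurable_compose[OF _ borel_measurable_exp]
        borel_measurable_diff borel_measurable_const S_measurable) (use n that m in auto)
  have C: "?C m m' \<in> borel_measurable ?P" if "m \<in> {..<k1} - {m1}" "m' \<in> {..<k2} - {m2}" for m m'
    by (intro measurable_compose[OF _ measurable_ennreal] measurable_compose[OF _ borel_measurable_exp]
        borel_measurable_diff borel_measurable_const S_measurable) (use n that m in auto)
  have sA: "(\<lambda>\<omega>. \<Sum>m\<in>{..<k1} - {m1}. ?A m \<omega>) \<in> borel_measurable ?P" by (intro borel_measurable_sum A)
  have sB: "(\<lambda>\<omega>. \<Sum>m\<in>{..<k2} - {m2}. ?B m \<omega>) \<in> borel_measurable ?P" by (intro borel_measurable_sum B)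
  have sC: "(\<lambda>\<omega>. \<Sum>m\<in>{..<k1} - {m1}. \<Sum>m'\<in>{..<k2} - {m2}. ?C m m' \<omega>) \<in> borel_measurable ?P"
    by (intro borel_measurable_sum C)
  show ?meas unfolding penalty_def by (intro borel_measurable_add D sA sB sC)
  have iD: "(\<integral>\<^sup>+\<omega>. ?D \<omega> \<partial>?P) \<le> ennreal (dvar * real L / (real L * \<tau>)\<^sup>2)"
  proof -
    define c where "c = 1 / (real L * \<tau>)\<^sup>2"
    have c: "0 \<le> c" by (simp add: c_def)
    have "(\<integral>\<^sup>+\<omega>. ?D \<omega> \<partial>?P) = (\<integral>\<^sup>+\<omega>. ennreal c * ennreal (discrepancy (letter_cov g1 g2 h) L (letters (fst \<omega> m1) (fst (snd \<omega>) m2) (snd (snd \<omega>)))) \<partial>?P)"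
      using c discrepancy_nonneg by (intro nn_integral_cong) (simp add: c_def ennreal_mult[symmetric])
    also have "\<dots> = ennreal c * (\<integral>\<^sup>+\<omega>. ennreal (discrepancy (letter_cov g1 g2 h) L (letters (fst \<omega> m1) (fst (snd \<omega>) m2) (snd (snd \<omega>)))) \<partial>?P)"
      by (intro nn_integral_cmult measurable_compose[OF _ measurable_ennreal] mean_discrepancy_codebook(1)[OF L n m])
    also have "\<dots> \<le> ennreal c * ennreal (dvar * real L)"
      by (intro mult_left_mono mean_discrepancy_codebook(2)[OF L n m]) auto
    also have "\<dots> = ennreal (dvar * real L / (real L * \<tau>)\<^sup>2)"
      using c dvar_nonneg by (simp add: ennreal_mult[symmetric] c_def)
    finally show ?thesis .
  qed
  have iA: "(\<integral>\<^sup>+\<omega>. (\<Sum>m\<in>{..<k1} - {m1}. ?A m \<omega>) \<partial>?P) \<le> ennreal (real (k1 - 1) * exp (- (real L * (I1 - \<epsilon>))))"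
  proof -
    have "(\<integral>\<^sup>+\<omega>. (\<Sum>m\<in>{..<k1} - {m1}. ?A m \<omega>) \<partial>?P) = (\<Sum>m\<in>{..<k1} - {m1}. \<integral>\<^sup>+\<omega>. ?A m \<omega> \<partial>?P)"
      by (rule nn_integral_sum[OF A])
    also have "\<dots> \<le> (\<Sum>m\<in>{..<k1} - {m1}. ennreal (exp (- (real L * (I1 - \<epsilon>)))))"
      by (intro sum_mono exp_shift_integral S_measurable mean_exp_S1) (use n m in auto)
    also have "\<dots> = ennreal (real (k1 - 1) * exp (- (real L * (I1 - \<epsilon>))))"
      using m by (simp add: ennreal_mult ennreal_of_nat_eq_real_of_nat)
    finally show ?thesis .
  qed
  have iB: "(\<integral>\<^sup>+\<omega>. (\<Sum>m\<in>{..<k2} - {m2}. ?B m \<omega>) \<partial>?P) \<le> ennreal (real (k2 - 1) * exp (- (real L * (I2 - \<epsilon>))))"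
  proof -
    have "(\<integral>\<^sup>+\<omega>. (\<Sum>m\<in>{..<k2} - {m2}. ?B m \<omega>) \<partial>?P) = (\<Sum>m\<in>{..<k2} - {m2}. \<integral>\<^sup>+\<omega>. ?B m \<omega> \<partial>?P)"
      by (rule nn_integral_sum[OF B])
    also have "\<dots> \<le> (\<Sum>m\<in>{..<k2} - {m2}. ennreal (exp (- (real L * (I2 - \<epsilon>)))))"
      by (intro sum_mono exp_shift_integral S_measurable mean_exp_S2) (use n m in auto)
    also have "\<dots> = ennreal (real (k2 - 1) * exp (- (real L * (I2 - \<epsilon>))))"
      using m by (simp add: ennreal_mult ennreal_of_nat_eq_real_of_nat)
    finally show ?thesis .
  qed
  have iC: "(\<integral>\<^sup>+\<omega>. (\<Sum>m\<in>{..<k1} - {m1}. \<Sum>m'\<in>{..<k2} - {m2}. ?C m m' \<omega>) \<partial>?P)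
      \<le> ennreal (real (k1 - 1) * real (k2 - 1) * exp (- (real L * (I12 - \<epsilon>))))"
  proof -
    have "(\<integral>\<^sup>+\<omega>. (\<Sum>m\<in>{..<k1} - {m1}. \<Sum>m'\<in>{..<k2} - {m2}. ?C m m' \<omega>) \<partial>?P)
      = (\<Sum>m\<in>{..<k1} - {m1}. \<integral>\<^sup>+\<omega>. (\<Sum>m'\<in>{..<k2} - {m2}. ?C m m' \<omega>) \<partial>?P)"
      by (intro nn_integral_sum borel_measurable_sum C)
    also have "\<dots> = (\<Sum>m\<in>{..<k1} - {m1}. \<Sum>m'\<in>{..<k2} - {m2}. \<integral>\<^sup>+\<omega>. ?C m m' \<omega> \<partial>?P)"
      by (intro sum.cong refl nn_integral_sum C)
    also have "\<dots> \<le> (\<Sum>m\<in>{..<k1} - {m1}. \<Sum>m'\<in>{..<k2} - {m2}. ennreal (exp (- (real L * (I12 - \<epsilon>)))))"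
      by (intro sum_mono exp_shift_integral S_measurable mean_exp_S12) (use n m in auto)
    also have "\<dots> = ennreal (real (k1 - 1) * real (k2 - 1) * exp (- (real L * (I12 - \<epsilon>))))"
      using m by (simp add: ennreal_mult ennreal_of_nat_eq_real_of_nat mult.assoc)
    finally show ?thesis .
  qed
  have "(\<integral>\<^sup>+\<omega>. penalty \<epsilon> \<tau> L k1 k2 m1 m2 (fst \<omega>) (fst (snd \<omega>)) (snd (snd \<omega>)) \<partial>?P)
    = (\<integral>\<^sup>+\<omega>. ?D \<omega> \<partial>?P) + (\<integral>\<^sup>+\<omega>. (\<Sum>m\<in>{..<k1} - {m1}. ?A m \<omega>) \<partial>?P)
      + (\<integral>\<^sup>+\<omega>. (\<Sum>m\<in>{..<k2} - {m2}. ?B m \<omega>) \<partial>?P)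
      + (\<integral>\<^sup>+\<omega>. (\<Sum>m\<in>{..<k1} - {m1}. \<Sum>m'\<in>{..<k2} - {m2}. ?C m m' \<omega>) \<partial>?P)"
    unfolding penalty_def using D sA sB sC by (simp add: nn_integral_add)
  also have "\<dots> \<le> ennreal (dvar * real L / (real L * \<tau>)\<^sup>2) + ennreal (real (k1 - 1) * exp (- (real L * (I1 - \<epsilon>))))
      + ennreal (real (k2 - 1) * exp (- (real L * (I2 - \<epsilon>))))
      + ennreal (real (k1 - 1) * real (k2 - 1) * exp (- (real L * (I12 - \<epsilon>))))"
    by (intro add_mono iD iA iB iC)
  also have "\<dots> = ennreal (pbound \<epsilon> \<tau> L k1 k2)"
    unfolding pbound_def using dvar_nonneg by (simp add: ennreal_plus)
  finally show "(\<integral>\<^sup>+\<omega>. penalty \<epsilon> \<tau> L k1 k2 m1 m2 (fst \<omega>) (fst (snd \<omega>)) (snd (snd \<omega>)) \<partial>?P) \<le> ennreal (pbound \<epsilon> \<tau> L k1 k2)" .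
qed

text \<open>The penalties of all message pairs are summed before the codebooks are averaged, so a
  single choice serves all messages at once. A function whose mean is below a bound is itself below
  it somewhere; this is applied to the first codebook and then, with that one fixed, to the
  second.\<close>

lemma good_codebook_exists:
  assumes L: "0 < L" and n: "L * \<eta> \<le> n" and k: "0 < k1" "0 < k2" and \<tau>: "0 < \<tau>" and \<beta>: "pbound \<epsilon> \<tau> L k1 k2 < \<beta>"
  shows "\<exists>c1 c2. (\<forall>m1<k1. \<forall>m2<k2. penalty \<epsilon> \<tau> L k1 k2 m1 m2 c1 c2 \<in> borel_measurable (noise n)) \<and>
    (\<Sum>m1<k1. \<Sum>m2<k2. \<integral>\<^sup>+g. penalty \<epsilon> \<tau> L k1 k2 m1 m2 c1 c2 g \<partial>noise n) < of_nat (k1 * k2) * ennreal \<beta>"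
proof -
  let ?C1 = "codebook k1 L" and ?C2 = "codebook k2 L" and ?N = "noise n"
  interpret C1: prob_space ?C1 by (rule prob_space_codebook)
  interpret C2: prob_space ?C2 by (rule prob_space_codebook)
  interpret N: prob_space ?N by (rule prob_space_noise_prod)
  interpret CN: prob_space "?C2 \<Otimes>\<^sub>M ?N" by (intro prob_space_pair prob_space_codebook prob_space_noise_prod)
  define f where "f = (\<lambda>m1 m2 \<omega>. penalty \<epsilon> \<tau> L k1 k2 m1 m2 (fst \<omega>) (fst (snd \<omega>)) (snd (snd \<omega>)))"
  have fm: "f m1 m2 \<in> borel_measurable (cspace k1 k2 L n)" if "m1 < k1" "m2 < k2" for m1 m2
    unfolding f_def by (rule penalty_mean(1)[OF L n that \<tau>])
  have fi: "(\<integral>\<^sup>+\<omega>. f m1 m2 \<omega> \<partial>cspace k1 k2 L n) \<le> ennreal (pbound \<epsilon> \<tau> L k1 k2)" if "m1 < k1" "m2 < k2" for m1 m2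
    unfolding f_def by (rule penalty_mean(2)[OF L n that \<tau>])
  define F where "F = (\<lambda>\<omega>. \<Sum>m1<k1. \<Sum>m2<k2. f m1 m2 \<omega>)"
  have F: "F \<in> borel_measurable (cspace k1 k2 L n)"
    unfolding F_def by (intro borel_measurable_sum fm) auto
  have pb: "0 \<le> pbound \<epsilon> \<tau> L k1 k2" using dvar_nonneg by (simp add: pbound_def)
  have "(\<integral>\<^sup>+\<omega>. F \<omega> \<partial>cspace k1 k2 L n) = (\<Sum>m1<k1. \<integral>\<^sup>+\<omega>. (\<Sum>m2<k2. f m1 m2 \<omega>) \<partial>cspace k1 k2 L n)"
    unfolding F_def by (intro nn_integral_sum borel_measurable_sum fm) auto
  also have "\<dots> = (\<Sum>m1<k1. \<Sum>m2<k2. \<integral>\<^sup>+\<omega>. f m1 m2 \<omega> \<partial>cspace k1 k2 L n)"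
    by (intro sum.cong refl nn_integral_sum fm) auto
  also have "\<dots> \<le> (\<Sum>m1<k1. \<Sum>m2<k2. ennreal (pbound \<epsilon> \<tau> L k1 k2))"
    by (intro sum_mono fi) auto
  also have "\<dots> = of_nat (k1 * k2) * ennreal (pbound \<epsilon> \<tau> L k1 k2)" by (simp add: mult.assoc)
  also have "\<dots> < of_nat (k1 * k2) * ennreal \<beta>"
    using k \<beta> pb by (simp add: ennreal_of_nat_eq_real_of_nat ennreal_mult[symmetric] ennreal_less_iff)
  finally have "(\<integral>\<^sup>+c1. (\<integral>\<^sup>+p. F (c1, p) \<partial>(?C2 \<Otimes>\<^sub>M ?N)) \<partial>?C1) < of_nat (k1 * k2) * ennreal \<beta>"
    unfolding CN.nn_integral_fst[OF F] .
  then obtain c1 where c1: "c1 \<in> space ?C1" "(\<integral>\<^sup>+p. F (c1, p) \<partial>(?C2 \<Otimes>\<^sub>M ?N)) < of_nat (k1 * k2) * ennreal \<beta>"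
    using C1.nn_integral_less_imp_exists[OF CN.borel_measurable_nn_integral_fst[OF F]] by blast
  have F1: "(\<lambda>p. F (c1, p)) \<in> borel_measurable (?C2 \<Otimes>\<^sub>M ?N)" using F c1(1) by measurable
  from c1(2) have "(\<integral>\<^sup>+c2. (\<integral>\<^sup>+g. F (c1, c2, g) \<partial>?N) \<partial>?C2) < of_nat (k1 * k2) * ennreal \<beta>"
    unfolding N.nn_integral_fst[OF F1] .
  then obtain c2 where c2: "c2 \<in> space ?C2" "(\<integral>\<^sup>+g. F (c1, c2, g) \<partial>?N) < of_nat (k1 * k2) * ennreal \<beta>"
    using C2.nn_integral_less_imp_exists[OF N.borel_measurable_nn_integral_fst[OF F1]] by blast
  have pr: "(\<lambda>g. (c1, c2, g)) \<in> measurable ?N (cspace k1 k2 L n)" using c1 c2 by measurable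
  have pm: "penalty \<epsilon> \<tau> L k1 k2 m1 m2 c1 c2 \<in> borel_measurable ?N" if "m1 < k1" "m2 < k2" for m1 m2
    using measurable_compose[OF pr fm[OF that]] by (simp add: f_def)
  have "(\<integral>\<^sup>+g. F (c1, c2, g) \<partial>?N) = (\<integral>\<^sup>+g. (\<Sum>m1<k1. \<Sum>m2<k2. penalty \<epsilon> \<tau> L k1 k2 m1 m2 c1 c2 g) \<partial>?N)"
    by (simp add: F_def f_def)
  also have "\<dots> = (\<Sum>m1<k1. \<integral>\<^sup>+g. (\<Sum>m2<k2. penalty \<epsilon> \<tau> L k1 k2 m1 m2 c1 c2 g) \<partial>?N)"
    by (intro nn_integral_sum borel_measurable_sum pm) auto
  also have "\<dots> = (\<Sum>m1<k1. \<Sum>m2<k2. \<integral>\<^sup>+g. penalty \<epsilon> \<tau> L k1 k2 m1 m2 c1 c2 g \<partial>?N)"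
    by (intro sum.cong refl nn_integral_sum pm) auto
  finally show ?thesis using c2(2) pm by (intro exI[of _ c1] exI[of _ c2]) auto
qed

end

section \<open>The linear feedback scheme\<close>

lemma length_out_seq [simp]: "length (out_seq f1 f2 m1 m2 z w1 w2 t) = t"
  by (induction t) (auto simp: Let_def)

text \<open>Later steps only append to the list, so an output is already determined by the run up to
  its own time.\<close>

lemma out_seq_nth:
  "s < t \<Longrightarrow> out_seq f1 f2 m1 m2 z w1 w2 t ! s = out_seq f1 f2 m1 m2 z w1 w2 (Suc s) ! s"
proof (induction t)
  case (Suc t)
  show ?case
  proof (cases "s = t")
    case False
    hence "s < t" using Suc.prems by simp
    thus ?thesis using Suc.IH by (simp add: Let_def nth_append)
  qed simp
qed simp

lemma fb_past_out_seq:
  "fb_past (out_seq f1 f2 m1 m2 z w1 w2 t) w t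
    = (\<lambda>s\<in>{..<t}. out_seq f1 f2 m1 m2 z w1 w2 (Suc s) ! s + w s)"
  unfolding fb_past_def by (intro restrict_ext arg_cong2[where f = "(+)"] refl out_seq_nth) simp

lemma out_seq_last:
  "out_seq f1 f2 m1 m2 z w1 w2 (Suc t) ! t =
     f1 t m1 (fb_past (out_seq f1 f2 m1 m2 z w1 w2 t) w1 t)
     + f2 t m2 (fb_past (out_seq f1 f2 m1 m2 z w1 w2 t) w2 t) + z t"
  by (simp add: Let_def nth_append)

text \<open>The scheme restarts in every block: feedback from earlier blocks is ignored, and the sum
  stops before the current time, as causality demands. After the \<open>L\<close> complete blocks
  nothing is sent.\<close>

definition lin_enc :: "nat \<Rightarrow> nat \<Rightarrow> (nat \<Rightarrow> real) \<Rightarrow> (nat \<Rightarrow> nat \<Rightarrow> real) \<Rightarrow> (nat \<Rightarrow> nat \<Rightarrow> real)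
    \<Rightarrow> nat \<Rightarrow> nat \<Rightarrow> (nat \<Rightarrow> real) \<Rightarrow> real" where
  "lin_enc \<eta> L a B c t m v = (if t < L * \<eta> then a (t mod \<eta>) * c m (t div \<eta>)
     + (\<Sum>j<t mod \<eta>. B (t mod \<eta>) j * v (t div \<eta> * \<eta> + j)) else 0)"

lemma lin_enc_measurable:
  "lin_enc \<eta> L a B c t m \<in> borel_measurable (PiM {..<t} (\<lambda>_. borel))"
proof -
  have "(\<lambda>v. v (t div \<eta> * \<eta> + j)) \<in> borel_measurable (PiM {..<t} (\<lambda>_. borel))"
    if "j < t mod \<eta>" for j
  proof (rule measurable_component_singleton)
    show "t div \<eta> * \<eta> + j \<in> {..<t}"
      using that div_mult_mod_eq[of t \<eta>] by (simp only: lessThan_iff)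
  qed
  hence "(\<lambda>v. \<Sum>j<t mod \<eta>. B (t mod \<eta>) j * v (t div \<eta> * \<eta> + j)) \<in> borel_measurable (PiM {..<t} (\<lambda>_. borel :: real measure))"
    by (intro borel_measurable_sum borel_measurable_times borel_measurable_const) auto
  thus ?thesis unfolding lin_enc_def[abs_def] by measurable
qed

lemma lin_enc_block:
  assumes "l < L" "i < \<eta>" and B: "\<And>i j. i \<le> j \<Longrightarrow> B i j = 0"
  shows "lin_enc \<eta> L a B c (l * \<eta> + i) m v = a i * c m l + (\<Sum>j<\<eta>. B i j * v (l * \<eta> + j))"
proof -
  have "l * \<eta> + i < L * \<eta>" by (rule block_index_less[OF assms(1,2)]) simp
  moreover have "(l * \<eta> + i) mod \<eta> = i" "(l * \<eta> + i) div \<eta> = l" using assms(2) by auto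
  moreover have "(\<Sum>j<i. B i j * v (l * \<eta> + j)) = (\<Sum>j<\<eta>. B i j * v (l * \<eta> + j))"
    using assms(2) B by (intro sum.mono_neutral_left) (auto simp: not_less)
  ultimately show ?thesis by (simp add: lin_enc_def)
qed

lemma lin_enc_block_past:
  assumes "l < L" "i < \<eta>" and B: "\<And>i j. i \<le> j \<Longrightarrow> B i j = 0"
  shows "lin_enc \<eta> L a B c (l * \<eta> + i) m (\<lambda>s\<in>{..<l * \<eta> + i}. y s)
    = a i * c m l + (\<Sum>j<\<eta>. B i j * y (l * \<eta> + j))"
proof -
  \<comment> \<open>Outside the past \<open>restrict\<close> returns \<open>undefined\<close>, but
    there \<open>B i j\<close> is zero.\<close>
  have "B i j * restrict y {..<l * \<eta> + i} (l * \<eta> + j) = B i j * y (l * \<eta> + j)" for j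
    using B[of i j] by (cases "j < i") auto
  thus ?thesis by (simp only: lin_enc_block[OF assms])
qed

lemma sum_blocks: "(\<Sum>t<L * \<eta>. f t) = (\<Sum>l<L. \<Sum>i<\<eta>. f (l * \<eta> + i))"
  for f :: "nat \<Rightarrow> 'a::comm_monoid_add" and L \<eta> :: nat
proof (induction L)
  case (Suc L)
  have "(\<Sum>t<Suc L * \<eta>. f t) = (\<Sum>t<L * \<eta> + \<eta>. f t)" by (simp add: add.commute)
  also have "\<dots> = (\<Sum>t<L * \<eta>. f t) + (\<Sum>i<\<eta>. f (L * \<eta> + i))"
    using sum.atLeastLessThan_concat[of 0 "L * \<eta>" "L * \<eta> + \<eta>" f] sum.shift_bounds_nat_ivl[of f 0 "L * \<eta>" \<eta>]
    by (simp add: lessThan_atLeast0 add.commute)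
  finally show ?case using Suc by simp
qed simp

text \<open>The effective noise of a block is Z + B1 W1 + B2 W2, so a filter \<open>u\<close> has
  the noise coefficients \<open>u\<close>, u^T B1 and u^T B2. The equations \<open>match\<close>
  require the gains of the filters to coincide with their noise covariance.\<close>

locale linear_scheme =
  fixes N s1 s2 r :: real and \<eta> :: nat
    and a1 a2 :: "nat \<Rightarrow> real" and B1 B2 :: "nat \<Rightarrow> nat \<Rightarrow> real"
    and u1 u2 :: "nat \<Rightarrow> real" and g1 g2 h :: real
  assumes filters: "noise_filters N s1 s2 r \<eta> u1 (\<lambda>j. \<Sum>i<\<eta>. u1 i * B1 i j) (\<lambda>j. \<Sum>i<\<eta>. u1 i * B2 i j)
      u2 (\<lambda>j. \<Sum>i<\<eta>. u2 i * B1 i j) (\<lambda>j. \<Sum>i<\<eta>. u2 i * B2 i j) g1 g2 h"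
    and lower: "\<And>i j. i \<le> j \<Longrightarrow> B1 i j = 0" "\<And>i j. i \<le> j \<Longrightarrow> B2 i j = 0"
    and match: "(\<Sum>i<\<eta>. u1 i * a1 i) = g1" "(\<Sum>i<\<eta>. u1 i * a2 i) = h"
      "(\<Sum>i<\<eta>. u2 i * a1 i) = h" "(\<Sum>i<\<eta>. u2 i * a2 i) = g2"
begin

sublocale noise_filters N s1 s2 r \<eta> u1 "\<lambda>j. \<Sum>i<\<eta>. u1 i * B1 i j" "\<lambda>j. \<Sum>i<\<eta>. u1 i * B2 i j"
      u2 "\<lambda>j. \<Sum>i<\<eta>. u2 i * B1 i j" "\<lambda>j. \<Sum>i<\<eta>. u2 i * B2 i j" g1 g2 h
  by (rule filters)

definition mfilt :: "(nat \<Rightarrow> real) \<Rightarrow> (nat \<Rightarrow> real) \<Rightarrow> nat \<Rightarrow> real" where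
  "mfilt u y l = (\<Sum>i<\<eta>. u i * (y (l * \<eta> + i) - (\<Sum>j<\<eta>. (B1 i j + B2 i j) * y (l * \<eta> + j))))"

abbreviation enc1 where "enc1 L c \<equiv> lin_enc \<eta> L a1 B1 c"
abbreviation enc2 where "enc2 L c \<equiv> lin_enc \<eta> L a2 B2 c"

text \<open>Time \<open>s\<close> is read off the shortest run that contains it, so the outputs do
  not depend on the blocklength.\<close>

definition outs :: "nat \<Rightarrow> (nat \<Rightarrow> nat \<Rightarrow> real) \<Rightarrow> (nat \<Rightarrow> nat \<Rightarrow> real) \<Rightarrow> nat \<Rightarrow> nat
    \<Rightarrow> (nat \<Rightarrow> real \<times> real \<times> real) \<Rightarrow> nat \<Rightarrow> real" where
  "outs L c1 c2 m1 m2 g s = out_seq (enc1 L c1) (enc2 L c2) m1 m2 (noiseZ g) (noiseW1 g) (noiseW2 g) (Suc s) ! s"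

lemma chanX_block:
  assumes "l < L" "i < \<eta>"
  shows "chanX1 (enc1 L c1) (enc2 L c2) (l * \<eta> + i) ((m1, m2), g)
      = a1 i * c1 m1 l + (\<Sum>j<\<eta>. B1 i j * (outs L c1 c2 m1 m2 g (l * \<eta> + j) + noiseW1 g (l * \<eta> + j)))"
    and "chanX2 (enc1 L c1) (enc2 L c2) (l * \<eta> + i) ((m1, m2), g)
      = a2 i * c2 m2 l + (\<Sum>j<\<eta>. B2 i j * (outs L c1 c2 m1 m2 g (l * \<eta> + j) + noiseW2 g (l * \<eta> + j)))"
  unfolding chanX1_def chanX2_def outs_def
  by (simp_all only: prod.case fb_past_out_seq lin_enc_block_past[OF assms lower(1)] lin_enc_block_past[OF assms lower(2)])

lemma outs_block:
  "outs L c1 c2 m1 m2 g t = chanX1 (enc1 L c1) (enc2 L c2) t ((m1, m2), g)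
     + chanX2 (enc1 L c1) (enc2 L c2) t ((m1, m2), g) + noiseZ g t"
  unfolding outs_def chanX1_def chanX2_def by (simp only: prod.case out_seq_last)

lemma chanY_outs:
  "chanY (enc1 L c1) (enc2 L c2) n ((m1, m2), g) = (\<lambda>s\<in>{..<n}. outs L c1 c2 m1 m2 g s)"
  unfolding chanY_def outs_def prod.case by (intro restrict_ext out_seq_nth) simp

text \<open>Feedback is output plus feedback noise. Subtracting \<open>B1 + B2\<close> applied to
  the outputs removes every output from the right side of the recursion and leaves letters and
  noise, without solving the recursion.\<close>

lemma mfilt_outs:
  assumes l: "l < L"
  shows "mfilt u1 (outs L c1 c2 m1 m2 g) l = T1 (c1 m1) (c2 m2) g l"
    and "mfilt u2 (outs L c1 c2 m1 m2 g) l = T2 (c1 m1) (c2 m2) g l"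
proof -
  let ?y = "\<lambda>j. outs L c1 c2 m1 m2 g (l * \<eta> + j)"
  let ?w1 = "\<lambda>j. noiseW1 g (l * \<eta> + j)" and ?w2 = "\<lambda>j. noiseW2 g (l * \<eta> + j)" and ?z = "\<lambda>j. noiseZ g (l * \<eta> + j)"
  have y: "?y i - (\<Sum>j<\<eta>. (B1 i j + B2 i j) * ?y j)
     = a1 i * c1 m1 l + a2 i * c2 m2 l + ?z i + (\<Sum>j<\<eta>. B1 i j * ?w1 j) + (\<Sum>j<\<eta>. B2 i j * ?w2 j)"
    if i: "i < \<eta>" for i
    unfolding outs_block[of L c1 c2 m1 m2 g "l * \<eta> + i"] chanX_block[OF l i]
    by (simp add: algebra_simps sum.distrib)
  have gen: "mfilt u (outs L c1 c2 m1 m2 g) l = (\<Sum>i<\<eta>. u i * a1 i) * c1 m1 l + (\<Sum>i<\<eta>. u i * a2 i) * c2 m2 l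
      + blin \<eta> u (\<lambda>j. \<Sum>i<\<eta>. u i * B1 i j) (\<lambda>j. \<Sum>i<\<eta>. u i * B2 i j) l g" for u
  proof -
    have sw: "(\<Sum>i<\<eta>. u i * (\<Sum>j<\<eta>. B i j * w j)) = (\<Sum>j<\<eta>. (\<Sum>i<\<eta>. u i * B i j) * w j)" for B w
      by (simp add: sum_distrib_left sum_distrib_right mult.assoc) (rule sum.swap)
    have "mfilt u (outs L c1 c2 m1 m2 g) l = (\<Sum>i<\<eta>. u i *
        (a1 i * c1 m1 l + a2 i * c2 m2 l + ?z i + (\<Sum>j<\<eta>. B1 i j * ?w1 j) + (\<Sum>j<\<eta>. B2 i j * ?w2 j)))"
      unfolding mfilt_def by (intro sum.cong refl) (simp add: y)
    also have "\<dots> = (\<Sum>i<\<eta>. u i * a1 i) * c1 m1 l + (\<Sum>i<\<eta>. u i * a2 i) * c2 m2 l + (\<Sum>i<\<eta>. u i * ?z i)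
        + (\<Sum>i<\<eta>. u i * (\<Sum>j<\<eta>. B1 i j * ?w1 j)) + (\<Sum>i<\<eta>. u i * (\<Sum>j<\<eta>. B2 i j * ?w2 j))"
      by (simp add: distrib_left sum.distrib sum_distrib_right mult.assoc)
    also have "\<dots> = (\<Sum>i<\<eta>. u i * a1 i) * c1 m1 l + (\<Sum>i<\<eta>. u i * a2 i) * c2 m2 l
      + blin \<eta> u (\<lambda>j. \<Sum>i<\<eta>. u i * B1 i j) (\<lambda>j. \<Sum>i<\<eta>. u i * B2 i j) l g"
      unfolding sw by (simp add: blin_def nlin_def noiseZ_def noiseW1_def noiseW2_def sum.distrib)
    finally show ?thesis .
  qed
  show "mfilt u1 (outs L c1 c2 m1 m2 g) l = T1 (c1 m1) (c2 m2) g l"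
    "mfilt u2 (outs L c1 c2 m1 m2 g) l = T2 (c1 m1) (c2 m2) g l"
    by (simp_all add: gen T1_def T2_def match v1_def v2_def)
qed

lemma mfilt_restrict:
  assumes "l < L" "L * \<eta> \<le> n"
  shows "mfilt u (\<lambda>s\<in>{..<n}. y s) l = mfilt u y l"
proof -
  have "l * \<eta> + i < n" if "i < \<eta>" for i by (rule block_index_less[OF assms(1) that assms(2)])
  thus ?thesis unfolding mfilt_def by (intro sum.cong refl arg_cong2[where f = "(*)"] arg_cong2[where f = "(-)"]) auto
qed

lemma mfilt_measurable:
  assumes "l < L" "L * \<eta> \<le> n"
  shows "(\<lambda>y. mfilt u y l) \<in> borel_measurable (PiM {..<n} (\<lambda>_. borel))"
proof -
  have "(\<lambda>y. y (l * \<eta> + i)) \<in> borel_measurable (PiM {..<n} (\<lambda>_. borel :: real measure))" if "i < \<eta>" for i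
    by (rule measurable_component_singleton) (use block_index_less[OF assms(1) that assms(2)] in simp)
  thus ?thesis unfolding mfilt_def
    by (intro borel_measurable_sum borel_measurable_times borel_measurable_diff borel_measurable_const) auto
qed

text \<open>Taking the accepted pair with the least code keeps the decoder measurable. If no pair is
  accepted, the result is whatever \<open>LEAST\<close> returns; the transmitted pair is then
  rejected, and the Chebyshev term of the penalty already covers this event.\<close>

definition decoder :: "real \<Rightarrow> nat \<Rightarrow> nat \<Rightarrow> nat \<Rightarrow> (nat \<Rightarrow> nat \<Rightarrow> real) \<Rightarrow> (nat \<Rightarrow> nat \<Rightarrow> real)
    \<Rightarrow> (nat \<Rightarrow> real) \<Rightarrow> nat \<times> nat" where
  "decoder \<epsilon> L k1 k2 c1 c2 y = prod_decode (LEAST i. fst (prod_decode i) < k1 \<and> snd (prod_decode i) < k2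
     \<and> accept \<epsilon> L (c1 (fst (prod_decode i))) (c2 (snd (prod_decode i))) (mfilt u1 y) (mfilt u2 y))"

lemma accept_cong:
  assumes "\<And>l. l < L \<Longrightarrow> t1 l = t1' l" "\<And>l. l < L \<Longrightarrow> t2 l = t2' l"
  shows "accept \<epsilon> L x1 x2 t1 t2 = accept \<epsilon> L x1 x2 t1' t2'"
  using assms by (simp add: accept_def S1_def S2_def S12_def)

lemma decoder_measurable:
  assumes "L * \<eta> \<le> n"
  shows "decoder \<epsilon> L k1 k2 c1 c2 \<in> PiM {..<n} (\<lambda>_. borel) \<rightarrow>\<^sub>M count_space UNIV"
proof -
  have m: "(\<lambda>y. S1 L x1 x2 (mfilt u1 y)) \<in> borel_measurable (PiM {..<n} (\<lambda>_. borel))"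
    "(\<lambda>y. S2 L x1 x2 (mfilt u2 y)) \<in> borel_measurable (PiM {..<n} (\<lambda>_. borel))"
    "(\<lambda>y. S12 L x1 x2 (mfilt u1 y) (mfilt u2 y)) \<in> borel_measurable (PiM {..<n} (\<lambda>_. borel))" for x1 x2
    unfolding S1_def S2_def S12_def idens2_def
    by (intro borel_measurable_sum borel_measurable_add idens_measurable borel_measurable_diff
        borel_measurable_times borel_measurable_divide borel_measurable_const mfilt_measurable[OF _ assms]; simp)+
  note [measurable] = m
  have "(\<lambda>y. LEAST i. fst (prod_decode i) < k1 \<and> snd (prod_decode i) < k2
     \<and> accept \<epsilon> L (c1 (fst (prod_decode i))) (c2 (snd (prod_decode i))) (mfilt u1 y) (mfilt u2 y))
     \<in> PiM {..<n} (\<lambda>_. borel) \<rightarrow>\<^sub>M count_space UNIV"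
    unfolding accept_def by measurable
  thus ?thesis unfolding decoder_def[abs_def] by (rule measurable_compose) simp
qed

lemma decoder_error:
  assumes dec: "decoder \<epsilon> L k1 k2 c1 c2 y \<noteq> (m1, m2)" and m: "m1 < k1" "m2 < k2"
    and acc: "accept \<epsilon> L (c1 m1) (c2 m2) (mfilt u1 y) (mfilt u2 y)"
  shows "\<exists>m m'. m < k1 \<and> m' < k2 \<and> (m, m') \<noteq> (m1, m2) \<and> accept \<epsilon> L (c1 m) (c2 m') (mfilt u1 y) (mfilt u2 y)"
proof -
  define P where "P = (\<lambda>i. fst (prod_decode i) < k1 \<and> snd (prod_decode i) < k2
     \<and> accept \<epsilon> L (c1 (fst (prod_decode i))) (c2 (snd (prod_decode i))) (mfilt u1 y) (mfilt u2 y))"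
  have "P (prod_encode (m1, m2))" using acc m by (simp add: P_def)
  hence "P (LEAST i. P i)" by (rule LeastI)
  moreover have "decoder \<epsilon> L k1 k2 c1 c2 y = prod_decode (LEAST i. P i)"
    by (simp add: decoder_def P_def)
  ultimately show ?thesis using dec
    by (intro exI[of _ "fst (decoder \<epsilon> L k1 k2 c1 c2 y)"] exI[of _ "snd (decoder \<epsilon> L k1 k2 c1 c2 y)"])
       (auto simp: P_def)
qed

lemma error_penalty:
  assumes \<tau>: "0 < \<tau>" and L: "0 < L"
    and typical: "\<And>x1 x2 g. discrepancy (letter_cov g1 g2 h) L (letters x1 x2 g) < (real L * \<tau>)\<^sup>2
        \<Longrightarrow> accept \<epsilon> L x1 x2 (T1 x1 x2 g) (T2 x1 x2 g)"
    and n: "L * \<eta> \<le> n" and m: "m1 < k1" "m2 < k2"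
    and err: "decoder \<epsilon> L k1 k2 c1 c2 (chanY (enc1 L c1) (enc2 L c2) n ((m1, m2), g)) \<noteq> (m1, m2)"
  shows "1 \<le> penalty \<epsilon> \<tau> L k1 k2 m1 m2 c1 c2 g"
proof -
  let ?y = "chanY (enc1 L c1) (enc2 L c2) n ((m1, m2), g)"
  let ?T1 = "T1 (c1 m1) (c2 m2) g" and ?T2 = "T2 (c1 m1) (c2 m2) g"
  have acc: "accept \<epsilon> L x1 x2 (mfilt u1 ?y) (mfilt u2 ?y) = accept \<epsilon> L x1 x2 ?T1 ?T2" for x1 x2
    by (rule accept_cong) (simp_all add: chanY_outs mfilt_restrict[OF _ n] mfilt_outs)
  have exp1: "1 \<le> ennreal (exp (x - y))" if "y < x" for x y :: real
    using that by (simp flip: ennreal_1)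
  let ?D = "ennreal (discrepancy (letter_cov g1 g2 h) L (letters (c1 m1) (c2 m2) g) / (real L * \<tau>)\<^sup>2)"
  let ?A = "\<lambda>m. ennreal (exp (S1 L (c1 m) (c2 m2) ?T1 - real L * (I1 - \<epsilon>)))"
  let ?B = "\<lambda>m. ennreal (exp (S2 L (c1 m1) (c2 m) ?T2 - real L * (I2 - \<epsilon>)))"
  let ?C = "\<lambda>m m'. ennreal (exp (S12 L (c1 m) (c2 m') ?T1 ?T2 - real L * (I12 - \<epsilon>)))"
  have p: "penalty \<epsilon> \<tau> L k1 k2 m1 m2 c1 c2 g = ?D + (\<Sum>m\<in>{..<k1} - {m1}. ?A m) + (\<Sum>m\<in>{..<k2} - {m2}. ?B m)
     + (\<Sum>m\<in>{..<k1} - {m1}. \<Sum>m'\<in>{..<k2} - {m2}. ?C m m')" by (simp add: penalty_def)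
  show ?thesis
  proof (cases "accept \<epsilon> L (c1 m1) (c2 m2) ?T1 ?T2")
    case False
    hence "\<not> discrepancy (letter_cov g1 g2 h) L (letters (c1 m1) (c2 m2) g) < (real L * \<tau>)\<^sup>2" using typical by blast
    hence "1 \<le> discrepancy (letter_cov g1 g2 h) L (letters (c1 m1) (c2 m2) g) / (real L * \<tau>)\<^sup>2"
      using \<tau> L by (simp add: not_less le_divide_eq)
    hence "1 \<le> ?D" by (simp flip: ennreal_1)
    thus ?thesis unfolding p by (rule add_increasing2[OF zero_le add_increasing2[OF zero_le add_increasing2[OF zero_le]]])
  next
    case True
    hence "accept \<epsilon> L (c1 m1) (c2 m2) (mfilt u1 ?y) (mfilt u2 ?y)" by (simp add: acc)
    from decoder_error[OF err m this] obtain m m' where mm: "m < k1" "m' < k2" "(m, m') \<noteq> (m1, m2)"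
      "accept \<epsilon> L (c1 m) (c2 m') ?T1 ?T2" by (auto simp: acc)
    \<comment> \<open>A wrong pair may share one message with the transmitted one. The density to
      use is the one that treats exactly the wrong words as unknown, for only these are independent
      of the output.\<close>
    consider "m \<noteq> m1" "m' = m2" | "m = m1" "m' \<noteq> m2" | "m \<noteq> m1" "m' \<noteq> m2" using mm(3) by blast
    thus ?thesis
    proof cases
      case 1
      have "1 \<le> ?A m" using mm 1 by (intro exp1) (simp add: accept_def)
      also have "\<dots> \<le> (\<Sum>m\<in>{..<k1} - {m1}. ?A m)" using mm 1 by (intro member_le_sum) auto
      finally show ?thesis unfolding p by (rule add_increasing2[OF zero_le add_increasing2[OF zero_le add_increasing[OF zero_le]]])
    next
      case 2
      have "1 \<le> ?B m'" using mm 2 by (intro exp1) (simp add: accept_def)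
      also have "\<dots> \<le> (\<Sum>m\<in>{..<k2} - {m2}. ?B m)" using mm 2 by (intro member_le_sum) auto
      finally show ?thesis unfolding p by (rule add_increasing2[OF zero_le add_increasing[OF zero_le]])
    next
      case 3
      have "1 \<le> ?C m m'" using mm 3 by (intro exp1) (simp add: accept_def)
      also have "\<dots> \<le> (\<Sum>m'\<in>{..<k2} - {m2}. ?C m m')" using mm 3 by (intro member_le_sum) auto
      also have "\<dots> \<le> (\<Sum>m\<in>{..<k1} - {m1}. \<Sum>m'\<in>{..<k2} - {m2}. ?C m m')"
        using mm 3 by (intro member_le_sum[of m _ "\<lambda>m. \<Sum>m'\<in>{..<k2} - {m2}. ?C m m'"]) auto
      finally show ?thesis unfolding p by (rule add_increasing[OF zero_le])
    qed
  qed
qed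

end

section \<open>Error probability and power\<close>

lemma nn_integral_chan_space:
  assumes k: "0 < k1" "0 < k2" and f: "f \<in> borel_measurable (chan_space N s1 s2 r n k1 k2)"
  shows "(\<integral>\<^sup>+\<omega>. f \<omega> \<partial>chan_space N s1 s2 r n k1 k2)
    = (\<Sum>m1<k1. \<Sum>m2<k2. \<integral>\<^sup>+g. f ((m1, m2), g) \<partial>noise_prod N s1 s2 r n) / of_nat (k1 * k2)"
proof -
  interpret P: prob_space "noise_prod N s1 s2 r n" by (rule prob_space_noise_prod)
  have ne: "{..<k1} \<times> {..<k2} \<noteq> {}" using k by (auto simp: lessThan_empty_iff)
  have fin: "finite ({..<k1} \<times> {..<k2})" by simp
  have "(\<integral>\<^sup>+\<omega>. f \<omega> \<partial>chan_space N s1 s2 r n k1 k2)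
      = (\<integral>\<^sup>+m. (\<integral>\<^sup>+g. f (m, g) \<partial>noise_prod N s1 s2 r n) \<partial>measure_pmf (pmf_of_set ({..<k1} \<times> {..<k2})))"
    unfolding chan_space_def by (rule P.nn_integral_fst[OF f[unfolded chan_space_def], symmetric])
  also have "\<dots> = (\<Sum>m\<in>{..<k1} \<times> {..<k2}. \<integral>\<^sup>+g. f (m, g) \<partial>noise_prod N s1 s2 r n) / of_nat (k1 * k2)"
    by (subst nn_integral_pmf_of_set[OF ne fin]) (simp add: ennreal_of_nat_eq_real_of_nat)
  also have "(\<Sum>m\<in>{..<k1} \<times> {..<k2}. \<integral>\<^sup>+g. f (m, g) \<partial>noise_prod N s1 s2 r n)
      = (\<Sum>m1<k1. \<Sum>m2<k2. \<integral>\<^sup>+g. f ((m1, m2), g) \<partial>noise_prod N s1 s2 r n)"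
    by (simp add: sum.cartesian_product case_prod_unfold)
  finally show ?thesis .
qed

lemma ennreal_divide_less_imp: "0 < k \<Longrightarrow> x < of_nat k * ennreal \<beta> \<Longrightarrow> x / of_nat k \<le> ennreal \<beta>"
  for x :: ennreal and k :: nat
  by (simp add: divide_le_posI_ennreal mult.commute ennreal_of_nat_eq_real_of_nat less_imp_le)

lemma abs_le_if_square_le: "x\<^sup>2 \<le> y\<^sup>2 \<Longrightarrow> 0 \<le> y \<Longrightarrow> \<bar>x\<bar> \<le> y" for x y :: real
  by (metis abs_le_square_iff abs_of_nonneg)

lemma sum_swap3: "(\<Sum>i\<in>I. \<Sum>j\<in>J. \<Sum>k\<in>K. f i j k) = (\<Sum>j\<in>J. \<Sum>k\<in>K. \<Sum>i\<in>I. f i j k)"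
  by (subst sum.swap) (intro sum.cong refl sum.swap)

lemma sum_sum_ennreal:
  assumes "\<And>i j. 0 \<le> f i j"
  shows "(\<Sum>i\<in>I. \<Sum>j\<in>J. ennreal (f i j)) = ennreal (\<Sum>i\<in>I. \<Sum>j\<in>J. f i j)"
  using assms by (simp add: sum_ennreal sum_nonneg)

context linear_scheme
begin

lemma err_prob_le:
  assumes \<tau>: "0 < \<tau>" and L: "0 < L" and \<beta>: "0 \<le> \<beta>"
    and typical: "\<And>x1 x2 g. discrepancy (letter_cov g1 g2 h) L (letters x1 x2 g) < (real L * \<tau>)\<^sup>2
        \<Longrightarrow> accept \<epsilon> L x1 x2 (T1 x1 x2 g) (T2 x1 x2 g)"
    and n: "L * \<eta> \<le> n" and k: "0 < k1" "0 < k2"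
    and good: "(\<Sum>m1<k1. \<Sum>m2<k2. \<integral>\<^sup>+g. penalty \<epsilon> \<tau> L k1 k2 m1 m2 c1 c2 g \<partial>noise n) < of_nat (k1 * k2) * ennreal \<beta>"
  shows "err_prob N s1 s2 r n k1 k2 (enc1 L c1) (enc2 L c2) (decoder \<epsilon> L k1 k2 c1 c2) \<le> \<beta>"
proof -
  let ?M = "chan_space N s1 s2 r n k1 k2"
  define E where "E = {\<omega> \<in> space ?M. decoder \<epsilon> L k1 k2 c1 c2 (chanY (enc1 L c1) (enc2 L c2) n \<omega>) \<noteq> fst \<omega>}"
  have "emeasure ?M E \<le> ennreal \<beta>"
  \<comment> \<open>A set outside the sigma-algebra has measure zero by convention, so the error
    event need not be shown measurable.\<close>
  proof (cases "E \<in> sets ?M")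
    case True
    have "emeasure ?M E = (\<integral>\<^sup>+\<omega>. indicator E \<omega> \<partial>?M)" using True by simp
    also have "\<dots> = (\<Sum>m1<k1. \<Sum>m2<k2. \<integral>\<^sup>+g. indicator E ((m1, m2), g) \<partial>noise n) / of_nat (k1 * k2)"
      using True by (intro nn_integral_chan_space k) auto
    also have "\<dots> \<le> (\<Sum>m1<k1. \<Sum>m2<k2. \<integral>\<^sup>+g. penalty \<epsilon> \<tau> L k1 k2 m1 m2 c1 c2 g \<partial>noise n) / of_nat (k1 * k2)"
    proof (intro divide_right_mono_ennreal sum_mono nn_integral_mono)
      fix m1 m2 g assume "m1 \<in> {..<k1}" "m2 \<in> {..<k2}"
      thus "indicator E ((m1, m2), g) \<le> penalty \<epsilon> \<tau> L k1 k2 m1 m2 c1 c2 g"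
        using error_penalty[OF \<tau> L typical n, of m1 k1 m2 k2 c1 c2 g]
        by (cases "((m1, m2), g) \<in> E") (auto simp: E_def)
    qed
    also have "\<dots> \<le> ennreal \<beta>" using good k by (intro ennreal_divide_less_imp) auto
    finally show ?thesis .
  qed (simp add: emeasure_notin_sets)
  thus ?thesis unfolding err_prob_def E_def[symmetric] measure_def
    using enn2real_mono[of _ "ennreal \<beta>"] \<beta> by fastforce
qed

text \<open>The second moments of the inputs do not involve the noise, and the first term of the
  penalty dominates their squared errors. A mean penalty below one therefore bounds the mean square
  of these errors over the message pairs.\<close>

lemma power_discrepancy:
  fixes a b :: nat
  assumes \<tau>: "0 < \<tau>" and L: "0 < L" and k: "0 < k1" "0 < k2" and ab: "a < 2" "b < 2"
    and good: "(\<Sum>m1<k1. \<Sum>m2<k2. \<integral>\<^sup>+g. penalty \<epsilon> \<tau> L k1 k2 m1 m2 c1 c2 g \<partial>noise n) < of_nat (k1 * k2) * ennreal 1"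
  defines "x \<equiv> \<lambda>i m1 m2 l. if i = 0 then c1 m1 l else c2 m2 l"
  shows "\<bar>(\<Sum>m1<k1. \<Sum>m2<k2. \<Sum>l<L. x a m1 m2 l * x b m1 m2 l - (if a = b then 1 else 0))\<bar> \<le> real (k1 * k2) * (real L * \<tau>)"
proof -
  interpret Nn: prob_space "noise n" by (rule prob_space_noise_prod)
  define D where "D = (\<lambda>m1 m2. \<Sum>l<L. x a m1 m2 l * x b m1 m2 l - (if a = b then 1 else 0))"
  define c where "c = (real L * \<tau>)\<^sup>2"
  have c: "c > 0" using \<tau> L by (simp add: c_def)
  have le: "ennreal ((D m1 m2)\<^sup>2 / c) \<le> (\<integral>\<^sup>+g. penalty \<epsilon> \<tau> L k1 k2 m1 m2 c1 c2 g \<partial>noise n)" for m1 m2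
  proof -
    have "ennreal ((D m1 m2)\<^sup>2 / c) \<le> penalty \<epsilon> \<tau> L k1 k2 m1 m2 c1 c2 g" for g
    proof -
      have K: "letter_cov g1 g2 h a b = (if a = b then 1 else 0)" using ab by (simp add: letter_cov_def)
      have xl: "letter i (letters (c1 m1) (c2 m2) g l) = x i m1 m2 l" if "i < 2" for i l
        using that by (auto simp: letter_def letters_def x_def)
      let ?t = "\<lambda>a b. (\<Sum>l<L. letter a (letters (c1 m1) (c2 m2) g l) * letter b (letters (c1 m1) (c2 m2) g l) - letter_cov g1 g2 h a b)\<^sup>2"
      have "(D m1 m2)\<^sup>2 = ?t a b" unfolding D_def K using xl ab by simp
      also have "\<dots> \<le> (\<Sum>b<4. ?t a b)" using ab by (intro member_le_sum) auto
      also have "\<dots> \<le> discrepancy (letter_cov g1 g2 h) L (letters (c1 m1) (c2 m2) g)"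
        unfolding discrepancy_def using ab by (intro member_le_sum[of a _ "\<lambda>a. \<Sum>b<4. ?t a b"]) (auto intro: sum_nonneg)
      finally have "ennreal ((D m1 m2)\<^sup>2 / c) \<le> ennreal (discrepancy (letter_cov g1 g2 h) L (letters (c1 m1) (c2 m2) g) / c)"
        using c by (intro ennreal_leI divide_right_mono) auto
      thus ?thesis unfolding penalty_def c_def
        by (rule add_increasing2[OF zero_le add_increasing2[OF zero_le add_increasing2[OF zero_le]]])
    qed
    hence "(\<integral>\<^sup>+g. ennreal ((D m1 m2)\<^sup>2 / c) \<partial>noise n) \<le> (\<integral>\<^sup>+g. penalty \<epsilon> \<tau> L k1 k2 m1 m2 c1 c2 g \<partial>noise n)"
      by (intro nn_integral_mono)
    thus ?thesis by (simp add: Nn.emeasure_space_1)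
  qed
  have "ennreal (\<Sum>m1<k1. \<Sum>m2<k2. (D m1 m2)\<^sup>2 / c) = (\<Sum>m1<k1. \<Sum>m2<k2. ennreal ((D m1 m2)\<^sup>2 / c))"
    using c by (intro sum_sum_ennreal[symmetric]) auto
  also have "\<dots> \<le> (\<Sum>m1<k1. \<Sum>m2<k2. \<integral>\<^sup>+g. penalty \<epsilon> \<tau> L k1 k2 m1 m2 c1 c2 g \<partial>noise n)"
    by (intro sum_mono le)
  also have "\<dots> < ennreal (real (k1 * k2))" using good by (simp add: ennreal_of_nat_eq_real_of_nat)
  finally have "(\<Sum>m1<k1. \<Sum>m2<k2. (D m1 m2)\<^sup>2 / c) < real (k1 * k2)"
    using c by (subst (asm) ennreal_less_iff) (auto intro!: sum_nonneg)
  hence s: "(\<Sum>m1<k1. \<Sum>m2<k2. (D m1 m2)\<^sup>2) < real (k1 * k2) * c"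
    using c by (simp add: pos_divide_less_eq flip: sum_divide_distrib)
  define S where "S = (\<Sum>m1<k1. \<Sum>m2<k2. D m1 m2)"
  have "S\<^sup>2 = (\<Sum>m\<in>{..<k1} \<times> {..<k2}. D (fst m) (snd m))\<^sup>2"
    by (simp add: S_def sum.cartesian_product case_prod_unfold)
  \<comment> \<open>Cauchy-Schwarz over the message pairs passes from the mean square to the
    mean.\<close>
  also have "\<dots> \<le> (\<Sum>m\<in>{..<k1} \<times> {..<k2}. (D (fst m) (snd m))\<^sup>2) * real (card ({..<k1} \<times> {..<k2}))"
    by (rule sum_squared_le_sum_of_squares)
  also have "(\<Sum>m\<in>{..<k1} \<times> {..<k2}. (D (fst m) (snd m))\<^sup>2) = (\<Sum>m1<k1. \<Sum>m2<k2. (D m1 m2)\<^sup>2)"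
    by (simp add: sum.cartesian_product case_prod_unfold)
  also have "\<dots> * real (card ({..<k1} \<times> {..<k2})) \<le> real (k1 * k2) * c * real (k1 * k2)"
    by (intro mult_mono less_imp_le[OF s]) (use c in \<open>auto simp: mult_nonneg_nonneg\<close>)
  also have "\<dots> = (real (k1 * k2) * (real L * \<tau>))\<^sup>2" by (simp add: c_def power2_eq_square algebra_simps)
  finally have "S\<^sup>2 \<le> (real (k1 * k2) * (real L * \<tau>))\<^sup>2" .
  hence "\<bar>S\<bar> \<le> real (k1 * k2) * (real L * \<tau>)"
    by (rule abs_le_if_square_le) (use \<tau> in simp)
  thus ?thesis by (simp add: S_def D_def)
qed

text \<open>The abstract form \<open>X = p \<xi>\<^sub>1 + q \<xi>\<^sub>2 + noise\<close> of the inputs sent in a block covers both users.\<close>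
lemma power_le:
  assumes \<tau>: "0 < \<tau>" and L: "0 < L" and k: "0 < k1" "0 < k2" and n: "L * \<eta> \<le> n"
    and good: "(\<Sum>m1<k1. \<Sum>m2<k2. \<integral>\<^sup>+g. penalty \<epsilon> \<tau> L k1 k2 m1 m2 c1 c2 g \<partial>noise n) < of_nat (k1 * k2) * ennreal 1"
    and X: "\<And>l i m1 m2 g. l < L \<Longrightarrow> i < \<eta> \<Longrightarrow> X (l * \<eta> + i) ((m1, m2), g)
        = p i * c1 m1 l + q i * c2 m2 l + blin \<eta> (\<alpha> i) (\<beta> i) (\<gamma> i) l g"
    and X0: "\<And>t \<omega>. L * \<eta> \<le> t \<Longrightarrow> X t \<omega> = 0"
    and pow: "(1 + 2 * \<tau>) * (\<Sum>i<\<eta>. (p i)\<^sup>2 + (q i)\<^sup>2)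
       + (\<Sum>i<\<eta>. \<Sum>j<\<eta>. ncov N s1 s2 r (\<alpha> i j) (\<beta> i j) (\<gamma> i j) (\<alpha> i j) (\<beta> i j) (\<gamma> i j)) \<le> real \<eta> * P"
    and P: "0 \<le> P"
  shows "(\<Sum>t<n. \<integral>\<^sup>+\<omega>. ennreal ((X t \<omega>)\<^sup>2) \<partial>chan_space N s1 s2 r n k1 k2) \<le> ennreal (real n * P)"
proof -
  let ?M = "chan_space N s1 s2 r n k1 k2"
  interpret Nn: prob_space "noise n" by (rule prob_space_noise_prod)
  define V where "V = (\<lambda>i. \<Sum>j<\<eta>. ncov N s1 s2 r (\<alpha> i j) (\<beta> i j) (\<gamma> i j) (\<alpha> i j) (\<beta> i j) (\<gamma> i j))"
  have V0: "0 \<le> V i" for i unfolding V_def by (intro sum_nonneg ncov_nonneg N r)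
  define w where "w = (\<lambda>l i m1 m2. p i * c1 m1 l + q i * c2 m2 l)"
  have one: "(\<integral>\<^sup>+\<omega>. ennreal ((X (l * \<eta> + i) \<omega>)\<^sup>2) \<partial>?M)
      = ennreal ((\<Sum>m1<k1. \<Sum>m2<k2. (w l i m1 m2)\<^sup>2 + V i) / real (k1 * k2))" if l: "l < L" and i: "i < \<eta>" for l i
  proof -
    let ?b = "blin \<eta> (\<alpha> i) (\<beta> i) (\<gamma> i) l"
    note bm = blin_moments[OF N r l n, where ?s1.0=s1 and ?s2.0=s2]
    have [measurable]: "?b \<in> borel_measurable (noise n)" by (rule blin_measurable[OF l n])
    have sec: "(\<lambda>g. ennreal ((X (l * \<eta> + i) (m, g))\<^sup>2)) \<in> borel_measurable (noise n)" for m
      unfolding X[OF l i, of "fst m" "snd m", unfolded prod.collapse] by measurable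
    \<comment> \<open>The messages form a countable discrete factor, so measurability may be checked
      for each pair separately.\<close>
    have "(\<lambda>\<omega>. ennreal ((X (l * \<eta> + i) \<omega>)\<^sup>2)) \<in> borel_measurable (count_space UNIV \<Otimes>\<^sub>M noise n)"
      by (rule measurable_pair_measure_countable1[OF _ sec]) simp
    hence meas: "(\<lambda>\<omega>. ennreal ((X (l * \<eta> + i) \<omega>)\<^sup>2)) \<in> borel_measurable ?M"
      unfolding chan_space_def by (simp cong: measurable_cong_sets sets_pair_measure_cong)
    have in1: "(\<integral>\<^sup>+g. ennreal ((X (l * \<eta> + i) ((m1, m2), g))\<^sup>2) \<partial>noise n) = ennreal ((w l i m1 m2)\<^sup>2 + V i)" for m1 m2
    proof -
      have L4b: "L4 (noise n) ?b" by (rule bm(1))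
      have int: "integrable (noise n) ?b" "integrable (noise n) (\<lambda>g. ?b g * ?b g)"
        using Nn.L4_integrable[OF L4b] Nn.L4_integrable_mult[OF L4b L4b] by auto
      have eq: "(w l i m1 m2 + ?b g)\<^sup>2 = (w l i m1 m2)\<^sup>2 + 2 * w l i m1 m2 * ?b g + ?b g * ?b g" for g
        by (simp add: power2_eq_square algebra_simps)
      have "(\<integral>\<^sup>+g. ennreal ((X (l * \<eta> + i) ((m1, m2), g))\<^sup>2) \<partial>noise n) = (\<integral>\<^sup>+g. ennreal ((w l i m1 m2 + ?b g)\<^sup>2) \<partial>noise n)"
        by (simp add: X[OF l i] w_def)
      also have "\<dots> = ennreal (Nn.expectation (\<lambda>g. (w l i m1 m2 + ?b g)\<^sup>2))"
      proof (rule nn_integral_eq_integral)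
        show "integrable (noise n) (\<lambda>g. (w l i m1 m2 + ?b g)\<^sup>2)" unfolding eq using int by auto
      qed auto
      also have "Nn.expectation (\<lambda>g. (w l i m1 m2 + ?b g)\<^sup>2) = (w l i m1 m2)\<^sup>2 + V i"
        unfolding eq using int bm(2)[of "\<alpha> i" "\<beta> i" "\<gamma> i"] bm(3)[of "\<alpha> i" "\<beta> i" "\<gamma> i" "\<alpha> i" "\<beta> i" "\<gamma> i"]
        by (simp add: Nn.prob_space V_def)
      finally show ?thesis .
    qed
    have "(\<integral>\<^sup>+\<omega>. ennreal ((X (l * \<eta> + i) \<omega>)\<^sup>2) \<partial>?M)
        = (\<Sum>m1<k1. \<Sum>m2<k2. ennreal ((w l i m1 m2)\<^sup>2 + V i)) / of_nat (k1 * k2)"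
      unfolding nn_integral_chan_space[OF k meas] in1 ..
    also have "(\<Sum>m1<k1. \<Sum>m2<k2. ennreal ((w l i m1 m2)\<^sup>2 + V i)) = ennreal (\<Sum>m1<k1. \<Sum>m2<k2. (w l i m1 m2)\<^sup>2 + V i)"
      using V0 by (intro sum_sum_ennreal) auto
    also have "\<dots> / of_nat (k1 * k2) = ennreal ((\<Sum>m1<k1. \<Sum>m2<k2. (w l i m1 m2)\<^sup>2 + V i) / real (k1 * k2))"
      unfolding ennreal_of_nat_eq_real_of_nat using k V0
      by (intro divide_ennreal) (auto intro!: sum_nonneg)
    finally show ?thesis .
  qed
  define x where "x = (\<lambda>i::nat. \<lambda>m1 m2 l. if i = 0 then c1 m1 l else c2 m2 l)"
  define kk where "kk = real (k1 * k2)"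
  have kk: "kk > 0" using k by (simp add: kk_def)
  define d where "d = kk * (real L * \<tau>)"
  define A where "A = (\<lambda>a b. \<Sum>m1<k1. \<Sum>m2<k2. \<Sum>l<L. x a m1 m2 l * x b m1 m2 l - (if a = b then 1 else 0))"
  have Ab: "\<bar>A a b\<bar> \<le> d" if "a < 2" "b < 2" for a b
    using power_discrepancy[OF \<tau> L k that good] unfolding A_def x_def d_def kk_def .
  define S where "S = (\<lambda>a b. \<Sum>m1<k1. \<Sum>m2<k2. \<Sum>l<L. x a m1 m2 l * x b m1 m2 l)"
  have SA: "S a b = A a b + (if a = b then kk * real L else 0)" for a b
    by (simp add: S_def A_def sum_subtractf kk_def)
  define pp where "pp = (\<Sum>i<\<eta>. (p i)\<^sup>2)"
  define qq where "qq = (\<Sum>i<\<eta>. (q i)\<^sup>2)"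
  define pq where "pq = (\<Sum>i<\<eta>. p i * q i)"
  have pq: "2 * \<bar>pq\<bar> \<le> pp + qq"
  proof -
    have "2 * \<bar>pq\<bar> \<le> (\<Sum>i<\<eta>. 2 * \<bar>p i * q i\<bar>)" unfolding pq_def sum_distrib_left[symmetric] by (simp add: sum_abs)
    also have "\<dots> \<le> (\<Sum>i<\<eta>. (p i)\<^sup>2 + (q i)\<^sup>2)"
    proof (rule sum_mono)
      fix i show "2 * \<bar>p i * q i\<bar> \<le> (p i)\<^sup>2 + (q i)\<^sup>2"
        using sum_squares_bound[of "\<bar>p i\<bar>" "\<bar>q i\<bar>"] by (simp add: abs_mult)
    qed
    finally show ?thesis by (simp add: pp_def qq_def sum.distrib)
  qed
  have pp0: "0 \<le> pp" "0 \<le> qq" by (auto simp: pp_def qq_def sum_nonneg)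
  \<comment> \<open>The response coefficients are the same in all blocks, so the power depends on
    the codebooks only through the three second moments \<open>S\<close>.\<close>
  have tot: "(\<Sum>l<L. \<Sum>i<\<eta>. \<Sum>m1<k1. \<Sum>m2<k2. (w l i m1 m2)\<^sup>2 + V i)
      = pp * S 0 0 + 2 * pq * S 0 1 + qq * S 1 1 + kk * real L * (\<Sum>i<\<eta>. V i)"
  proof -
    have "(\<Sum>l<L. \<Sum>i<\<eta>. \<Sum>m1<k1. \<Sum>m2<k2. (w l i m1 m2)\<^sup>2 + V i)
       = (\<Sum>l<L. \<Sum>m1<k1. \<Sum>m2<k2. \<Sum>i<\<eta>. (w l i m1 m2)\<^sup>2 + V i)"
      by (intro sum.cong[OF refl] sum_swap3)
    also have "\<dots> = (\<Sum>l<L. \<Sum>m1<k1. \<Sum>m2<k2. pp * (x 0 m1 m2 l * x 0 m1 m2 l) + 2 * pq * (x 0 m1 m2 l * x 1 m1 m2 l)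
         + qq * (x 1 m1 m2 l * x 1 m1 m2 l) + (\<Sum>i<\<eta>. V i))"
    proof (intro sum.cong refl)
      fix l m1 m2
      have "(w l i m1 m2)\<^sup>2 = (p i)\<^sup>2 * (c1 m1 l * c1 m1 l) + (p i * q i) * (2 * (c1 m1 l * c2 m2 l)) + (q i)\<^sup>2 * (c2 m2 l * c2 m2 l)" for i
        by (simp add: w_def power2_eq_square algebra_simps)
      thus "(\<Sum>i<\<eta>. (w l i m1 m2)\<^sup>2 + V i) = pp * (x 0 m1 m2 l * x 0 m1 m2 l) + 2 * pq * (x 0 m1 m2 l * x 1 m1 m2 l)
         + qq * (x 1 m1 m2 l * x 1 m1 m2 l) + (\<Sum>i<\<eta>. V i)"
        by (simp add: sum.distrib pp_def qq_def pq_def x_def flip: sum_distrib_right)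
    qed
    also have "\<dots> = (\<Sum>m1<k1. \<Sum>m2<k2. \<Sum>l<L. pp * (x 0 m1 m2 l * x 0 m1 m2 l) + 2 * pq * (x 0 m1 m2 l * x 1 m1 m2 l)
         + qq * (x 1 m1 m2 l * x 1 m1 m2 l) + (\<Sum>i<\<eta>. V i))"
      by (rule sum_swap3)
    also have "\<dots> = pp * S 0 0 + 2 * pq * S 0 1 + qq * S 1 1 + kk * real L * (\<Sum>i<\<eta>. V i)"
      unfolding S_def by (simp add: sum.distrib kk_def flip: sum_distrib_left)
    finally show ?thesis .
  qed
  \<comment> \<open>One \<tau> is due to the diagonal moments, the other to the correlation between
    the users, which the bound on \<open>2 * \<bar>pq\<bar>\<close> reduces to the squared
    amplitudes.\<close>
  have "pp * S 0 0 + 2 * pq * S 0 1 + qq * S 1 1 \<le> (pp + qq) * (1 + 2 * \<tau>) * (kk * real L)"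
  proof -
    have "pp * S 0 0 \<le> pp * (kk * real L + d)" "qq * S 1 1 \<le> qq * (kk * real L + d)"
      using Ab[of 0 0] Ab[of 1 1] pp0 unfolding SA by (auto intro!: mult_left_mono)
    moreover have "2 * pq * S 0 1 \<le> (pp + qq) * d"
    proof -
      have "2 * pq * S 0 1 \<le> \<bar>2 * pq * S 0 1\<bar>" by simp
      also have "\<dots> = 2 * \<bar>pq\<bar> * \<bar>A 0 1\<bar>" unfolding SA by (simp add: abs_mult)
      also have "\<dots> \<le> (pp + qq) * d" using pq Ab[of 0 1] pp0 by (intro mult_mono) auto
      finally show ?thesis .
    qed
    ultimately have "pp * S 0 0 + 2 * pq * S 0 1 + qq * S 1 1 \<le> pp * (kk * real L + d) + (pp + qq) * d + qq * (kk * real L + d)"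
      by linarith
    also have "\<dots> = (pp + qq) * (1 + 2 * \<tau>) * (kk * real L)" by (simp add: d_def algebra_simps)
    finally show ?thesis .
  qed
  hence "(\<Sum>l<L. \<Sum>i<\<eta>. \<Sum>m1<k1. \<Sum>m2<k2. (w l i m1 m2)\<^sup>2 + V i)
      \<le> (pp + qq) * (1 + 2 * \<tau>) * (kk * real L) + kk * real L * (\<Sum>i<\<eta>. V i)" unfolding tot by simp
  also have "\<dots> = kk * real L * ((1 + 2 * \<tau>) * (pp + qq) + (\<Sum>i<\<eta>. V i))" by (simp add: algebra_simps)
  also have "\<dots> \<le> kk * real L * (real \<eta> * P)"
    using pow kk unfolding pp_def qq_def V_def sum.distrib[symmetric] by (intro mult_left_mono) auto
  finally have fin: "(\<Sum>l<L. \<Sum>i<\<eta>. \<Sum>m1<k1. \<Sum>m2<k2. (w l i m1 m2)\<^sup>2 + V i) / kk \<le> real (L * \<eta>) * P"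
    using kk by (simp add: field_simps)
  have "(\<Sum>t<n. \<integral>\<^sup>+\<omega>. ennreal ((X t \<omega>)\<^sup>2) \<partial>?M) = (\<Sum>t<L * \<eta>. \<integral>\<^sup>+\<omega>. ennreal ((X t \<omega>)\<^sup>2) \<partial>?M)"
    using n X0 by (intro sum.mono_neutral_right) auto
  also have "\<dots> = (\<Sum>l<L. \<Sum>i<\<eta>. \<integral>\<^sup>+\<omega>. ennreal ((X (l * \<eta> + i) \<omega>)\<^sup>2) \<partial>?M)" by (rule sum_blocks)
  also have "\<dots> = (\<Sum>l<L. \<Sum>i<\<eta>. ennreal ((\<Sum>m1<k1. \<Sum>m2<k2. (w l i m1 m2)\<^sup>2 + V i) / kk))"
    by (intro sum.cong refl) (simp add: one kk_def)
  also have "\<dots> = (\<Sum>l<L. ennreal (\<Sum>i<\<eta>. (\<Sum>m1<k1. \<Sum>m2<k2. (w l i m1 m2)\<^sup>2 + V i) / kk))"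
    using V0 kk by (intro sum.cong refl sum_ennreal) (auto intro!: sum_nonneg divide_nonneg_pos)
  also have "\<dots> = ennreal (\<Sum>l<L. \<Sum>i<\<eta>. (\<Sum>m1<k1. \<Sum>m2<k2. (w l i m1 m2)\<^sup>2 + V i) / kk)"
    using V0 kk by (intro sum_ennreal) (auto intro!: sum_nonneg divide_nonneg_pos)
  also have "\<dots> = ennreal ((\<Sum>l<L. \<Sum>i<\<eta>. \<Sum>m1<k1. \<Sum>m2<k2. (w l i m1 m2)\<^sup>2 + V i) / kk)"
    by (simp add: sum_divide_distrib)
  also have "\<dots> \<le> ennreal (real (L * \<eta>) * P)" by (intro ennreal_leI fin)
  also have "\<dots> \<le> ennreal (real n * P)" using n P by (intro ennreal_leI mult_right_mono) (simp_all only: of_nat_le_iff)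
  finally show ?thesis .
qed


text \<open>\<open>n\<close> exceeds \<open>L * \<eta>\<close> by less than \<open>\<eta>\<close>,
  which costs only a constant factor. Of the slack \<open>2 * \<epsilon>\<close> per block, one
  \<open>\<epsilon>\<close> is spent on the acceptance threshold and the other produces the
  geometric decay.\<close>

lemma pbound_le:
  assumes L: "0 < L" and k: "real (k1 - 1) \<le> exp (real n * \<rho>1)" "real (k2 - 1) \<le> exp (real n * \<rho>2)"
    and n: "n div \<eta> = L"
    and rate: "real \<eta> * \<rho>1 + 2 * \<epsilon> \<le> I1" "real \<eta> * \<rho>2 + 2 * \<epsilon> \<le> I2" "real \<eta> * (\<rho>1 + \<rho>2) + 2 * \<epsilon> \<le> I12"
  shows "pbound \<epsilon> \<tau> L k1 k2 \<le> dvar / \<tau>\<^sup>2 * (1 / real L) + 3 * (exp (real \<eta> * (\<bar>\<rho>1\<bar> + \<bar>\<rho>2\<bar>)) * exp (- \<epsilon>) ^ L)"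
proof -
  define C where "C = real \<eta> * (\<bar>\<rho>1\<bar> + \<bar>\<rho>2\<bar>)"
  have key: "real n * x - real L * (I - \<epsilon>) \<le> C - real L * \<epsilon>"
    if x: "\<bar>x\<bar> \<le> \<bar>\<rho>1\<bar> + \<bar>\<rho>2\<bar>" and I: "real \<eta> * x + 2 * \<epsilon> \<le> I" for x I
  proof -
    define m where "m = n mod \<eta>"
    have n': "real n = real L * real \<eta> + real m"
      using div_mult_mod_eq[of n \<eta>] unfolding n m_def[symmetric] by (metis of_nat_add of_nat_mult)
    have "real m \<le> real \<eta>" using \<eta> by (simp add: m_def less_imp_le)
    hence "real m * x \<le> real \<eta> * (\<bar>\<rho>1\<bar> + \<bar>\<rho>2\<bar>)"
      using x by (intro order_trans[OF mult_left_mono[of x "\<bar>x\<bar>"] mult_mono]) auto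
    moreover have "real L * (real \<eta> * x + 2 * \<epsilon>) \<le> real L * I" using I by (intro mult_left_mono) auto
    ultimately show ?thesis unfolding n' C_def by (simp add: algebra_simps)
  qed
  have e: "exp (C - real L * \<epsilon>) = exp C * exp (- \<epsilon>) ^ L"
    by (simp add: exp_add[symmetric] exp_of_nat_mult[symmetric])
  have 1: "real (k1 - 1) * exp (- (real L * (I1 - \<epsilon>))) \<le> exp (C - real L * \<epsilon>)"
  proof -
    have "real (k1 - 1) * exp (- (real L * (I1 - \<epsilon>))) \<le> exp (real n * \<rho>1) * exp (- (real L * (I1 - \<epsilon>)))"
      using k(1) by (intro mult_right_mono) auto
    also have "\<dots> = exp (real n * \<rho>1 - real L * (I1 - \<epsilon>))" by (simp add: exp_add[symmetric])
    also have "\<dots> \<le> exp (C - real L * \<epsilon>)" using key[OF _ rate(1)] by simp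
    finally show ?thesis .
  qed
  have 2: "real (k2 - 1) * exp (- (real L * (I2 - \<epsilon>))) \<le> exp (C - real L * \<epsilon>)"
  proof -
    have "real (k2 - 1) * exp (- (real L * (I2 - \<epsilon>))) \<le> exp (real n * \<rho>2) * exp (- (real L * (I2 - \<epsilon>)))"
      using k(2) by (intro mult_right_mono) auto
    also have "\<dots> = exp (real n * \<rho>2 - real L * (I2 - \<epsilon>))" by (simp add: exp_add[symmetric])
    also have "\<dots> \<le> exp (C - real L * \<epsilon>)" using key[OF _ rate(2)] by simp
    finally show ?thesis .
  qed
  have 3: "real (k1 - 1) * real (k2 - 1) * exp (- (real L * (I12 - \<epsilon>))) \<le> exp (C - real L * \<epsilon>)"
  proof -
    have "real (k1 - 1) * real (k2 - 1) * exp (- (real L * (I12 - \<epsilon>)))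
        \<le> exp (real n * \<rho>1) * exp (real n * \<rho>2) * exp (- (real L * (I12 - \<epsilon>)))"
      using k by (intro mult_right_mono mult_mono) auto
    also have "\<dots> = exp (real n * (\<rho>1 + \<rho>2) - real L * (I12 - \<epsilon>))" by (simp add: exp_add[symmetric] algebra_simps)
    also have "\<dots> \<le> exp (C - real L * \<epsilon>)" using key[OF _ rate(3)] by (simp add: abs_triangle_ineq)
    finally show ?thesis .
  qed
  have "dvar * real L / (real L * \<tau>)\<^sup>2 = dvar / \<tau>\<^sup>2 * (1 / real L)"
    using L by (simp add: power2_eq_square)
  thus ?thesis using 1 2 3 unfolding pbound_def C_def[symmetric] e by linarith
qed

text \<open>\<open>resp1\<close> and \<open>resp2\<close> express the inputs of a block through
  letters and noise, which keeps the matrix inverse behind these coefficients out of the coding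
  argument. The factor \<open>1 + \<kappa>\<close> stands on the codeword part of the power only,
  since this part alone depends on the choice of codebooks.\<close>

lemma codes_exist:
  assumes resp1: "\<And>L c1 c2 l i m1 m2 g. l < L \<Longrightarrow> i < \<eta> \<Longrightarrow>
      chanX1 (enc1 L c1) (enc2 L c2) (l * \<eta> + i) ((m1, m2), g)
        = p1 i * c1 m1 l + q1 i * c2 m2 l + blin \<eta> (A1 i) (D1 i) (E1 i) l g"
    and resp2: "\<And>L c1 c2 l i m1 m2 g. l < L \<Longrightarrow> i < \<eta> \<Longrightarrow>
      chanX2 (enc1 L c1) (enc2 L c2) (l * \<eta> + i) ((m1, m2), g)
        = p2 i * c1 m1 l + q2 i * c2 m2 l + blin \<eta> (A2 i) (D2 i) (E2 i) l g"
    and \<kappa>: "0 < \<kappa>"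
    and pow1: "(1 + \<kappa>) * (\<Sum>i<\<eta>. (p1 i)\<^sup>2 + (q1 i)\<^sup>2)
       + (\<Sum>i<\<eta>. \<Sum>j<\<eta>. ncov N s1 s2 r (A1 i j) (D1 i j) (E1 i j) (A1 i j) (D1 i j) (E1 i j)) \<le> real \<eta> * P1"
    and pow2: "(1 + \<kappa>) * (\<Sum>i<\<eta>. (p2 i)\<^sup>2 + (q2 i)\<^sup>2)
       + (\<Sum>i<\<eta>. \<Sum>j<\<eta>. ncov N s1 s2 r (A2 i j) (D2 i j) (E2 i j) (A2 i j) (D2 i j) (E2 i j)) \<le> real \<eta> * P2"
    and P: "0 \<le> P1" "0 \<le> P2"
    and rate: "real \<eta> * \<rho>1 < I1" "real \<eta> * \<rho>2 < I2" "real \<eta> * (\<rho>1 + \<rho>2) < I12"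
  shows "\<exists>k1 k2 :: nat \<Rightarrow> nat. \<exists>f1 f2 :: nat \<Rightarrow> nat \<Rightarrow> nat \<Rightarrow> (nat \<Rightarrow> real) \<Rightarrow> real.
     \<exists>dec :: nat \<Rightarrow> (nat \<Rightarrow> real) \<Rightarrow> nat \<times> nat. \<exists>n0.
       (\<forall>n\<ge>n0. is_code P1 P2 N s1 s2 r n (k1 n) (k2 n) (f1 n) (f2 n) (dec n) \<and>
                ln (real (k1 n)) / real n \<ge> \<rho>1 \<and> ln (real (k2 n)) / real n \<ge> \<rho>2) \<and>
       (\<lambda>n. err_prob N s1 s2 r n (k1 n) (k2 n) (f1 n) (f2 n) (dec n)) \<longlonglongrightarrow> 0"
proof -
  \<comment> \<open>Half of the smallest rate slack, so that \<open>2 * \<epsilon>\<close> fits into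
    all three rate conditions.\<close>
  define \<epsilon> where "\<epsilon> = min (I1 - real \<eta> * \<rho>1) (min (I2 - real \<eta> * \<rho>2) (I12 - real \<eta> * (\<rho>1 + \<rho>2))) / 2"
  have \<epsilon>: "0 < \<epsilon>" using rate by (simp add: \<epsilon>_def)
  have rate': "real \<eta> * \<rho>1 + 2 * \<epsilon> \<le> I1" "real \<eta> * \<rho>2 + 2 * \<epsilon> \<le> I2" "real \<eta> * (\<rho>1 + \<rho>2) + 2 * \<epsilon> \<le> I12"
    by (simp_all add: \<epsilon>_def min_def)
  obtain \<tau>0 where \<tau>0: "\<tau>0 > 0" and typ0: "\<And>L x1 x2 g. L > 0 \<Longrightarrow>
      discrepancy (letter_cov g1 g2 h) L (letters x1 x2 g) < (real L * \<tau>0)\<^sup>2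
      \<Longrightarrow> accept \<epsilon> L x1 x2 (T1 x1 x2 g) (T2 x1 x2 g)"
    using accept_if_typical[OF \<epsilon>] by blast
  \<comment> \<open>Small enough for typicality to imply acceptance and for the relative power error
    \<open>2 * \<tau>\<close> to fit into \<open>\<kappa>\<close>.\<close>
  define \<tau> where "\<tau> = min \<tau>0 (\<kappa> / 2)"
  have \<tau>: "0 < \<tau>" "\<tau> \<le> \<tau>0" "2 * \<tau> \<le> \<kappa>" using \<tau>0 \<kappa> by (auto simp: \<tau>_def min_def)
  have typical: "accept \<epsilon> L x1 x2 (T1 x1 x2 g) (T2 x1 x2 g)"
    if "L > 0" "discrepancy (letter_cov g1 g2 h) L (letters x1 x2 g) < (real L * \<tau>)\<^sup>2" for L x1 x2 g
  proof (rule typ0[OF that(1)])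
    have "(real L * \<tau>)\<^sup>2 \<le> (real L * \<tau>0)\<^sup>2" using \<tau> by (intro power_mono mult_left_mono) auto
    thus "discrepancy (letter_cov g1 g2 h) L (letters x1 x2 g) < (real L * \<tau>0)\<^sup>2" using that(2) by linarith
  qed
  \<comment> \<open>The bound of \<open>pbound_le\<close> plus 1 / L; the extra term makes the bound
    on the mean penalty strict.\<close>
  define b where "b = (\<lambda>L::nat. dvar / \<tau>\<^sup>2 * (1 / real L)
     + 3 * (exp (real \<eta> * (\<bar>\<rho>1\<bar> + \<bar>\<rho>2\<bar>)) * exp (- \<epsilon>) ^ L) + 1 / real L)"
  have b0: "0 \<le> b L" for L using dvar_nonneg by (simp add: b_def)
  have "b \<longlonglongrightarrow> dvar / \<tau>\<^sup>2 * 0 + 3 * (exp (real \<eta> * (\<bar>\<rho>1\<bar> + \<bar>\<rho>2\<bar>)) * 0) + 0"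
    unfolding b_def using \<epsilon> by (intro tendsto_intros lim_1_over_n LIMSEQ_power_zero) simp
  hence b: "b \<longlonglongrightarrow> 0" by simp
  have divtop: "filterlim (\<lambda>n. n div \<eta>) at_top sequentially"
    unfolding filterlim_at_top
  proof
    fix Z show "eventually (\<lambda>n. Z \<le> n div \<eta>) sequentially"
      using eventually_ge_at_top[of "Z * \<eta>"] by eventually_elim (use \<eta> in \<open>simp add: less_eq_div_iff_mult_less_eq\<close>)
  qed
  have bn: "(\<lambda>n. b (n div \<eta>)) \<longlonglongrightarrow> 0" by (rule filterlim_compose[OF b divtop])
  \<comment> \<open>Rounding up keeps the rate at least \<open>\<rho>\<close>, for negative
    \<open>\<rho>\<close> as well, and the number of competitors \<open>k - 1\<close> does not
    exceed the exponential.\<close>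
  define k where "k = (\<lambda>\<rho> n. nat \<lceil>exp (real n * \<rho>)\<rceil>)"
  have kp: "1 \<le> k \<rho> n" "exp (real n * \<rho>) \<le> real (k \<rho> n)" "real (k \<rho> n - 1) \<le> exp (real n * \<rho>)" for \<rho> n
  proof -
    have p: "0 < exp (real n * \<rho>)" by simp
    hence c: "1 \<le> \<lceil>exp (real n * \<rho>)\<rceil>" by (simp add: one_le_ceiling)
    show k1: "1 \<le> k \<rho> n" using c unfolding k_def by linarith
    show "exp (real n * \<rho>) \<le> real (k \<rho> n)" unfolding k_def by linarith
    have "real (k \<rho> n) < exp (real n * \<rho>) + 1" unfolding k_def using c by linarith
    thus "real (k \<rho> n - 1) \<le> exp (real n * \<rho>)" using k1 by linarith
  qed
  define Good where "Good = (\<lambda>n c1 c2. (\<Sum>m1<k \<rho>1 n. \<Sum>m2<k \<rho>2 n. \<integral>\<^sup>+g. penalty \<epsilon> \<tau> (n div \<eta>) (k \<rho>1 n) (k \<rho>2 n) m1 m2 c1 c2 g \<partial>noise n)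
      < of_nat (k \<rho>1 n * k \<rho>2 n) * ennreal (b (n div \<eta>)))"
  have ex: "\<exists>c1 c2. Good n c1 c2" if "0 < n div \<eta>" for n
  proof -
    have "pbound \<epsilon> \<tau> (n div \<eta>) (k \<rho>1 n) (k \<rho>2 n) < b (n div \<eta>)"
    proof (rule le_less_trans[OF pbound_le[OF that kp(3) kp(3) refl rate']])
      have "0 < 1 / real (n div \<eta>)" using that by (simp only: zero_less_divide_1_iff of_nat_0_less_iff)
      thus "dvar / \<tau>\<^sup>2 * (1 / real (n div \<eta>))
          + 3 * (exp (real \<eta> * (\<bar>\<rho>1\<bar> + \<bar>\<rho>2\<bar>)) * exp (- \<epsilon>) ^ (n div \<eta>)) < b (n div \<eta>)"
        unfolding b_def by linarith
    qed
    from good_codebook_exists[OF that div_times_less_eq_dividend _ _ \<tau>(1) this] kp(1)[of \<rho>1 n] kp(1)[of \<rho>2 n]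
    show ?thesis unfolding Good_def by force
  qed
  then obtain c1 c2 where "\<And>n. 0 < n div \<eta> \<Longrightarrow> Good n (c1 n) (c2 n)" by metis
  note good = this[unfolded Good_def]
  define f1 where "f1 = (\<lambda>n. enc1 (n div \<eta>) (c1 n))"
  define f2 where "f2 = (\<lambda>n. enc2 (n div \<eta>) (c2 n))"
  define dec where "dec = (\<lambda>n. decoder \<epsilon> (n div \<eta>) (k \<rho>1 n) (k \<rho>2 n) (c1 n) (c2 n))"
  have Ln: "n div \<eta> * \<eta> \<le> n" for n by (rule div_times_less_eq_dividend)
  have err: "err_prob N s1 s2 r n (k \<rho>1 n) (k \<rho>2 n) (f1 n) (f2 n) (dec n) \<le> b (n div \<eta>)" if n: "0 < n div \<eta>" for n
    unfolding f1_def f2_def dec_def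
    by (rule err_prob_le[OF \<tau>(1) n b0 typical[OF n] Ln _ _ good[OF n]])
       (use kp(1)[of \<rho>1 n] kp(1)[of \<rho>2 n] in auto)
  have code: "is_code P1 P2 N s1 s2 r n (k \<rho>1 n) (k \<rho>2 n) (f1 n) (f2 n) (dec n) \<and>
      ln (real (k \<rho>1 n)) / real n \<ge> \<rho>1 \<and> ln (real (k \<rho>2 n)) / real n \<ge> \<rho>2"
    if n: "0 < n div \<eta>" and bn: "b (n div \<eta>) \<le> 1" for n
  proof -
    \<comment> \<open>The power estimate assumes a mean penalty below one, which holds as soon as
      \<open>b\<close> is at most one.\<close>
    have g1: "(\<Sum>m1<k \<rho>1 n. \<Sum>m2<k \<rho>2 n. \<integral>\<^sup>+g. penalty \<epsilon> \<tau> (n div \<eta>) (k \<rho>1 n) (k \<rho>2 n) m1 m2 (c1 n) (c2 n) g \<partial>noise n)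
      < of_nat (k \<rho>1 n * k \<rho>2 n) * ennreal 1"
      by (rule less_le_trans[OF good[OF n]]) (intro mult_left_mono ennreal_leI bn, simp)
    have kp': "0 < k \<rho>1 n" "0 < k \<rho>2 n" using kp(1)[of \<rho>1 n] kp(1)[of \<rho>2 n] by auto
    have pow1': "(1 + 2 * \<tau>) * (\<Sum>i<\<eta>. (p1 i)\<^sup>2 + (q1 i)\<^sup>2)
       + (\<Sum>i<\<eta>. \<Sum>j<\<eta>. ncov N s1 s2 r (A1 i j) (D1 i j) (E1 i j) (A1 i j) (D1 i j) (E1 i j)) \<le> real \<eta> * P1"
      by (rule order_trans[OF add_right_mono[OF mult_right_mono] pow1]) (use \<tau>(3) in \<open>auto intro: sum_nonneg\<close>)
    have pow2': "(1 + 2 * \<tau>) * (\<Sum>i<\<eta>. (p2 i)\<^sup>2 + (q2 i)\<^sup>2)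
       + (\<Sum>i<\<eta>. \<Sum>j<\<eta>. ncov N s1 s2 r (A2 i j) (D2 i j) (E2 i j) (A2 i j) (D2 i j) (E2 i j)) \<le> real \<eta> * P2"
      by (rule order_trans[OF add_right_mono[OF mult_right_mono] pow2]) (use \<tau>(3) in \<open>auto intro: sum_nonneg\<close>)
    have z: "chanX1 (enc1 L c1) (enc2 L c2) t \<omega> = 0" "chanX2 (enc1 L c1) (enc2 L c2) t \<omega> = 0"
      if "L * \<eta> \<le> t" for L c1 c2 t \<omega>
      using that by (auto simp: chanX1_def chanX2_def lin_enc_def split: prod.splits)
    have "(\<Sum>t<n. \<integral>\<^sup>+\<omega>. ennreal ((chanX1 (f1 n) (f2 n) t \<omega>)\<^sup>2) \<partial>chan_space N s1 s2 r n (k \<rho>1 n) (k \<rho>2 n)) \<le> ennreal (real n * P1)"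
      unfolding f1_def f2_def
      by (rule power_le[OF \<tau>(1) n kp' Ln g1 resp1 z(1) pow1' P(1)])
    moreover have "(\<Sum>t<n. \<integral>\<^sup>+\<omega>. ennreal ((chanX2 (f1 n) (f2 n) t \<omega>)\<^sup>2) \<partial>chan_space N s1 s2 r n (k \<rho>1 n) (k \<rho>2 n)) \<le> ennreal (real n * P2)"
      unfolding f1_def f2_def
      by (rule power_le[OF \<tau>(1) n kp' Ln g1 resp2 z(2) pow2' P(2)])
    moreover have "ln (real (k \<rho> n)) / real n \<ge> \<rho>" for \<rho>
    proof -
      have "real n > 0" using n by (cases n) auto
      moreover have "real n * \<rho> \<le> ln (real (k \<rho> n))"
        using kp(1)[of \<rho> n] kp(2)[of n \<rho>] by (subst ln_ge_iff) auto
      ultimately show ?thesis by (simp add: field_simps)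
    qed
    moreover have "dec n \<in> PiM {..<n} (\<lambda>_. borel) \<rightarrow>\<^sub>M count_space UNIV"
      unfolding dec_def by (rule decoder_measurable[OF Ln])
    moreover have "\<forall>t<n. \<forall>m. f1 n t m \<in> borel_measurable (PiM {..<t} (\<lambda>_. borel))"
      "\<forall>t<n. \<forall>m. f2 n t m \<in> borel_measurable (PiM {..<t} (\<lambda>_. borel))"
      unfolding f1_def f2_def by (intro allI impI lin_enc_measurable)+
    ultimately show ?thesis unfolding is_code_def using kp(1) by (intro conjI)
  qed
  have pos: "eventually (\<lambda>n. 0 < n div \<eta>) sequentially"
    using divtop[unfolded filterlim_at_top, rule_format, of 1]
    by (rule eventually_mono) (simp only: One_nat_def Suc_le_eq)
  have "eventually (\<lambda>n. b (n div \<eta>) < 1) sequentially" using bn by (rule order_tendstoD) simp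
  with pos have "eventually (\<lambda>n. 0 < n div \<eta> \<and> b (n div \<eta>) \<le> 1) sequentially"
    by eventually_elim simp
  then obtain n0 where n0: "\<And>n. n \<ge> n0 \<Longrightarrow> 0 < n div \<eta> \<and> b (n div \<eta>) \<le> 1"
    unfolding eventually_sequentially by blast
  have "(\<lambda>n. err_prob N s1 s2 r n (k \<rho>1 n) (k \<rho>2 n) (f1 n) (f2 n) (dec n)) \<longlonglongrightarrow> 0"
  proof (rule tendsto_sandwich[OF _ _ tendsto_const bn])
    show "\<forall>\<^sub>F n in sequentially. 0 \<le> err_prob N s1 s2 r n (k \<rho>1 n) (k \<rho>2 n) (f1 n) (f2 n) (dec n)"
      by (simp add: err_prob_def)
    show "\<forall>\<^sub>F n in sequentially. err_prob N s1 s2 r n (k \<rho>1 n) (k \<rho>2 n) (f1 n) (f2 n) (dec n) \<le> b (n div \<eta>)"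
      using pos by eventually_elim (rule err)
  qed
  moreover have "\<forall>n\<ge>n0. is_code P1 P2 N s1 s2 r n (k \<rho>1 n) (k \<rho>2 n) (f1 n) (f2 n) (dec n) \<and>
      ln (real (k \<rho>1 n)) / real n \<ge> \<rho>1 \<and> ln (real (k \<rho>2 n)) / real n \<ge> \<rho>2"
    using n0 by (intro allI impI code) blast+
  ultimately show ?thesis
    by (intro exI[of _ "k \<rho>1"] exI[of _ "k \<rho>2"] exI[of _ f1] exI[of _ f2] exI[of _ dec] exI[of _ n0] conjI)
qed

end

section \<open>Matched filters\<close>

lemma det_2x2:
  fixes A :: "real mat"
  assumes "A \<in> carrier_mat 2 2"
  shows "det A = A $$ (0, 0) * A $$ (1, 1) - A $$ (0, 1) * A $$ (1, 0)"
proof -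
  let ?m = "\<lambda>i j. mat 1 1 (\<lambda>_. A $$ (i, j))"
  have eq: "A = four_block_mat (?m 0 0) (?m 0 1) (?m 1 0) (?m 1 1)"
  proof (rule eq_matI)
    fix i j assume "i < dim_row (four_block_mat (?m 0 0) (?m 0 1) (?m 1 0) (?m 1 1))"
      "j < dim_col (four_block_mat (?m 0 0) (?m 0 1) (?m 1 0) (?m 1 1))"
    hence "i = 0 \<or> i = 1" "j = 0 \<or> j = 1" by auto
    thus "A $$ (i, j) = four_block_mat (?m 0 0) (?m 0 1) (?m 1 0) (?m 1 1) $$ (i, j)"
      by (elim disjE) simp_all
  qed (use assms in simp_all)
  have "det A = det (four_block_mat (?m 0 0) (?m 0 1) (?m 1 0) (?m 1 1))"
    by (rule arg_cong[OF eq])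
  also have "\<dots> = det (?m 0 0 * ?m 1 1 - ?m 0 1 * ?m 1 0)"
  proof (rule det_four_block_mat[where n = 1])
    show "?m 1 0 * ?m 1 1 = ?m 1 1 * ?m 1 0"
      by (rule eq_matI) (simp_all add: scalar_prod_def)
  qed simp_all
  also have "\<dots> = (?m 0 0 * ?m 1 1 - ?m 0 1 * ?m 1 0) $$ (0, 0)"
    by (rule det_single) (intro minus_carrier_mat mult_carrier_mat[of _ 1 1 _ 1] mat_carrier)
  also have "\<dots> = A $$ (0, 0) * A $$ (1, 1) - A $$ (0, 1) * A $$ (1, 0)"
    by (simp add: scalar_prod_def)
  finally show ?thesis .
qed

lemma sum_atLeast0: "sum f {0..<n} = sum f {..<n}" for f :: "nat \<Rightarrow> 'a::comm_monoid_add"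
  by (simp add: lessThan_atLeast0)

lemma mult_entry:
  "A \<in> carrier_mat n m \<Longrightarrow> B \<in> carrier_mat m k \<Longrightarrow> i < n \<Longrightarrow> j < k
    \<Longrightarrow> (A * B) $$ (i, j) = (\<Sum>l<m. A $$ (i, l) * B $$ (l, j))"
  by (auto simp: scalar_prod_def sum_atLeast0)

lemma mult_transpose_entry:
  "A \<in> carrier_mat n m \<Longrightarrow> B \<in> carrier_mat k m \<Longrightarrow> i < n \<Longrightarrow> j < k
    \<Longrightarrow> (A * B\<^sup>T) $$ (i, j) = (\<Sum>l<m. A $$ (i, l) * B $$ (j, l))"
  by (subst mult_entry[of _ n m _ k]) auto

text \<open>Zero outside the index range as well, so that strict triangularity holds for all
  \<open>i\<close> and \<open>j\<close>, as \<open>linear_scheme\<close> demands.\<close>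

definition low :: "nat \<Rightarrow> real mat \<Rightarrow> nat \<Rightarrow> nat \<Rightarrow> real" where
  "low \<eta> B i j = (if j < i \<and> i < \<eta> then B $$ (i, j) else 0)"

lemma low_zero: "i \<le> j \<Longrightarrow> low \<eta> B i j = 0"
  by (simp add: low_def)

lemma low_entry: "strictly_lower \<eta> B \<Longrightarrow> i < \<eta> \<Longrightarrow> j < \<eta> \<Longrightarrow> B $$ (i, j) = low \<eta> B i j"
  by (auto simp: strictly_lower_def low_def not_less)

lemma strictly_lower_carrier: "strictly_lower \<eta> B \<Longrightarrow> B \<in> carrier_mat \<eta> \<eta>"
  by (simp add: strictly_lower_def)

text \<open>The form u^T Q v, written as the covariance of two filter outputs so that it has the
  shape required by \<open>noise_filters\<close>.\<close>

definition nform :: "real \<Rightarrow> real \<Rightarrow> real \<Rightarrow> real \<Rightarrow> nat \<Rightarrow> (nat \<Rightarrow> nat \<Rightarrow> real) \<Rightarrow> (nat \<Rightarrow> nat \<Rightarrow> real)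
    \<Rightarrow> (nat \<Rightarrow> real) \<Rightarrow> (nat \<Rightarrow> real) \<Rightarrow> real" where
  "nform N s1 s2 r \<eta> B1 B2 u v = (\<Sum>j<\<eta>. ncov N s1 s2 r (u j) (\<Sum>i<\<eta>. u i * B1 i j) (\<Sum>i<\<eta>. u i * B2 i j)
     (v j) (\<Sum>i<\<eta>. v i * B1 i j) (\<Sum>i<\<eta>. v i * B2 i j))"

lemma nform_sym: "nform N s1 s2 r \<eta> B1 B2 u v = nform N s1 s2 r \<eta> B1 B2 v u"
  unfolding nform_def by (intro sum.cong refl) (simp add: ncov_def algebra_simps)

lemma ncov_linear: "ncov N s1 s2 r (x * a + y * a') (x * b + y * b') (x * c + y * c') d e f
    = x * ncov N s1 s2 r a b c d e f + y * ncov N s1 s2 r a' b' c' d e f"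
  by (simp add: ncov_def algebra_simps)

lemma nform_lin2: "nform N s1 s2 r \<eta> B1 B2 (\<lambda>i. x * u i + y * v i) w
    = x * nform N s1 s2 r \<eta> B1 B2 u w + y * nform N s1 s2 r \<eta> B1 B2 v w"
proof -
  have s: "(\<Sum>i<\<eta>. (x * u i + y * v i) * B i j) = x * (\<Sum>i<\<eta>. u i * B i j) + y * (\<Sum>i<\<eta>. v i * B i j)" for B j
    by (simp add: sum_distrib_left sum.distrib algebra_simps)
  show ?thesis unfolding nform_def
    by (simp only: s ncov_linear) (simp only: sum.distrib, simp only: sum_distrib_left)
qed

lemma nform_lin2': "nform N s1 s2 r \<eta> B1 B2 w (\<lambda>i. x * u i + y * v i)
    = x * nform N s1 s2 r \<eta> B1 B2 w u + y * nform N s1 s2 r \<eta> B1 B2 w v"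
  by (simp add: nform_sym[of _ _ _ _ _ _ _ w] nform_lin2)

text \<open>Feedback noise adds a nonnegative variance to that of the channel noise. For
  \<open>N > 0\<close> this makes Q positive definite.\<close>

lemma nform_ge:
  assumes "0 \<le> N" "r\<^sup>2 \<le> 1"
  shows "N * (\<Sum>i<\<eta>. (u i)\<^sup>2) \<le> nform N s1 s2 r \<eta> B1 B2 u u"
  unfolding nform_def sum_distrib_left
proof (rule sum_mono)
  fix j
  let ?b = "\<Sum>i<\<eta>. u i * B1 i j" and ?c = "\<Sum>i<\<eta>. u i * B2 i j"
  have "ncov N s1 s2 r (u j) ?b ?c (u j) ?b ?c = N * (u j)\<^sup>2 + ncov N s1 s2 r 0 ?b ?c 0 ?b ?c"
    by (simp add: ncov_def power2_eq_square)
  thus "N * (u j)\<^sup>2 \<le> ncov N s1 s2 r (u j) ?b ?c (u j) ?b ?c" using ncov_nonneg[OF assms, of s1 s2 0 ?b ?c] by linarith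
qed

lemma Qmat_carrier: "strictly_lower \<eta> B1 \<Longrightarrow> strictly_lower \<eta> B2 \<Longrightarrow> Qmat \<eta> N s1 s2 r B1 B2 \<in> carrier_mat \<eta> \<eta>"
  by (auto simp: Qmat_def strictly_lower_def)

text \<open>Q is the Gram matrix of the rows of (I B1 B2) with respect to \<open>ncov\<close>,
  summed over the columns.\<close>

lemma nform_Qmat:
  assumes B: "strictly_lower \<eta> B1" "strictly_lower \<eta> B2"
  shows "(\<Sum>k<\<eta>. (\<Sum>i<\<eta>. u i * Qmat \<eta> N s1 s2 r B1 B2 $$ (i, k)) * v k)
    = nform N s1 s2 r \<eta> (low \<eta> B1) (low \<eta> B2) u v"
proof -
  let ?b = "low \<eta> B1" and ?c = "low \<eta> B2"
  have Q: "Qmat \<eta> N s1 s2 r B1 B2 $$ (i, k) = (\<Sum>j<\<eta>. ncov N s1 s2 r (if i = j then 1 else 0) (?b i j) (?c i j)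
      (if k = j then 1 else 0) (?b k j) (?c k j))" if "i < \<eta>" "k < \<eta>" for i k
  proof -
    have e: "(X * Y\<^sup>T) $$ (i, k) = (\<Sum>j<\<eta>. low \<eta> X i j * low \<eta> Y k j)"
      if "strictly_lower \<eta> X" "strictly_lower \<eta> Y" for X Y
      using that \<open>i < \<eta>\<close> \<open>k < \<eta>\<close>
      by (subst mult_transpose_entry[of _ \<eta> \<eta> _ \<eta>]) (auto simp: strictly_lower_carrier low_entry)
    have c: "B1 \<in> carrier_mat \<eta> \<eta>" "B2 \<in> carrier_mat \<eta> \<eta>" using B by (auto simp: strictly_lower_carrier)
    have "Qmat \<eta> N s1 s2 r B1 B2 $$ (i, k) = N * (if i = k then 1 else 0) + s1\<^sup>2 * (B1 * B1\<^sup>T) $$ (i, k) + s2\<^sup>2 * (B2 * B2\<^sup>T) $$ (i, k)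
      + r * s1 * s2 * ((B1 * B2\<^sup>T) $$ (i, k) + (B2 * B1\<^sup>T) $$ (i, k))"
      using c that by (simp add: Qmat_def)
    also have "(if i = k then 1 else 0) = (\<Sum>j<\<eta>. (if i = j then 1 else 0) * (if k = j then 1 else (0::real)))"
      using that by (simp add: if_distrib[where f = "\<lambda>x. x * _"] cong: if_cong)
    finally show ?thesis unfolding e[OF B(1) B(1)] e[OF B(2) B(2)] e[OF B] e[OF B(2) B(1)] ncov_def
      by (simp add: sum.distrib sum_distrib_left algebra_simps)
  qed
  have "(\<Sum>k<\<eta>. (\<Sum>i<\<eta>. u i * Qmat \<eta> N s1 s2 r B1 B2 $$ (i, k)) * v k)
    = (\<Sum>k<\<eta>. \<Sum>i<\<eta>. \<Sum>j<\<eta>. u i * v k * ncov N s1 s2 r (if i = j then 1 else 0) (?b i j) (?c i j)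
      (if k = j then 1 else 0) (?b k j) (?c k j))"
    by (simp add: Q sum_distrib_left sum_distrib_right mult_ac)
  also have "\<dots> = (\<Sum>j<\<eta>. \<Sum>k<\<eta>. \<Sum>i<\<eta>. u i * v k * ncov N s1 s2 r (if i = j then 1 else 0) (?b i j) (?c i j)
      (if k = j then 1 else 0) (?b k j) (?c k j))"
    by (rule sum_swap3[symmetric])
  also have "\<dots> = nform N s1 s2 r \<eta> ?b ?c u v"
    unfolding nform_def
  proof (intro sum.cong refl)
    fix j assume "j \<in> {..<\<eta>}"
    hence j: "j < \<eta>" by simp
    define U where "U = (\<lambda>B. \<Sum>i<\<eta>. u i * B i j)"
    define V where "V = (\<lambda>B. \<Sum>i<\<eta>. v i * B i j)"
    let ?d = "\<lambda>i k. if i = k then 1 else (0::real)"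
    have d: "U ?d = u j" "V ?d = v j" using j by (simp_all add: U_def V_def if_distrib[where f = "\<lambda>x. _ * x"] cong: if_cong)
    have UV: "(\<Sum>k<\<eta>. \<Sum>i<\<eta>. (u i * X i j) * (v k * Y k j)) = U X * V Y" for X Y
      unfolding U_def V_def sum_product by (rule sum.swap)
    have "(\<Sum>k<\<eta>. \<Sum>i<\<eta>. u i * v k * ncov N s1 s2 r (?d i j) (?b i j) (?c i j) (?d k j) (?b k j) (?c k j))
      = (\<Sum>k<\<eta>. \<Sum>i<\<eta>. N * ((u i * ?d i j) * (v k * ?d k j)) + s1\<^sup>2 * ((u i * ?b i j) * (v k * ?b k j))
         + s2\<^sup>2 * ((u i * ?c i j) * (v k * ?c k j))
         + r * s1 * s2 * ((u i * ?b i j) * (v k * ?c k j)) + r * s1 * s2 * ((u i * ?c i j) * (v k * ?b k j)))"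
      by (intro sum.cong refl) (simp only: ncov_def, simp only: algebra_simps)
    also have "\<dots> = N * (U ?d * V ?d) + s1\<^sup>2 * (U ?b * V ?b) + s2\<^sup>2 * (U ?c * V ?c)
         + r * s1 * s2 * (U ?b * V ?c) + r * s1 * s2 * (U ?c * V ?b)"
      by (simp only: sum.distrib sum_distrib_left[symmetric] UV UV[of ?d ?d])
    also have "\<dots> = ncov N s1 s2 r (u j) (U ?b) (U ?c) (v j) (V ?b) (V ?c)"
      unfolding d by (simp add: ncov_def algebra_simps)
    finally show "(\<Sum>k<\<eta>. \<Sum>i<\<eta>. u i * v k * ncov N s1 s2 r (?d i j) (?b i j) (?c i j) (?d k j) (?b k j) (?c k j))
       = ncov N s1 s2 r (u j) (\<Sum>i<\<eta>. u i * ?b i j) (\<Sum>i<\<eta>. u i * ?c i j) (v j) (\<Sum>i<\<eta>. v i * ?b i j) (\<Sum>i<\<eta>. v i * ?c i j)"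
      by (simp add: U_def V_def)
  qed
  finally show ?thesis .
qed

lemma sandwich_entry:
  assumes "Cm \<in> carrier_mat d \<eta>" "Q \<in> carrier_mat \<eta> \<eta>" "p < d" "q < d"
  shows "(Cm * Q * Cm\<^sup>T) $$ (p, q) = (\<Sum>k<\<eta>. (\<Sum>i<\<eta>. Cm $$ (p, i) * Q $$ (i, k)) * Cm $$ (q, k))"
  using assms
  by (subst mult_transpose_entry[of _ d \<eta> _ d])
     (auto simp: mult_entry[of Cm d \<eta> Q \<eta>] simp del: index_mult_mat)


text \<open>Two rank-one terms cover all three numerators of the region; for a single user
  \<open>f'\<close> is zero.\<close>

lemma sandwich_low_rank:
  fixes Cm :: "real mat"
  assumes C: "Cm \<in> carrier_mat d \<eta>" and M: "M \<in> carrier_mat \<eta> \<eta>" and Q: "Q \<in> carrier_mat \<eta> \<eta>"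
    and e: "\<And>i k. i < \<eta> \<Longrightarrow> k < \<eta> \<Longrightarrow> M $$ (i, k) = f i * f k + f' i * f' k + Q $$ (i, k)" and pq: "p < d" "q < d"
  shows "(Cm * M * Cm\<^sup>T) $$ (p, q) = (\<Sum>i<\<eta>. Cm $$ (p, i) * f i) * (\<Sum>i<\<eta>. Cm $$ (q, i) * f i)
    + (\<Sum>i<\<eta>. Cm $$ (p, i) * f' i) * (\<Sum>i<\<eta>. Cm $$ (q, i) * f' i) + (Cm * Q * Cm\<^sup>T) $$ (p, q)"
proof -
  let ?c = "\<lambda>p i. Cm $$ (p, i)"
  have "(Cm * M * Cm\<^sup>T) $$ (p, q) = (\<Sum>k<\<eta>. (\<Sum>i<\<eta>. ?c p i * M $$ (i, k)) * ?c q k)"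
    by (rule sandwich_entry[OF C M pq])
  also have "\<dots> = (\<Sum>k<\<eta>. (\<Sum>i<\<eta>. ?c p i * f i) * (?c q k * f k) + (\<Sum>i<\<eta>. ?c p i * f' i) * (?c q k * f' k)
     + (\<Sum>i<\<eta>. ?c p i * Q $$ (i, k)) * ?c q k)"
  proof (intro sum.cong refl)
    fix k assume "k \<in> {..<\<eta>}"
    hence "(\<Sum>i<\<eta>. ?c p i * M $$ (i, k)) = (\<Sum>i<\<eta>. ?c p i * f i * f k + ?c p i * f' i * f' k + ?c p i * Q $$ (i, k))"
      by (intro sum.cong refl) (simp add: e algebra_simps)
    also have "\<dots> = (\<Sum>i<\<eta>. ?c p i * f i) * f k + (\<Sum>i<\<eta>. ?c p i * f' i) * f' k + (\<Sum>i<\<eta>. ?c p i * Q $$ (i, k))"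
      by (simp only: sum.distrib sum_distrib_right)
    finally show "(\<Sum>i<\<eta>. ?c p i * M $$ (i, k)) * ?c q k = (\<Sum>i<\<eta>. ?c p i * f i) * (?c q k * f k)
       + (\<Sum>i<\<eta>. ?c p i * f' i) * (?c q k * f' k) + (\<Sum>i<\<eta>. ?c p i * Q $$ (i, k)) * ?c q k"
      by (simp only: distrib_right mult.assoc mult.commute[of "?c q k"])
  qed
  also have "\<dots> = (\<Sum>i<\<eta>. ?c p i * f i) * (\<Sum>i<\<eta>. ?c q i * f i) + (\<Sum>i<\<eta>. ?c p i * f' i) * (\<Sum>i<\<eta>. ?c q i * f' i)
     + (\<Sum>k<\<eta>. (\<Sum>i<\<eta>. ?c p i * Q $$ (i, k)) * ?c q k)"
    by (simp only: sum.distrib sum_distrib_left)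
  finally show ?thesis unfolding sandwich_entry[OF C Q pq] .
qed

text \<open>Gain matrix and noise covariance of the two filters are the same G. Beyond these
  equations the coding argument needs no knowledge of C.\<close>

definition matched :: "real \<Rightarrow> real \<Rightarrow> real \<Rightarrow> real \<Rightarrow> nat \<Rightarrow> (nat \<Rightarrow> nat \<Rightarrow> real) \<Rightarrow> (nat \<Rightarrow> nat \<Rightarrow> real)
    \<Rightarrow> (nat \<Rightarrow> real) \<Rightarrow> (nat \<Rightarrow> real) \<Rightarrow> (nat \<Rightarrow> real) \<Rightarrow> (nat \<Rightarrow> real) \<Rightarrow> real \<Rightarrow> real \<Rightarrow> real \<Rightarrow> bool" where
  "matched N s1 s2 r \<eta> B1 B2 a1 a2 u1 u2 g1 g2 h \<longleftrightarrow>
     (\<Sum>i<\<eta>. u1 i * a1 i) = g1 \<and> (\<Sum>i<\<eta>. u1 i * a2 i) = h \<and>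
     (\<Sum>i<\<eta>. u2 i * a1 i) = h \<and> (\<Sum>i<\<eta>. u2 i * a2 i) = g2 \<and>
     nform N s1 s2 r \<eta> B1 B2 u1 u1 = g1 \<and> nform N s1 s2 r \<eta> B1 B2 u2 u2 = g2 \<and>
     nform N s1 s2 r \<eta> B1 B2 u1 u2 = h"

text \<open>The filters are \<open>u = C\<^sup>T K\<^sup>-\<^sup>1 C a\<close> with \<open>K = C Q C\<^sup>T\<close>; here \<open>C\<close> has the single row \<open>c\<close>.\<close>
lemma matched_rank1:
  fixes N s1 s2 r :: real and \<eta> :: nat and B1 B2 :: "nat \<Rightarrow> nat \<Rightarrow> real"
    and c a1 a2 :: "nat \<Rightarrow> real"
  defines "k \<equiv> nform N s1 s2 r \<eta> B1 B2 c c"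
    and "H1 \<equiv> \<Sum>i<\<eta>. c i * a1 i" and "H2 \<equiv> \<Sum>i<\<eta>. c i * a2 i"
  assumes k: "k > 0"
  shows "matched N s1 s2 r \<eta> B1 B2 a1 a2 (\<lambda>i. H1 / k * c i) (\<lambda>i. H2 / k * c i) (H1\<^sup>2 / k) (H2\<^sup>2 / k) (H1 * H2 / k)"
proof -
  have s: "nform N s1 s2 r \<eta> B1 B2 (\<lambda>i. x * c i) (\<lambda>i. y * c i) = x * y * k" for x y
    using nform_lin2[of N s1 s2 r \<eta> B1 B2 x c 0 c "\<lambda>i. y * c i"] nform_lin2'[of N s1 s2 r \<eta> B1 B2 c y c 0 c]
    by (simp add: k_def)
  have t: "(\<Sum>i<\<eta>. x * c i * a i) = x * (\<Sum>i<\<eta>. c i * a i)" for x a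
    by (simp add: sum_distrib_left mult.assoc)
  show ?thesis unfolding matched_def s t H1_def[symmetric] H2_def[symmetric]
    using k by (simp add: power2_eq_square)
qed

text \<open>By Cramer's rule \<open>(x a, y a)\<close> solves the system with matrix K, of
  determinant \<open>D\<close>, and right side C a. Applying K to the solution returns C a, which is
  why covariance and gain agree.\<close>

lemma matched_rank2:
  fixes N s1 s2 r :: real and \<eta> :: nat and B1 B2 :: "nat \<Rightarrow> nat \<Rightarrow> real"
    and c d a1 a2 :: "nat \<Rightarrow> real"
  defines "k0 \<equiv> nform N s1 s2 r \<eta> B1 B2 c c" and "k1 \<equiv> nform N s1 s2 r \<eta> B1 B2 c d"
    and "k2 \<equiv> nform N s1 s2 r \<eta> B1 B2 d d"
    and "H \<equiv> \<lambda>a. \<Sum>i<\<eta>. c i * a i" and "J \<equiv> \<lambda>a. \<Sum>i<\<eta>. d i * a i"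
  defines "D \<equiv> k0 * k2 - k1 * k1"
  defines "x \<equiv> \<lambda>a. (k2 * H a - k1 * J a) / D" and "y \<equiv> \<lambda>a. (k0 * J a - k1 * H a) / D"
  assumes D: "D > 0"
  shows "matched N s1 s2 r \<eta> B1 B2 a1 a2 (\<lambda>i. x a1 * c i + y a1 * d i) (\<lambda>i. x a2 * c i + y a2 * d i)
    (x a1 * H a1 + y a1 * J a1) (x a2 * H a2 + y a2 * J a2) (x a1 * H a2 + y a1 * J a2)"
proof -
  have t: "(\<Sum>i<\<eta>. (x a * c i + y a * d i) * b i) = x a * H b + y a * J b" for a b
    by (simp add: H_def J_def sum_distrib_left sum.distrib algebra_simps)
  have dc: "nform N s1 s2 r \<eta> B1 B2 d c = k1" unfolding k1_def by (rule nform_sym)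
  have n: "nform N s1 s2 r \<eta> B1 B2 (\<lambda>i. x a * c i + y a * d i) (\<lambda>i. x b * c i + y b * d i)
     = x a * (k0 * x b + k1 * y b) + y a * (k1 * x b + k2 * y b)" for a b
    unfolding nform_lin2 nform_lin2' dc k0_def[symmetric] k1_def[symmetric] k2_def[symmetric] by (simp add: algebra_simps)
  have e1: "k0 * x b + k1 * y b = H b" for b
  proof -
    have "D * (k0 * x b + k1 * y b) = k0 * (k2 * H b - k1 * J b) + k1 * (k0 * J b - k1 * H b)"
      using D by (simp add: x_def y_def field_simps)
    also have "\<dots> = D * H b" by (simp add: D_def algebra_simps)
    finally show ?thesis using D by simp
  qed
  have e2: "k1 * x b + k2 * y b = J b" for b
  proof -
    have "D * (k1 * x b + k2 * y b) = k1 * (k2 * H b - k1 * J b) + k2 * (k0 * J b - k1 * H b)"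
      using D by (simp add: x_def y_def field_simps)
    also have "\<dots> = D * J b" by (simp add: D_def algebra_simps)
    finally show ?thesis using D by simp
  qed
  have s: "x a2 * H a1 + y a2 * J a1 = x a1 * H a2 + y a1 * J a2"
    by (simp add: x_def y_def add_divide_distrib[symmetric] algebra_simps)
  show ?thesis unfolding matched_def t n e1 e2 using s by simp
qed

lemma matched_zero:
  "matched N s1 s2 r \<eta> B1 B2 a1 a2 (\<lambda>i. 0) (\<lambda>i. 0) 0 0 0"
  by (simp add: matched_def nform_def ncov_def)

text \<open>The matrix determinant lemma det (K + H H^T) / det K = det (I + H^T K^-1 H) for a 2 x 2
  matrix K. In the first identity H is the single column (p, q); in the second it has the further
  column (p', q').\<close>

lemma det_rank_identities:
  fixes k0 k1 k2 p q p' q' :: real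
  defines "D \<equiv> k0 * k2 - k1 * k1"
  defines "x \<equiv> (k2 * p - k1 * q) / D" and "y \<equiv> (k0 * q - k1 * p) / D"
    and "x' \<equiv> (k2 * p' - k1 * q') / D" and "y' \<equiv> (k0 * q' - k1 * p') / D"
  assumes D: "D > 0"
  shows "((p * p + k0) * (q * q + k2) - (p * q + k1) * (q * p + k1)) / D = 1 + (x * p + y * q)"
    and "((p * p + p' * p' + k0) * (q * q + q' * q' + k2) - (p * q + p' * q' + k1) * (q * p + q' * p' + k1)) / D
      = (1 + (x * p + y * q)) * (1 + (x' * p' + y' * q')) - (x * p' + y * q')\<^sup>2"
proof -
  define A where "A = (k2 * p - k1 * q) * p + (k0 * q - k1 * p) * q"
  define A' where "A' = (k2 * p' - k1 * q') * p' + (k0 * q' - k1 * p') * q'"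
  define B where "B = (k2 * p - k1 * q) * p' + (k0 * q - k1 * p) * q'"
  have a: "x * p + y * q = A / D" "x' * p' + y' * q' = A' / D" "x * p' + y * q' = B / D"
    by (simp_all add: x_def y_def x'_def y'_def A_def A'_def B_def add_divide_distrib)
  have "(p * p + k0) * (q * q + k2) - (p * q + k1) * (q * p + k1) = D + A"
    by (simp add: D_def A_def algebra_simps)
  thus "((p * p + k0) * (q * q + k2) - (p * q + k1) * (q * p + k1)) / D = 1 + (x * p + y * q)"
    unfolding a using D by (simp add: add_divide_distrib)
  \<comment> \<open>Multiplicativity of the determinant: the left side is the determinant of H^T
    adj(K) H, and adj(K) has determinant \<open>D\<close>.\<close>
  have AB: "A * A' - B\<^sup>2 = D * (p * q' - q * p')\<^sup>2"
    by (simp add: D_def A_def A'_def B_def power2_eq_square algebra_simps)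
  have "(p * p + p' * p' + k0) * (q * q + q' * q' + k2) - (p * q + p' * q' + k1) * (q * p + q' * p' + k1)
     = D + A + A' + (p * q' - q * p')\<^sup>2"
    by (simp add: D_def A_def A'_def power2_eq_square algebra_simps)
  also have "\<dots> / D = 1 + A / D + A' / D + (A * A' - B\<^sup>2) / (D * D)"
    unfolding AB using D by (simp add: add_divide_distrib)
  also have "\<dots> = (1 + A / D) * (1 + A' / D) - (B / D)\<^sup>2"
    by (simp add: algebra_simps power2_eq_square diff_divide_distrib)
  finally show "((p * p + p' * p' + k0) * (q * q + q' * q' + k2) - (p * q + p' * q' + k1) * (q * p + q' * p' + k1)) / D
      = (1 + (x * p + y * q)) * (1 + (x' * p' + y' * q')) - (x * p' + y * q')\<^sup>2" unfolding a .
qed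

definition rates_le :: "nat \<Rightarrow> real \<Rightarrow> real \<Rightarrow> real \<Rightarrow> real \<Rightarrow> real \<Rightarrow> bool" where
  "rates_le \<eta> R1 R2 g1 g2 h \<longleftrightarrow> 2 * real \<eta> * R1 \<le> ln (1 + g1) \<and> 2 * real \<eta> * R2 \<le> ln (1 + g2)
     \<and> 2 * real \<eta> * (R1 + R2) \<le> ln ((1 + g1) * (1 + g2) - h\<^sup>2)"

text \<open>Later arguments use only the entries of the four matrices, so the products themselves
  are hidden behind an existential; one row and two rows of \<open>Cm\<close> are treated
  alike.\<close>

lemma region_with_entries:
  assumes \<eta>: "0 < \<eta>" and a: "a1 \<in> carrier_vec \<eta>" "a2 \<in> carrier_vec \<eta>"
    and B: "strictly_lower \<eta> B1" "strictly_lower \<eta> B2" and C: "Cm \<in> carrier_mat d \<eta>"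
    and R: "(R1, R2) \<in> region_with \<eta> N s1 s2 r a1 a2 B1 B2 Cm"
  defines "K \<equiv> \<lambda>p q. nform N s1 s2 r \<eta> (low \<eta> B1) (low \<eta> B2) (\<lambda>i. Cm $$ (p, i)) (\<lambda>i. Cm $$ (q, i))"
    and "H \<equiv> \<lambda>p. \<Sum>i<\<eta>. Cm $$ (p, i) * a1 $ i" and "J \<equiv> \<lambda>p. \<Sum>i<\<eta>. Cm $$ (p, i) * a2 $ i"
  shows "\<exists>X X1 X2 X12. X \<in> carrier_mat d d \<and> X1 \<in> carrier_mat d d \<and> X2 \<in> carrier_mat d d \<and> X12 \<in> carrier_mat d d \<and>
    (\<forall>p<d. \<forall>q<d. X $$ (p, q) = K p q \<and> X1 $$ (p, q) = H p * H q + K p q \<and> X2 $$ (p, q) = J p * J q + K p q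
       \<and> X12 $$ (p, q) = H p * H q + J p * J q + K p q) \<and>
    2 * real \<eta> * R1 \<le> ln (det X1 / det X) \<and> 2 * real \<eta> * R2 \<le> ln (det X2 / det X)
    \<and> 2 * real \<eta> * (R1 + R2) \<le> ln (det X12 / det X)"
proof -
  define Q where "Q = Qmat \<eta> N s1 s2 r B1 B2"
  define A where "A = mat \<eta> 2 (\<lambda>(i, j). if j = 0 then a1 $ i else a2 $ i)"
  have Q: "Q \<in> carrier_mat \<eta> \<eta>" unfolding Q_def by (rule Qmat_carrier[OF B])
  have A: "A \<in> carrier_mat \<eta> 2" by (simp add: A_def)
  have cm: "colmat a \<in> carrier_mat \<eta> 1" if "a \<in> carrier_vec \<eta>" for a
    using that by (auto simp: colmat_def)
  have M1: "colmat a1 * (colmat a1)\<^sup>T + Q \<in> carrier_mat \<eta> \<eta>" and M2: "colmat a2 * (colmat a2)\<^sup>T + Q \<in> carrier_mat \<eta> \<eta>"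
    and M12: "A * A\<^sup>T + Q \<in> carrier_mat \<eta> \<eta>" using Q by auto
  have ce: "(colmat a * (colmat a)\<^sup>T) $$ (i, k) = a $ i * a $ k" if "a \<in> carrier_vec \<eta>" "i < \<eta>" "k < \<eta>" for a i k
    using that by (subst mult_transpose_entry[OF cm cm]) (auto simp: colmat_def)
  have Ae: "(A * A\<^sup>T) $$ (i, k) = a1 $ i * a1 $ k + a2 $ i * a2 $ k" if "i < \<eta>" "k < \<eta>" for i k
    using that by (subst mult_transpose_entry[OF A A]) (auto simp: A_def numeral_2_eq_2)
  have addQ: "(X + Q) $$ (i, k) = X $$ (i, k) + Q $$ (i, k)" if "i < \<eta>" "k < \<eta>" for X i k
    using that Q by simp
  have e1: "(colmat a1 * (colmat a1)\<^sup>T + Q) $$ (i, k) = a1 $ i * a1 $ k + 0 * 0 + Q $$ (i, k)" if "i < \<eta>" "k < \<eta>" for i k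
    unfolding addQ[OF that] ce[OF a(1) that] by simp
  have e2: "(colmat a2 * (colmat a2)\<^sup>T + Q) $$ (i, k) = a2 $ i * a2 $ k + 0 * 0 + Q $$ (i, k)" if "i < \<eta>" "k < \<eta>" for i k
    unfolding addQ[OF that] ce[OF a(2) that] by simp
  have e12: "(A * A\<^sup>T + Q) $$ (i, k) = a1 $ i * a1 $ k + a2 $ i * a2 $ k + Q $$ (i, k)" if "i < \<eta>" "k < \<eta>" for i k
    unfolding addQ[OF that] Ae[OF that] by simp
  have K: "(Cm * Q * Cm\<^sup>T) $$ (p, q) = K p q" if "p < d" "q < d" for p q
    unfolding sandwich_entry[OF C Q that] unfolding Q_def K_def by (rule nform_Qmat[OF B])
  have car: "Cm * X * Cm\<^sup>T \<in> carrier_mat d d" if "X \<in> carrier_mat \<eta> \<eta>" for X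
    using C that by auto
  have ld: "R \<le> ld_bound \<eta> Cm X Q \<Longrightarrow> 2 * real \<eta> * R \<le> ln (det (Cm * X * Cm\<^sup>T) / det (Cm * Q * Cm\<^sup>T))" for R X
    using \<eta> unfolding ld_bound_def by (simp add: field_simps)
  from R have "R1 \<le> ld_bound \<eta> Cm (colmat a1 * (colmat a1)\<^sup>T + Q) Q" "R2 \<le> ld_bound \<eta> Cm (colmat a2 * (colmat a2)\<^sup>T + Q) Q"
    "R1 + R2 \<le> ld_bound \<eta> Cm (A * A\<^sup>T + Q) Q"
    by (auto simp: region_with_def Let_def Q_def A_def)
  note b = this[THEN ld]
  have E: "(Cm * Q * Cm\<^sup>T) $$ (p, q) = K p q \<and> (Cm * (colmat a1 * (colmat a1)\<^sup>T + Q) * Cm\<^sup>T) $$ (p, q) = H p * H q + K p q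
      \<and> (Cm * (colmat a2 * (colmat a2)\<^sup>T + Q) * Cm\<^sup>T) $$ (p, q) = J p * J q + K p q
      \<and> (Cm * (A * A\<^sup>T + Q) * Cm\<^sup>T) $$ (p, q) = H p * H q + J p * J q + K p q" if pq: "p < d" "q < d" for p q
    using sandwich_low_rank[where f = "\<lambda>i. a1 $ i" and f' = "\<lambda>_. 0", OF C M1 Q e1 pq]
      sandwich_low_rank[where f = "\<lambda>i. a2 $ i" and f' = "\<lambda>_. 0", OF C M2 Q e2 pq]
      sandwich_low_rank[where f = "\<lambda>i. a1 $ i" and f' = "\<lambda>i. a2 $ i", OF C M12 Q e12 pq]
    unfolding K[OF pq] H_def J_def by (simp del: index_mult_mat)
  hence all: "\<forall>p<d. \<forall>q<d. (Cm * Q * Cm\<^sup>T) $$ (p, q) = K p q \<and> (Cm * (colmat a1 * (colmat a1)\<^sup>T + Q) * Cm\<^sup>T) $$ (p, q) = H p * H q + K p q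
      \<and> (Cm * (colmat a2 * (colmat a2)\<^sup>T + Q) * Cm\<^sup>T) $$ (p, q) = J p * J q + K p q
      \<and> (Cm * (A * A\<^sup>T + Q) * Cm\<^sup>T) $$ (p, q) = H p * H q + J p * J q + K p q" by blast
  show ?thesis
    by (intro exI conjI, rule car[OF Q], rule car[OF M1], rule car[OF M2], rule car[OF M12], rule all, (rule b)+)
qed

lemma region_eta_matched:
  assumes \<eta>: "0 < \<eta>" and a: "a1 \<in> carrier_vec \<eta>" "a2 \<in> carrier_vec \<eta>"
    and B: "strictly_lower \<eta> B1" "strictly_lower \<eta> B2" and C: "C \<in> carrier_mat 2 \<eta>"
    and N: "0 < N" and r: "r\<^sup>2 \<le> 1"
    and R: "(R1, R2) \<in> region_eta \<eta> N s1 s2 r a1 a2 B1 B2 C"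
  shows "\<exists>u1 u2 g1 g2 h. matched N s1 s2 r \<eta> (low \<eta> B1) (low \<eta> B2) (\<lambda>i. a1 $ i) (\<lambda>i. a2 $ i) u1 u2 g1 g2 h
     \<and> rates_le \<eta> R1 R2 g1 g2 h"
proof -
  let ?nf = "nform N s1 s2 r \<eta> (low \<eta> B1) (low \<eta> B2)"
  have nf_pos: "0 < ?nf u u" if "i < \<eta>" "u i \<noteq> 0" for u i
  proof -
    have "0 < (u i)\<^sup>2" using that by simp
    also have "(u i)\<^sup>2 \<le> (\<Sum>i<\<eta>. (u i)\<^sup>2)" using that by (intro member_le_sum) auto
    finally have "0 < N * (\<Sum>i<\<eta>. (u i)\<^sup>2)" using N by simp
    also have "\<dots> \<le> ?nf u u" using N r by (intro nform_ge) auto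
    finally show ?thesis .
  qed
  consider (two) "det (C * C\<^sup>T) \<noteq> 0" | (one) "det (C * C\<^sup>T) = 0" "C \<noteq> 0\<^sub>m 2 \<eta>" | (zero) "det (C * C\<^sup>T) = 0" "C = 0\<^sub>m 2 \<eta>"
    by blast
  thus ?thesis
  proof cases
    case zero
    hence "R1 = 0" "R2 = 0" using R by (auto simp: region_eta_def)
    thus ?thesis
      by (intro exI[of _ "\<lambda>_. 0"] exI[of _ 0] conjI matched_zero) (simp add: rates_le_def)
  next
    case one
    define w where "w = (if row C 0 \<noteq> 0\<^sub>v \<eta> then row C 0 else row C 1)"
    have "row C i \<in> carrier_vec \<eta>" for i using C by (intro carrier_vecI) simp
    hence w: "w \<in> carrier_vec \<eta>" by (simp add: w_def)
    have "w \<noteq> 0\<^sub>v \<eta>"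
    proof
      assume w0: "w = 0\<^sub>v \<eta>"
      hence rows: "row C 0 = 0\<^sub>v \<eta>" "row C 1 = 0\<^sub>v \<eta>" by (auto simp: w_def split: if_splits)
      have "C = 0\<^sub>m 2 \<eta>"
      proof (rule eq_matI)
        fix i j assume "i < dim_row (0\<^sub>m 2 \<eta> :: real mat)" "j < dim_col (0\<^sub>m 2 \<eta> :: real mat)"
        hence ij: "i = 0 \<or> i = 1" "j < \<eta>" by auto
        have "C $$ (i, j) = row C i $ j" using ij C by auto
        also have "\<dots> = 0" using ij rows by auto
        finally show "C $$ (i, j) = 0\<^sub>m 2 \<eta> $$ (i, j)" using ij by auto
      qed (use C in auto)
      thus False using one by simp
    qed
    have "\<exists>i<\<eta>. w $ i \<noteq> 0"
    proof (rule ccontr)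
      assume "\<not> ?thesis"
      hence "w = 0\<^sub>v \<eta>" using w by (intro eq_vecI) auto
      thus False using \<open>w \<noteq> 0\<^sub>v \<eta>\<close> by simp
    qed
    then obtain i where i: "i < \<eta>" "w $ i \<noteq> 0" by blast
    define Cm where "Cm = mat_of_rows \<eta> [w]"
    have Cm: "Cm \<in> carrier_mat 1 \<eta>" by (simp add: Cm_def mat_of_rows_def)
    have Ce: "Cm $$ (0, i) = w $ i" if "i < \<eta>" for i using that by (simp add: Cm_def mat_of_rows_def)
    have R': "(R1, R2) \<in> region_with \<eta> N s1 s2 r a1 a2 B1 B2 Cm" using R one by (simp add: region_eta_def w_def Cm_def)
    let ?c = "\<lambda>i. Cm $$ (0, i)"
    define k where "k = ?nf ?c ?c"
    define H where "H = (\<Sum>i<\<eta>. ?c i * a1 $ i)"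
    define J where "J = (\<Sum>i<\<eta>. ?c i * a2 $ i)"
    have k: "k > 0" unfolding k_def by (rule nf_pos[OF i(1)]) (use i Ce in simp)
    from region_with_entries[OF \<eta> a B Cm R'] obtain X X1 X2 X12 where
      X: "X \<in> carrier_mat 1 1" "X1 \<in> carrier_mat 1 1" "X2 \<in> carrier_mat 1 1" "X12 \<in> carrier_mat 1 1"
      and all: "\<forall>p<1. \<forall>q<1. X $$ (p, q) = ?nf (\<lambda>i. Cm $$ (p, i)) (\<lambda>i. Cm $$ (q, i))
       \<and> X1 $$ (p, q) = (\<Sum>i<\<eta>. Cm $$ (p, i) * a1 $ i) * (\<Sum>i<\<eta>. Cm $$ (q, i) * a1 $ i) + ?nf (\<lambda>i. Cm $$ (p, i)) (\<lambda>i. Cm $$ (q, i))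
       \<and> X2 $$ (p, q) = (\<Sum>i<\<eta>. Cm $$ (p, i) * a2 $ i) * (\<Sum>i<\<eta>. Cm $$ (q, i) * a2 $ i) + ?nf (\<lambda>i. Cm $$ (p, i)) (\<lambda>i. Cm $$ (q, i))
       \<and> X12 $$ (p, q) = (\<Sum>i<\<eta>. Cm $$ (p, i) * a1 $ i) * (\<Sum>i<\<eta>. Cm $$ (q, i) * a1 $ i)
          + (\<Sum>i<\<eta>. Cm $$ (p, i) * a2 $ i) * (\<Sum>i<\<eta>. Cm $$ (q, i) * a2 $ i) + ?nf (\<lambda>i. Cm $$ (p, i)) (\<lambda>i. Cm $$ (q, i))"
      and le: "2 * real \<eta> * R1 \<le> ln (det X1 / det X)" "2 * real \<eta> * R2 \<le> ln (det X2 / det X)"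
       "2 * real \<eta> * (R1 + R2) \<le> ln (det X12 / det X)"
      by (elim exE conjE) (rule that)
    note a0 = all[rule_format, OF less_one[THEN iffD2, OF refl] less_one[THEN iffD2, OF refl]]
    have e: "X $$ (0, 0) = k" "X1 $$ (0, 0) = H * H + k" "X2 $$ (0, 0) = J * J + k" "X12 $$ (0, 0) = H * H + J * J + k"
      unfolding k_def H_def J_def by (rule a0[THEN conjunct1], rule a0[THEN conjunct2, THEN conjunct1],
        rule a0[THEN conjunct2, THEN conjunct2, THEN conjunct1], rule a0[THEN conjunct2, THEN conjunct2, THEN conjunct2])
    have rl: "rates_le \<eta> R1 R2 (H\<^sup>2 / k) (J\<^sup>2 / k) (H * J / k)"
    proof -
      have d: "det X1 / det X = 1 + H\<^sup>2 / k" "det X2 / det X = 1 + J\<^sup>2 / k" "det X12 / det X = 1 + H\<^sup>2 / k + J\<^sup>2 / k"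
        using k by (simp_all add: det_single[OF X(1)] det_single[OF X(2)] det_single[OF X(3)] det_single[OF X(4)] e
            power2_eq_square add_divide_distrib)
      \<comment> \<open>Here G has rank at most one, so det (I + G) is one plus its trace.\<close>
      have "(1 + H\<^sup>2 / k) * (1 + J\<^sup>2 / k) - (H * J / k)\<^sup>2 = 1 + H\<^sup>2 / k + J\<^sup>2 / k"
        by (simp add: power_divide power_mult_distrib algebra_simps power2_eq_square)
      thus ?thesis using le unfolding rates_le_def d by simp
    qed
    note m = matched_rank1[of N s1 s2 r \<eta> "low \<eta> B1" "low \<eta> B2" ?c "\<lambda>i. a1 $ i" "\<lambda>i. a2 $ i",
        folded k_def H_def J_def, OF k]
    show ?thesis by (intro exI conjI, rule m, rule rl)
  next
    case two
    have R': "(R1, R2) \<in> region_with \<eta> N s1 s2 r a1 a2 B1 B2 C" using R two by (simp add: region_eta_def)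
    let ?c = "\<lambda>i. C $$ (0, i)" and ?d = "\<lambda>i. C $$ (1, i)"
    define k0 where "k0 = ?nf ?c ?c"
    define k1 where "k1 = ?nf ?c ?d"
    define k2 where "k2 = ?nf ?d ?d"
    have k1': "?nf ?d ?c = k1" unfolding k1_def by (rule nform_sym)
    define D where "D = k0 * k2 - k1 * k1"
    have CC: "C * C\<^sup>T \<in> carrier_mat 2 2" using C by auto
    have l2: "(0::nat) < 2" "(1::nat) < 2" by auto
    have detCC: "det (C * C\<^sup>T) = (\<Sum>l<\<eta>. ?c l * ?c l) * (\<Sum>l<\<eta>. ?d l * ?d l) - (\<Sum>l<\<eta>. ?c l * ?d l) * (\<Sum>l<\<eta>. ?d l * ?c l)"
      unfolding det_2x2[OF CC] mult_transpose_entry[OF C C l2(1) l2(1)] mult_transpose_entry[OF C C l2(1) l2(2)]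
        mult_transpose_entry[OF C C l2(2) l2(1)] mult_transpose_entry[OF C C l2(2) l2(2)] ..
    have "\<exists>i<\<eta>. ?d i \<noteq> 0"
    proof (rule ccontr)
      assume "\<not> ?thesis"
      hence "?d l = 0" if "l < \<eta>" for l using that by blast
      hence "det (C * C\<^sup>T) = 0" unfolding detCC by simp
      thus False using two by simp
    qed
    hence k2: "k2 > 0" unfolding k2_def by (elim exE conjE) (rule nf_pos)
    have D: "D > 0"
    proof -
      \<comment> \<open>\<open>k2\<close> times the part of the first row that is orthogonal to the
        second in the form Q. Its squared norm is \<open>k2 * D\<close>, and it vanishes only for
        parallel rows, which the nonsingular C C^T excludes.\<close>
      define w where "w = (\<lambda>i. k2 * ?c i + (- k1) * ?d i)"
      have "?nf w w = k2 * (k2 * k0 + (- k1) * k1) + (- k1) * (k2 * k1 + (- k1) * k2)"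
        unfolding w_def nform_lin2 nform_lin2' k1' k0_def[symmetric] k1_def[symmetric] k2_def[symmetric] by simp
      hence nw: "?nf w w = k2 * D" by (simp add: D_def algebra_simps)
      have "\<exists>i<\<eta>. w i \<noteq> 0"
      proof (rule ccontr)
        assume "\<not> ?thesis"
        hence "k2 * ?c l = k1 * ?d l" if "l < \<eta>" for l using that by (auto simp: w_def)
        hence c: "?c l = k1 / k2 * ?d l" if "l < \<eta>" for l using that k2 by (simp add: field_simps)
        have s: "(\<Sum>l<\<eta>. ?c l * ?c l) = (k1 / k2) * (k1 / k2) * (\<Sum>l<\<eta>. ?d l * ?d l)"
          "(\<Sum>l<\<eta>. ?c l * ?d l) = (k1 / k2) * (\<Sum>l<\<eta>. ?d l * ?d l)" "(\<Sum>l<\<eta>. ?d l * ?c l) = (k1 / k2) * (\<Sum>l<\<eta>. ?d l * ?d l)"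
          unfolding sum_distrib_left by (intro sum.cong refl; simp add: c)+
        have "det (C * C\<^sup>T) = 0" unfolding detCC s by (simp add: algebra_simps)
        thus False using two by simp
      qed
      hence "0 < ?nf w w" by (elim exE conjE) (rule nf_pos)
      thus ?thesis using k2 unfolding nw by (simp add: zero_less_mult_iff)
    qed
    define H where "H = (\<lambda>a. \<Sum>i<\<eta>. ?c i * a i)"
    define J where "J = (\<lambda>a. \<Sum>i<\<eta>. ?d i * a i)"
    define x where "x = (\<lambda>a. (k2 * H a - k1 * J a) / D)"
    define y where "y = (\<lambda>a. (k0 * J a - k1 * H a) / D)"
    let ?a1 = "\<lambda>i. a1 $ i" and ?a2 = "\<lambda>i. a2 $ i"
    have m: "matched N s1 s2 r \<eta> (low \<eta> B1) (low \<eta> B2) ?a1 ?a2 (\<lambda>i. x ?a1 * ?c i + y ?a1 * ?d i) (\<lambda>i. x ?a2 * ?c i + y ?a2 * ?d i)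
      (x ?a1 * H ?a1 + y ?a1 * J ?a1) (x ?a2 * H ?a2 + y ?a2 * J ?a2) (x ?a1 * H ?a2 + y ?a1 * J ?a2)"
      using D unfolding x_def y_def H_def J_def D_def k0_def k1_def k2_def by (rule matched_rank2)
    from region_with_entries[OF \<eta> a B C R'] obtain X X1 X2 X12 where
      X: "X \<in> carrier_mat 2 2" "X1 \<in> carrier_mat 2 2" "X2 \<in> carrier_mat 2 2" "X12 \<in> carrier_mat 2 2"
      and all: "\<forall>p<2. \<forall>q<2. X $$ (p, q) = ?nf (\<lambda>i. C $$ (p, i)) (\<lambda>i. C $$ (q, i))
       \<and> X1 $$ (p, q) = (\<Sum>i<\<eta>. C $$ (p, i) * a1 $ i) * (\<Sum>i<\<eta>. C $$ (q, i) * a1 $ i) + ?nf (\<lambda>i. C $$ (p, i)) (\<lambda>i. C $$ (q, i))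
       \<and> X2 $$ (p, q) = (\<Sum>i<\<eta>. C $$ (p, i) * a2 $ i) * (\<Sum>i<\<eta>. C $$ (q, i) * a2 $ i) + ?nf (\<lambda>i. C $$ (p, i)) (\<lambda>i. C $$ (q, i))
       \<and> X12 $$ (p, q) = (\<Sum>i<\<eta>. C $$ (p, i) * a1 $ i) * (\<Sum>i<\<eta>. C $$ (q, i) * a1 $ i)
          + (\<Sum>i<\<eta>. C $$ (p, i) * a2 $ i) * (\<Sum>i<\<eta>. C $$ (q, i) * a2 $ i) + ?nf (\<lambda>i. C $$ (p, i)) (\<lambda>i. C $$ (q, i))"
      and le: "2 * real \<eta> * R1 \<le> ln (det X1 / det X)" "2 * real \<eta> * R2 \<le> ln (det X2 / det X)"
       "2 * real \<eta> * (R1 + R2) \<le> ln (det X12 / det X)"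
      by (elim exE conjE) (rule that)
    note e = all[rule_format, THEN conjunct1] all[rule_format, THEN conjunct2, THEN conjunct1]
      all[rule_format, THEN conjunct2, THEN conjunct2, THEN conjunct1] all[rule_format, THEN conjunct2, THEN conjunct2, THEN conjunct2]
    have e': "X $$ (0, 0) = k0" "X $$ (0, 1) = k1" "X $$ (1, 0) = k1" "X $$ (1, 1) = k2"
      "X1 $$ (0, 0) = H ?a1 * H ?a1 + k0" "X1 $$ (0, 1) = H ?a1 * J ?a1 + k1" "X1 $$ (1, 0) = J ?a1 * H ?a1 + k1" "X1 $$ (1, 1) = J ?a1 * J ?a1 + k2"
      "X2 $$ (0, 0) = H ?a2 * H ?a2 + k0" "X2 $$ (0, 1) = H ?a2 * J ?a2 + k1" "X2 $$ (1, 0) = J ?a2 * H ?a2 + k1" "X2 $$ (1, 1) = J ?a2 * J ?a2 + k2"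
      "X12 $$ (0, 0) = H ?a1 * H ?a1 + H ?a2 * H ?a2 + k0" "X12 $$ (0, 1) = H ?a1 * J ?a1 + H ?a2 * J ?a2 + k1"
      "X12 $$ (1, 0) = J ?a1 * H ?a1 + J ?a2 * H ?a2 + k1" "X12 $$ (1, 1) = J ?a1 * J ?a1 + J ?a2 * J ?a2 + k2"
      unfolding e(1)[OF l2(1) l2(1)] e(1)[OF l2(1) l2(2)] e(1)[OF l2(2) l2(1)] e(1)[OF l2(2) l2(2)]
        e(2)[OF l2(1) l2(1)] e(2)[OF l2(1) l2(2)] e(2)[OF l2(2) l2(1)] e(2)[OF l2(2) l2(2)]
        e(3)[OF l2(1) l2(1)] e(3)[OF l2(1) l2(2)] e(3)[OF l2(2) l2(1)] e(3)[OF l2(2) l2(2)]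
        e(4)[OF l2(1) l2(1)] e(4)[OF l2(1) l2(2)] e(4)[OF l2(2) l2(1)] e(4)[OF l2(2) l2(2)]
        k1' unfolding k0_def k1_def k2_def H_def J_def by (rule refl)+
    note id1 = det_rank_identities(1)[where ?k0.0 = k0 and ?k1.0 = k1 and ?k2.0 = k2 and p = "H ?a1" and q = "J ?a1", folded D_def, OF D]
    note id12 = det_rank_identities(2)[where ?k0.0 = k0 and ?k1.0 = k1 and ?k2.0 = k2 and p = "H ?a1" and q = "J ?a1"
        and p' = "H ?a2" and q' = "J ?a2", folded D_def, OF D]
    note id2 = det_rank_identities(1)[where ?k0.0 = k0 and ?k1.0 = k1 and ?k2.0 = k2 and p = "H ?a2" and q = "J ?a2", folded D_def, OF D]
    have d: "det X = D" "det X1 / det X = 1 + (x ?a1 * H ?a1 + y ?a1 * J ?a1)" "det X2 / det X = 1 + (x ?a2 * H ?a2 + y ?a2 * J ?a2)"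
      "det X12 / det X = (1 + (x ?a1 * H ?a1 + y ?a1 * J ?a1)) * (1 + (x ?a2 * H ?a2 + y ?a2 * J ?a2)) - (x ?a1 * H ?a2 + y ?a1 * J ?a2)\<^sup>2"
    proof -
      show dX: "det X = D" unfolding det_2x2[OF X(1)] e' D_def ..
      show "det X1 / det X = 1 + (x ?a1 * H ?a1 + y ?a1 * J ?a1)"
        unfolding dX det_2x2[OF X(2)] e' x_def y_def by (rule id1)
      show "det X2 / det X = 1 + (x ?a2 * H ?a2 + y ?a2 * J ?a2)"
        unfolding dX det_2x2[OF X(3)] e' x_def y_def by (rule id2)
      show "det X12 / det X = (1 + (x ?a1 * H ?a1 + y ?a1 * J ?a1)) * (1 + (x ?a2 * H ?a2 + y ?a2 * J ?a2)) - (x ?a1 * H ?a2 + y ?a1 * J ?a2)\<^sup>2"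
        unfolding dX det_2x2[OF X(4)] e' x_def y_def by (rule id12)
    qed
    have rl: "rates_le \<eta> R1 R2 (x ?a1 * H ?a1 + y ?a1 * J ?a1) (x ?a2 * H ?a2 + y ?a2 * J ?a2) (x ?a1 * H ?a2 + y ?a1 * J ?a2)"
      using le unfolding rates_le_def d(2,3,4) by (intro conjI)
    show ?thesis
      by (rule exI[of _ "\<lambda>i. x ?a1 * ?c i + y ?a1 * ?d i"], rule exI[of _ "\<lambda>i. x ?a2 * ?c i + y ?a2 * ?d i"],
          rule exI[of _ "x ?a1 * H ?a1 + y ?a1 * J ?a1"], rule exI[of _ "x ?a2 * H ?a2 + y ?a2 * J ?a2"],
          rule exI[of _ "x ?a1 * H ?a2 + y ?a1 * J ?a2"], rule conjI[OF m rl])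
  qed
qed

section \<open>Covariance of the inputs\<close>

lemma sum_double: "(\<Sum>l<2 * n. f l) = (\<Sum>l<n. f l) + (\<Sum>l<n. f (n + l))"
  for f :: "nat \<Rightarrow> 'a::comm_monoid_add" and n :: nat
  using sum.atLeastLessThan_concat[of 0 n "n + n" f] sum.shift_bounds_nat_ivl[of f 0 n n]
  by (simp add: lessThan_atLeast0 mult_2 add.commute)

lemma sum_bilinear:
  fixes J :: "nat \<Rightarrow> real"
  shows "(\<Sum>l<n. (\<Sum>k<n. J k * (\<Sum>c<m. A k c * A' l c)) * J l)
    = (\<Sum>c<m. (\<Sum>k<n. J k * A k c) * (\<Sum>l<n. J l * A' l c))"
proof -
  have "(\<Sum>l<n. (\<Sum>k<n. J k * (\<Sum>c<m. A k c * A' l c)) * J l)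
      = (\<Sum>l<n. \<Sum>k<n. \<Sum>c<m. (J k * A k c) * (J l * A' l c))"
    by (simp add: sum_distrib_left sum_distrib_right mult_ac)
  also have "\<dots> = (\<Sum>c<m. \<Sum>l<n. \<Sum>k<n. (J k * A k c) * (J l * A' l c))" by (rule sum_swap3[symmetric])
  also have "\<dots> = (\<Sum>c<m. \<Sum>k<n. \<Sum>l<n. (J k * A k c) * (J l * A' l c))"
    by (intro sum.cong[OF refl] sum.swap)
  finally show ?thesis by (simp only: sum_product)
qed

locale block_matrices =
  fixes \<eta> :: nat and N s1 s2 r :: real and a1 a2 :: "real vec" and B1 B2 :: "real mat"
  assumes B: "strictly_lower \<eta> B1" "strictly_lower \<eta> B2"
begin

abbreviation "b1 \<equiv> low \<eta> B1"
abbreviation "b2 \<equiv> low \<eta> B2"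

definition "BB = four_block_mat B1 B1 B2 B2"
definition "Mm = 1\<^sub>m (2 * \<eta>) - BB"
definition "Inv = the (mat_inverse Mm)"

lemma B_dims [simp]: "dim_row B1 = \<eta>" "dim_col B1 = \<eta>" "dim_row B2 = \<eta>" "dim_col B2 = \<eta>"
  using B by (auto simp: strictly_lower_def)

lemma BB_carrier: "BB \<in> carrier_mat (2 * \<eta>) (2 * \<eta>)"
  unfolding BB_def mult_2 using B by (intro four_block_carrier_mat) (auto simp: strictly_lower_def)

lemma Mm_carrier: "Mm \<in> carrier_mat (2 * \<eta>) (2 * \<eta>)"
  unfolding Mm_def by (rule minus_carrier_mat[OF BB_carrier])

lemma Mm_apply:
  assumes k: "k < \<eta>"
  shows "(\<Sum>l<2 * \<eta>. Mm $$ (k, l) * X l) = X k - (\<Sum>j<\<eta>. b1 k j * (X j + X (\<eta> + j)))"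
    and "(\<Sum>l<2 * \<eta>. Mm $$ (\<eta> + k, l) * X l) = X (\<eta> + k) - (\<Sum>j<\<eta>. b2 k j * (X j + X (\<eta> + j)))"
proof -
  have e: "Mm $$ (i, l) = (if i = l then 1 else 0) - BB $$ (i, l)" if "i < 2 * \<eta>" "l < 2 * \<eta>" for i l
    using that BB_carrier by (simp add: Mm_def)
  have gen: "(\<Sum>l<2 * \<eta>. Mm $$ (i, l) * X l) = X i - (\<Sum>j<\<eta>. b j * (X j + X (\<eta> + j)))"
    if i: "i < 2 * \<eta>" and b: "\<And>j. j < \<eta> \<Longrightarrow> BB $$ (i, j) = b j" "\<And>j. j < \<eta> \<Longrightarrow> BB $$ (i, \<eta> + j) = b j" for i b
  proof -
    have "(\<Sum>l<2 * \<eta>. Mm $$ (i, l) * X l) = (\<Sum>l<2 * \<eta>. (if i = l then X l else 0) - BB $$ (i, l) * X l)"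
      using i by (intro sum.cong refl) (auto simp: e left_diff_distrib)
    also have "\<dots> = X i - (\<Sum>l<2 * \<eta>. BB $$ (i, l) * X l)" using i by (simp add: sum_subtractf)
    also have "(\<Sum>l<2 * \<eta>. BB $$ (i, l) * X l) = (\<Sum>j<\<eta>. b j * X j) + (\<Sum>j<\<eta>. b j * X (\<eta> + j))"
      unfolding sum_double by (simp add: b)
    also have "\<dots> = (\<Sum>j<\<eta>. b j * (X j + X (\<eta> + j)))" by (simp add: distrib_left sum.distrib)
    finally show ?thesis .
  qed
  show "(\<Sum>l<2 * \<eta>. Mm $$ (k, l) * X l) = X k - (\<Sum>j<\<eta>. b1 k j * (X j + X (\<eta> + j)))"
    by (rule gen) (use k low_entry[OF B(1) k] in \<open>auto simp: BB_def\<close>)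
  show "(\<Sum>l<2 * \<eta>. Mm $$ (\<eta> + k, l) * X l) = X (\<eta> + k) - (\<Sum>j<\<eta>. b2 k j * (X j + X (\<eta> + j)))"
    by (rule gen) (use k low_entry[OF B(2) k] in \<open>auto simp: BB_def\<close>)
qed

text \<open>For a kernel vector the sums of its two halves satisfy a strictly triangular recursion
  and vanish by induction; the halves are linear in these sums and vanish too.\<close>

lemma det_Mm: "det Mm \<noteq> 0"
proof
  assume "det Mm = 0"
  then obtain v where v: "v \<in> carrier_vec (2 * \<eta>)" "v \<noteq> 0\<^sub>v (2 * \<eta>)" "Mm *\<^sub>v v = 0\<^sub>v (2 * \<eta>)"
    using det_0_iff_vec_prod_zero_field[OF Mm_carrier] by blast
  define X where "X = (\<lambda>l. v $ l)"
  have z: "(\<Sum>l<2 * \<eta>. Mm $$ (k, l) * X l) = 0" if "k < 2 * \<eta>" for k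
  proof -
    have "(\<Sum>l<2 * \<eta>. Mm $$ (k, l) * X l) = (Mm *\<^sub>v v) $ k"
      using that v(1) Mm_carrier by (auto simp: scalar_prod_def X_def sum_atLeast0)
    thus ?thesis using v(3) that by simp
  qed
  have x1: "X k = (\<Sum>j<\<eta>. b1 k j * (X j + X (\<eta> + j)))" and x2: "X (\<eta> + k) = (\<Sum>j<\<eta>. b2 k j * (X j + X (\<eta> + j)))"
    if "k < \<eta>" for k
    using Mm_apply[OF that, of X] z[of k] z[of "\<eta> + k"] that by auto
  have s: "X k + X (\<eta> + k) = 0" if "k < \<eta>" for k
    using that
  proof (induction k rule: less_induct)
    case (less k)
    have "b j * (X j + X (\<eta> + j)) = 0" if "j < \<eta>" "\<And>i. k \<le> i \<Longrightarrow> b i = 0" for j b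
      using that less.IH[of j] by (cases "j < k") auto
    hence "(\<Sum>j<\<eta>. b1 k j * (X j + X (\<eta> + j))) = 0" "(\<Sum>j<\<eta>. b2 k j * (X j + X (\<eta> + j))) = 0"
      by (auto intro!: sum.neutral simp del: mult_eq_0_iff simp: low_zero)
    thus ?case using x1[OF less.prems] x2[OF less.prems] by simp
  qed
  have "X k = 0" "X (\<eta> + k) = 0" if "k < \<eta>" for k
    using x1[OF that] x2[OF that] s by auto
  hence "X k = 0" if "k < 2 * \<eta>" for k
    using that by (cases "k < \<eta>") (auto dest: le_Suc_ex simp: not_less)
  hence "v = 0\<^sub>v (2 * \<eta>)" using v(1) by (intro eq_vecI) (auto simp: X_def)
  thus False using v(2) by simp
qed

lemma Inv: "Inv * Mm = 1\<^sub>m (2 * \<eta>)" "Inv \<in> carrier_mat (2 * \<eta>) (2 * \<eta>)"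
proof -
  have "mat_inverse Mm \<noteq> None"
    using mat_inverse(1)[OF Mm_carrier, of "()"] det_non_zero_imp_unit[OF Mm_carrier det_Mm, of "()"] by blast
  then obtain I where "mat_inverse Mm = Some I" by auto
  thus "Inv * Mm = 1\<^sub>m (2 * \<eta>)" "Inv \<in> carrier_mat (2 * \<eta>) (2 * \<eta>)"
    using mat_inverse(2)[OF Mm_carrier] by (auto simp: Inv_def)
qed

text \<open>Responses of input \<open>i\<close> to the sources in a block: \<open>pc\<close> and
  \<open>qc\<close> to the two letters, \<open>wc1\<close> and \<open>wc2\<close> to the feedback
  noises, \<open>zc\<close> to the channel noise, which enters both feedback links.\<close>

definition pc where "pc i = (\<Sum>k<\<eta>. Inv $$ (i, k) * a1 $ k)"
definition qc where "qc i = (\<Sum>k<\<eta>. Inv $$ (i, \<eta> + k) * a2 $ k)"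
definition wc1 where "wc1 i j = (\<Sum>k<\<eta>. Inv $$ (i, k) * b1 k j)"
definition wc2 where "wc2 i j = (\<Sum>k<\<eta>. Inv $$ (i, \<eta> + k) * b2 k j)"
definition zc where "zc i j = wc1 i j + wc2 i j"

text \<open>Substituting the outputs turns the recursion into the linear system with matrix I - BB,
  and multiplication by \<open>Inv\<close> solves it.\<close>

lemma block_response:
  assumes X1: "\<And>k. k < \<eta> \<Longrightarrow> X k = a1 $ k * \<xi>1 + (\<Sum>j<\<eta>. b1 k j * (y j + w1 j))"
    and X2: "\<And>k. k < \<eta> \<Longrightarrow> X (\<eta> + k) = a2 $ k * \<xi>2 + (\<Sum>j<\<eta>. b2 k j * (y j + w2 j))"
    and y: "\<And>j. j < \<eta> \<Longrightarrow> y j = X j + X (\<eta> + j) + z j" and i: "i < 2 * \<eta>"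
  shows "X i = pc i * \<xi>1 + qc i * \<xi>2 + (\<Sum>j<\<eta>. nlin (zc i j) (wc1 i j) (wc2 i j) (z j, w1 j, w2 j))"
proof -
  have d: "(\<Sum>k<2 * \<eta>. Inv $$ (i, k) * Mm $$ (k, l)) = (if i = l then 1 else 0)" if "l < 2 * \<eta>" for l
    using mult_entry[OF Inv(2) Mm_carrier i that] Inv(1) i that by simp
  have "X i = (\<Sum>l<2 * \<eta>. (\<Sum>k<2 * \<eta>. Inv $$ (i, k) * Mm $$ (k, l)) * X l)"
    using i by (simp add: d if_distrib[where f = "\<lambda>x. x * _"] cong: if_cong)
  also have "\<dots> = (\<Sum>l<2 * \<eta>. \<Sum>k<2 * \<eta>. Inv $$ (i, k) * (Mm $$ (k, l) * X l))"
    by (simp add: sum_distrib_right mult.assoc)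
  also have "\<dots> = (\<Sum>k<2 * \<eta>. \<Sum>l<2 * \<eta>. Inv $$ (i, k) * (Mm $$ (k, l) * X l))" by (rule sum.swap)
  also have "\<dots> = (\<Sum>k<2 * \<eta>. Inv $$ (i, k) * (\<Sum>l<2 * \<eta>. Mm $$ (k, l) * X l))"
    by (simp add: sum_distrib_left)
  also have "\<dots> = (\<Sum>k<\<eta>. Inv $$ (i, k) * (a1 $ k * \<xi>1 + (\<Sum>j<\<eta>. b1 k j * (z j + w1 j))))
      + (\<Sum>k<\<eta>. Inv $$ (i, \<eta> + k) * (a2 $ k * \<xi>2 + (\<Sum>j<\<eta>. b2 k j * (z j + w2 j))))"
  proof -
    have m1: "(\<Sum>l<2 * \<eta>. Mm $$ (k, l) * X l) = a1 $ k * \<xi>1 + (\<Sum>j<\<eta>. b1 k j * (z j + w1 j))" if "k < \<eta>" for k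
    proof -
      have "(\<Sum>j<\<eta>. b1 k j * (y j + w1 j)) = (\<Sum>j<\<eta>. b1 k j * (X j + X (\<eta> + j)) + b1 k j * (z j + w1 j))"
        by (intro sum.cong refl) (simp add: y algebra_simps)
      thus ?thesis unfolding Mm_apply(1)[OF that] X1[OF that] by (simp add: sum.distrib)
    qed
    have m2: "(\<Sum>l<2 * \<eta>. Mm $$ (\<eta> + k, l) * X l) = a2 $ k * \<xi>2 + (\<Sum>j<\<eta>. b2 k j * (z j + w2 j))" if "k < \<eta>" for k
    proof -
      have "(\<Sum>j<\<eta>. b2 k j * (y j + w2 j)) = (\<Sum>j<\<eta>. b2 k j * (X j + X (\<eta> + j)) + b2 k j * (z j + w2 j))"
        by (intro sum.cong refl) (simp add: y algebra_simps)
      thus ?thesis unfolding Mm_apply(2)[OF that] X2[OF that] by (simp add: sum.distrib)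
    qed
    show ?thesis unfolding sum_double[of "\<lambda>k. Inv $$ (i, k) * (\<Sum>l<2 * \<eta>. Mm $$ (k, l) * X l)"] using m1 m2 by simp
  qed
  also have "(\<Sum>k<\<eta>. Inv $$ (i, k) * (a1 $ k * \<xi>1 + (\<Sum>j<\<eta>. b1 k j * (z j + w1 j)))) = pc i * \<xi>1 + (\<Sum>j<\<eta>. wc1 i j * (z j + w1 j))"
  proof -
    have "(\<Sum>k<\<eta>. Inv $$ (i, k) * (\<Sum>j<\<eta>. b1 k j * (z j + w1 j))) = (\<Sum>k<\<eta>. \<Sum>j<\<eta>. Inv $$ (i, k) * b1 k j * (z j + w1 j))"
      by (simp add: sum_distrib_left mult.assoc)
    also have "\<dots> = (\<Sum>j<\<eta>. \<Sum>k<\<eta>. Inv $$ (i, k) * b1 k j * (z j + w1 j))" by (rule sum.swap)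
    finally show ?thesis by (simp add: pc_def wc1_def distrib_left sum.distrib sum_distrib_right mult.assoc)
  qed
  also have "(\<Sum>k<\<eta>. Inv $$ (i, \<eta> + k) * (a2 $ k * \<xi>2 + (\<Sum>j<\<eta>. b2 k j * (z j + w2 j)))) = qc i * \<xi>2 + (\<Sum>j<\<eta>. wc2 i j * (z j + w2 j))"
  proof -
    have "(\<Sum>k<\<eta>. Inv $$ (i, \<eta> + k) * (\<Sum>j<\<eta>. b2 k j * (z j + w2 j))) = (\<Sum>k<\<eta>. \<Sum>j<\<eta>. Inv $$ (i, \<eta> + k) * b2 k j * (z j + w2 j))"
      by (simp add: sum_distrib_left mult.assoc)
    also have "\<dots> = (\<Sum>j<\<eta>. \<Sum>k<\<eta>. Inv $$ (i, \<eta> + k) * b2 k j * (z j + w2 j))" by (rule sum.swap)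
    finally show ?thesis by (simp add: qc_def wc2_def distrib_left sum.distrib sum_distrib_right mult.assoc)
  qed
  also have "pc i * \<xi>1 + (\<Sum>j<\<eta>. wc1 i j * (z j + w1 j)) + (qc i * \<xi>2 + (\<Sum>j<\<eta>. wc2 i j * (z j + w2 j)))
     = pc i * \<xi>1 + qc i * \<xi>2 + (\<Sum>j<\<eta>. wc1 i j * (z j + w1 j) + wc2 i j * (z j + w2 j))"
    by (simp only: sum.distrib)
  also have "(\<Sum>j<\<eta>. wc1 i j * (z j + w1 j) + wc2 i j * (z j + w2 j)) = (\<Sum>j<\<eta>. nlin (zc i j) (wc1 i j) (wc2 i j) (z j, w1 j, w2 j))"
    by (intro sum.cong refl) (simp add: nlin_def zc_def algebra_simps)
  finally show ?thesis .
qed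

text \<open>\<open>Sigma_mat\<close> is the covariance of the inputs for letters of unit variance,
  so a diagonal entry is the sum of the squared responses to the letters and the variance of the
  response to the noise.\<close>

lemma Sigma_diag:
  assumes i: "i < 2 * \<eta>"
  shows "Sigma_mat \<eta> N s1 s2 r a1 a2 B1 B2 $$ (i, i) = (pc i)\<^sup>2 + (qc i)\<^sup>2
    + (\<Sum>j<\<eta>. ncov N s1 s2 r (zc i j) (wc1 i j) (wc2 i j) (zc i j) (wc1 i j) (wc2 i j))"
proof -
  let ?n = "2 * \<eta>"
  define Ad where "Ad = mat ?n 2 (\<lambda>(i, j). if i < \<eta> \<and> j = 0 then a1 $ i
                                     else if \<eta> \<le> i \<and> j = 1 then a2 $ (i - \<eta>) else 0)"
  define Bt where "Bt = mat ?n \<eta> (\<lambda>(i, j). if i < \<eta> then B1 $$ (i, j) else B2 $$ (i - \<eta>, j))"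
  define Bd where "Bd = four_block_mat B1 (0\<^sub>m \<eta> \<eta>) (0\<^sub>m \<eta> \<eta>) B2"
  define KW where "KW = four_block_mat ((s1\<^sup>2) \<cdot>\<^sub>m 1\<^sub>m \<eta>) ((r * s1 * s2) \<cdot>\<^sub>m 1\<^sub>m \<eta>)
                              ((r * s1 * s2) \<cdot>\<^sub>m 1\<^sub>m \<eta>) ((s2\<^sup>2) \<cdot>\<^sub>m 1\<^sub>m \<eta>)"
  define T where "T = Ad * Ad\<^sup>T + N \<cdot>\<^sub>m (Bt * Bt\<^sup>T) + Bd * KW * Bd\<^sup>T"
  have S: "Sigma_mat \<eta> N s1 s2 r a1 a2 B1 B2 = Inv * T * Inv\<^sup>T"
    by (simp add: Sigma_mat_def Let_def Inv_def Mm_def BB_def T_def Ad_def Bt_def Bd_def KW_def)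
  have Ad: "Ad \<in> carrier_mat ?n 2" by (simp add: Ad_def)
  have Bt: "Bt \<in> carrier_mat ?n \<eta>" by (simp add: Bt_def)
  have Bd: "Bd \<in> carrier_mat ?n ?n" unfolding Bd_def mult_2
    using B by (intro four_block_carrier_mat) (auto simp: strictly_lower_def)
  have KW: "KW \<in> carrier_mat ?n ?n" unfolding KW_def mult_2
    by (intro four_block_carrier_mat) auto
  have BK: "Bd * KW \<in> carrier_mat ?n ?n" using Bd KW by simp
  have T: "T \<in> carrier_mat ?n ?n" unfolding T_def using Ad Bt Bd KW by auto
  define J where "J = (\<lambda>k. Inv $$ (i, k))"
  have Te: "T $$ (k, l) = (\<Sum>c<2. Ad $$ (k, c) * Ad $$ (l, c)) + N * (\<Sum>c<\<eta>. Bt $$ (k, c) * Bt $$ (l, c))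
     + (\<Sum>c<?n. (\<Sum>b<?n. Bd $$ (k, b) * KW $$ (b, c)) * Bd $$ (l, c))" if "k < ?n" "l < ?n" for k l
  proof -
    have "T $$ (k, l) = (Ad * Ad\<^sup>T) $$ (k, l) + N * (Bt * Bt\<^sup>T) $$ (k, l) + (Bd * KW * Bd\<^sup>T) $$ (k, l)"
      unfolding T_def using that Ad Bt Bd KW by (simp del: index_mult_mat(1))
    thus ?thesis using sandwich_entry[OF Bd KW that]
      by (simp only: mult_transpose_entry[OF Ad Ad that] mult_transpose_entry[OF Bt Bt that])
  qed
  \<comment> \<open>Row \<open>i\<close> of the inverse applied to a column of one of the factor
    matrices; the values are the response coefficients.\<close>
  define \<phi> where "\<phi> = (\<lambda>A c. \<Sum>k<?n. J k * A $$ (k, c))"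
  have "Sigma_mat \<eta> N s1 s2 r a1 a2 B1 B2 $$ (i, i) = (\<Sum>l<?n. (\<Sum>k<?n. J k * T $$ (k, l)) * J l)"
    unfolding S sandwich_entry[OF Inv(2) T i i] J_def ..
  also have "\<dots> = (\<Sum>l<?n. (\<Sum>k<?n. J k * (\<Sum>c<2. Ad $$ (k, c) * Ad $$ (l, c))) * J l)
      + N * (\<Sum>l<?n. (\<Sum>k<?n. J k * (\<Sum>c<\<eta>. Bt $$ (k, c) * Bt $$ (l, c))) * J l)
      + (\<Sum>l<?n. (\<Sum>k<?n. J k * (\<Sum>c<?n. (\<Sum>b<?n. Bd $$ (k, b) * KW $$ (b, c)) * Bd $$ (l, c))) * J l)"
  proof -
    have "(\<Sum>k<?n. J k * T $$ (k, l)) * J l = (\<Sum>k<?n. J k * (\<Sum>c<2. Ad $$ (k, c) * Ad $$ (l, c))) * J l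
      + N * ((\<Sum>k<?n. J k * (\<Sum>c<\<eta>. Bt $$ (k, c) * Bt $$ (l, c))) * J l)
      + (\<Sum>k<?n. J k * (\<Sum>c<?n. (\<Sum>b<?n. Bd $$ (k, b) * KW $$ (b, c)) * Bd $$ (l, c))) * J l" if l: "l < ?n" for l
    proof -
      have "(\<Sum>k<?n. J k * T $$ (k, l)) = (\<Sum>k<?n. J k * (\<Sum>c<2. Ad $$ (k, c) * Ad $$ (l, c))
        + N * (J k * (\<Sum>c<\<eta>. Bt $$ (k, c) * Bt $$ (l, c)))
        + J k * (\<Sum>c<?n. (\<Sum>b<?n. Bd $$ (k, b) * KW $$ (b, c)) * Bd $$ (l, c)))"
        using Te[OF _ l] by (intro sum.cong refl) (simp only: lessThan_iff, simp only: distrib_left mult.left_commute)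
      also have "\<dots> = (\<Sum>k<?n. J k * (\<Sum>c<2. Ad $$ (k, c) * Ad $$ (l, c)))
        + N * (\<Sum>k<?n. J k * (\<Sum>c<\<eta>. Bt $$ (k, c) * Bt $$ (l, c)))
        + (\<Sum>k<?n. J k * (\<Sum>c<?n. (\<Sum>b<?n. Bd $$ (k, b) * KW $$ (b, c)) * Bd $$ (l, c)))"
        by (simp only: sum.distrib sum_distrib_left[symmetric])
      finally show ?thesis by (simp only: distrib_right mult.assoc)
    qed
    hence "(\<Sum>l<?n. (\<Sum>k<?n. J k * T $$ (k, l)) * J l) = (\<Sum>l<?n. (\<Sum>k<?n. J k * (\<Sum>c<2. Ad $$ (k, c) * Ad $$ (l, c))) * J l
      + N * ((\<Sum>k<?n. J k * (\<Sum>c<\<eta>. Bt $$ (k, c) * Bt $$ (l, c))) * J l)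
      + (\<Sum>k<?n. J k * (\<Sum>c<?n. (\<Sum>b<?n. Bd $$ (k, b) * KW $$ (b, c)) * Bd $$ (l, c))) * J l)"
      by (intro sum.cong refl) (simp only: lessThan_iff)
    thus ?thesis by (simp only: sum.distrib sum_distrib_left[symmetric])
  qed
  also have "\<dots> = (\<Sum>c<2. \<phi> Ad c * \<phi> Ad c) + N * (\<Sum>c<\<eta>. \<phi> Bt c * \<phi> Bt c)
     + (\<Sum>c<?n. (\<Sum>k<?n. J k * (\<Sum>b<?n. Bd $$ (k, b) * KW $$ (b, c))) * \<phi> Bd c)"
    unfolding sum_bilinear \<phi>_def ..
  also have "(\<Sum>c<2. \<phi> Ad c * \<phi> Ad c) = (pc i)\<^sup>2 + (qc i)\<^sup>2"
  proof -
    have "\<phi> Ad 0 = pc i" "\<phi> Ad 1 = qc i"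
      unfolding \<phi>_def sum_double by (simp_all add: Ad_def J_def pc_def qc_def)
    thus ?thesis by (simp add: numeral_2_eq_2)
  qed
  also have "(\<Sum>c<\<eta>. \<phi> Bt c * \<phi> Bt c) = (\<Sum>c<\<eta>. zc i c * zc i c)"
  proof (intro sum.cong refl)
    fix c assume "c \<in> {..<\<eta>}"
    hence c: "c < \<eta>" by simp
    have "\<phi> Bt c = zc i c" unfolding \<phi>_def sum_double
      using c by (simp add: Bt_def J_def zc_def wc1_def wc2_def low_entry[OF B(1)] low_entry[OF B(2)])
    thus "\<phi> Bt c * \<phi> Bt c = zc i c * zc i c" by simp
  qed
  also have "(\<Sum>c<?n. (\<Sum>k<?n. J k * (\<Sum>b<?n. Bd $$ (k, b) * KW $$ (b, c))) * \<phi> Bd c)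
     = (\<Sum>j<\<eta>. s1\<^sup>2 * wc1 i j * wc1 i j + s2\<^sup>2 * wc2 i j * wc2 i j + r * s1 * s2 * (wc1 i j * wc2 i j + wc2 i j * wc1 i j))"
  proof -
    have f: "\<phi> Bd j = wc1 i j" "\<phi> Bd (\<eta> + j) = wc2 i j" if "j < \<eta>" for j
      unfolding \<phi>_def sum_double using that
      by (simp_all add: Bd_def J_def wc1_def wc2_def low_entry[OF B(1)] low_entry[OF B(2)])
    have g: "(\<Sum>k<?n. J k * (\<Sum>b<?n. Bd $$ (k, b) * KW $$ (b, c))) = (\<Sum>b<?n. \<phi> Bd b * KW $$ (b, c))" for c
    proof -
      have "(\<Sum>k<?n. J k * (\<Sum>b<?n. Bd $$ (k, b) * KW $$ (b, c))) = (\<Sum>k<?n. \<Sum>b<?n. J k * Bd $$ (k, b) * KW $$ (b, c))"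
        by (simp only: sum_distrib_left mult.assoc)
      also have "\<dots> = (\<Sum>b<?n. \<Sum>k<?n. J k * Bd $$ (k, b) * KW $$ (b, c))" by (rule sum.swap)
      finally show ?thesis by (simp only: \<phi>_def sum_distrib_right)
    qed
    have hh: "(\<Sum>b<?n. \<phi> Bd b * KW $$ (b, j)) = s1\<^sup>2 * wc1 i j + r * s1 * s2 * wc2 i j"
      "(\<Sum>b<?n. \<phi> Bd b * KW $$ (b, \<eta> + j)) = r * s1 * s2 * wc1 i j + s2\<^sup>2 * wc2 i j" if j: "j < \<eta>" for j
    proof -
      have K: "KW $$ (b, j) = (if b = j then s1\<^sup>2 else 0)" "KW $$ (\<eta> + b, j) = (if b = j then r * s1 * s2 else 0)"
        "KW $$ (b, \<eta> + j) = (if b = j then r * s1 * s2 else 0)" "KW $$ (\<eta> + b, \<eta> + j) = (if b = j then s2\<^sup>2 else 0)"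
        if "b < \<eta>" for b using that j by (auto simp: KW_def)
      show "(\<Sum>b<?n. \<phi> Bd b * KW $$ (b, j)) = s1\<^sup>2 * wc1 i j + r * s1 * s2 * wc2 i j"
        "(\<Sum>b<?n. \<phi> Bd b * KW $$ (b, \<eta> + j)) = r * s1 * s2 * wc1 i j + s2\<^sup>2 * wc2 i j"
        unfolding sum_double using j by (simp_all add: f K if_distrib[where f = "\<lambda>x. _ * x"] cong: if_cong)
    qed
    have "(\<Sum>c<?n. (\<Sum>k<?n. J k * (\<Sum>b<?n. Bd $$ (k, b) * KW $$ (b, c))) * \<phi> Bd c)
        = (\<Sum>j<\<eta>. (\<Sum>b<?n. \<phi> Bd b * KW $$ (b, j)) * \<phi> Bd j)
          + (\<Sum>j<\<eta>. (\<Sum>b<?n. \<phi> Bd b * KW $$ (b, \<eta> + j)) * \<phi> Bd (\<eta> + j))"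
      unfolding g by (rule sum_double)
    also have "\<dots> = (\<Sum>j<\<eta>. (s1\<^sup>2 * wc1 i j + r * s1 * s2 * wc2 i j) * wc1 i j)
          + (\<Sum>j<\<eta>. (r * s1 * s2 * wc1 i j + s2\<^sup>2 * wc2 i j) * wc2 i j)"
      by (intro arg_cong2[where f = "(+)"] sum.cong refl) (simp_all only: lessThan_iff hh f)
    also have "\<dots> = (\<Sum>j<\<eta>. s1\<^sup>2 * wc1 i j * wc1 i j + s2\<^sup>2 * wc2 i j * wc2 i j + r * s1 * s2 * (wc1 i j * wc2 i j + wc2 i j * wc1 i j))"
      unfolding sum.distrib[symmetric] by (intro sum.cong refl) (simp add: algebra_simps)
    finally show ?thesis .
  qed
  finally show ?thesis
    by (simp add: ncov_def sum.distrib sum_distrib_left algebra_simps)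
qed

end

section \<open>Achievability\<close>

lemma nform_scale: "nform N s1 s2 r \<eta> B1 B2 (\<lambda>i. c * u i) (\<lambda>i. c * v i) = c\<^sup>2 * nform N s1 s2 r \<eta> B1 B2 u v"
  using nform_lin2[of N s1 s2 r \<eta> B1 B2 c u 0 u "\<lambda>i. c * v i"] nform_lin2'[of N s1 s2 r \<eta> B1 B2 u c v 0 v]
  by (simp add: power2_eq_square)

text \<open>The filters must shrink with the amplitudes: then gain and covariance both acquire the
  factor \<open>c\<^sup>2\<close>, and the scheme stays matched.\<close>

lemma matched_scale:
  assumes "matched N s1 s2 r \<eta> B1 B2 a1 a2 u1 u2 g1 g2 h"
  shows "matched N s1 s2 r \<eta> B1 B2 (\<lambda>i. c * a1 i) (\<lambda>i. c * a2 i) (\<lambda>i. c * u1 i) (\<lambda>i. c * u2 i)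
    (c\<^sup>2 * g1) (c\<^sup>2 * g2) (c\<^sup>2 * h)"
proof -
  have "(\<Sum>i<\<eta>. (c * u i) * (c * a i)) = c\<^sup>2 * (\<Sum>i<\<eta>. u i * a i)" for u a
    by (simp add: sum_distrib_left power2_eq_square mult_ac)
  thus ?thesis using assms unfolding matched_def nform_scale by simp
qed

lemma matched_noise_filters:
  assumes "matched N s1 s2 r \<eta> B1 B2 a1 a2 u1 u2 g1 g2 h" "0 < N" "r\<^sup>2 \<le> 1" "0 < \<eta>"
  shows "noise_filters N s1 s2 r \<eta> u1 (\<lambda>j. \<Sum>i<\<eta>. u1 i * B1 i j) (\<lambda>j. \<Sum>i<\<eta>. u1 i * B2 i j)
      u2 (\<lambda>j. \<Sum>i<\<eta>. u2 i * B1 i j) (\<lambda>j. \<Sum>i<\<eta>. u2 i * B2 i j) g1 g2 h"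
  using assms by unfold_locales (auto simp: matched_def nform_def)

lemma matched_linear_scheme:
  assumes "matched N s1 s2 r \<eta> B1 B2 a1 a2 u1 u2 g1 g2 h" "0 < N" "r\<^sup>2 \<le> 1" "0 < \<eta>"
    and "\<And>i j. i \<le> j \<Longrightarrow> B1 i j = 0" "\<And>i j. i \<le> j \<Longrightarrow> B2 i j = 0"
  shows "linear_scheme N s1 s2 r \<eta> a1 a2 B1 B2 u1 u2 g1 g2 h"
  using matched_noise_filters[OF assms(1-4)] assms by (simp add: linear_scheme_def matched_def)

lemma region_eta_codes:
  assumes P: "0 < P1" "0 < P2" and N: "0 < N" and r: "r\<^sup>2 \<le> 1" and \<eta>: "0 < \<eta>"
    and a: "a1 \<in> carrier_vec \<eta>" "a2 \<in> carrier_vec \<eta>"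
    and B: "strictly_lower \<eta> B1" "strictly_lower \<eta> B2" and C: "C \<in> carrier_mat 2 \<eta>"
    and pow: "power_ok \<eta> P1 P2 N s1 s2 r a1 a2 B1 B2"
    and R: "(R1, R2) \<in> region_eta \<eta> N s1 s2 r a1 a2 B1 B2 C" and \<delta>: "0 < \<delta>"
  shows "\<exists>k1 k2 :: nat \<Rightarrow> nat. \<exists>f1 f2 :: nat \<Rightarrow> nat \<Rightarrow> nat \<Rightarrow> (nat \<Rightarrow> real) \<Rightarrow> real.
     \<exists>dec :: nat \<Rightarrow> (nat \<Rightarrow> real) \<Rightarrow> nat \<times> nat. \<exists>n0.
       (\<forall>n\<ge>n0. is_code P1 P2 N s1 s2 r n (k1 n) (k2 n) (f1 n) (f2 n) (dec n) \<and>
                ln (real (k1 n)) / real n \<ge> R1 - \<delta> \<and> ln (real (k2 n)) / real n \<ge> R2 - \<delta>) \<and>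
       (\<lambda>n. err_prob N s1 s2 r n (k1 n) (k2 n) (f1 n) (f2 n) (dec n)) \<longlonglongrightarrow> 0"
proof -
  interpret bm: block_matrices \<eta> N s1 s2 r a1 a2 B1 B2 by unfold_locales (rule B)+
  obtain u1 u2 g1 g2 h where m: "matched N s1 s2 r \<eta> bm.b1 bm.b2 (\<lambda>i. a1 $ i) (\<lambda>i. a2 $ i) u1 u2 g1 g2 h"
    and rl: "rates_le \<eta> R1 R2 g1 g2 h"
    using region_eta_matched[OF \<eta> a B C N r R] by blast
  \<comment> \<open>Scaling costs at most \<open>- 2 * ln c\<close>, a quarter of
    \<open>real \<eta> * \<delta>\<close>, in \<open>ln (1 + g)\<close>, and twice that in the
    log-determinant; the available slack is \<open>2 * (real \<eta> * \<delta>)\<close> and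
    \<open>4 * (real \<eta> * \<delta>)\<close>.\<close>
  define c where "c = exp (- (real \<eta> * \<delta> / 8))"
  have \<eta>\<delta>: "0 < real \<eta> * \<delta>" using \<eta> \<delta> by simp
  have c: "0 < c" "c < 1" using \<eta>\<delta> by (auto simp: c_def)
  have lnc: "8 * ln c = - (real \<eta> * \<delta>)" by (simp add: c_def)
  \<comment> \<open>The unscaled filters supply the signs of \<open>g1\<close>, \<open>g2\<close>
    and det (I + G) before scaling.\<close>
  interpret nf: noise_filters N s1 s2 r \<eta> u1 "\<lambda>j. \<Sum>i<\<eta>. u1 i * bm.b1 i j" "\<lambda>j. \<Sum>i<\<eta>. u1 i * bm.b2 i j"
      u2 "\<lambda>j. \<Sum>i<\<eta>. u2 i * bm.b1 i j" "\<lambda>j. \<Sum>i<\<eta>. u2 i * bm.b2 i j" g1 g2 h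
    by (rule matched_noise_filters[OF m N r \<eta>])
  interpret ls: linear_scheme N s1 s2 r \<eta> "\<lambda>i. c * a1 $ i" "\<lambda>i. c * a2 $ i" bm.b1 bm.b2
      "\<lambda>i. c * u1 i" "\<lambda>i. c * u2 i" "c\<^sup>2 * g1" "c\<^sup>2 * g2" "c\<^sup>2 * h"
    by (rule matched_linear_scheme[OF matched_scale[OF m] N r \<eta>]) (rule low_zero, assumption)+
  have g0: "0 \<le> g1" "0 \<le> g2" by (rule nf.g1_nonneg nf.g2_nonneg)+
  define D where "D = (1 + g1) * (1 + g2) - h\<^sup>2"
  have D: "0 < D" using nf.dd_pos by (simp add: nf.dd_def D_def)
  have c2: "0 < c\<^sup>2" "c\<^sup>2 \<le> 1" using c by (auto simp: power_le_one)
  have l1: "2 * ln c + ln (1 + g) \<le> ln (1 + c\<^sup>2 * g)" if "0 \<le> g" for g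
  proof -
    have "2 * ln c + ln (1 + g) = ln (c\<^sup>2 * (1 + g))" using c that by (simp add: ln_mult ln_realpow)
    also have "\<dots> \<le> ln (1 + c\<^sup>2 * g)"
      using c2 that by (subst ln_le_cancel_iff) (auto simp: algebra_simps add_pos_nonneg intro: mult_pos_pos)
    finally show ?thesis .
  qed
  have l12: "4 * ln c + ln D \<le> ln ((1 + c\<^sup>2 * g1) * (1 + c\<^sup>2 * g2) - (c\<^sup>2 * h)\<^sup>2)"
  proof -
    define q where "q = c\<^sup>2"
    have q: "0 < q" "q \<le> 1" using c2 by (auto simp: q_def)
    have qq: "q * q \<le> q" using q by (simp add: mult_left_le_one_le)
    \<comment> \<open>For \<open>q\<close> at most one, det (I + q G) dominates q^2 det (I + G); the
      difference involves G only through its nonnegative trace.\<close>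
    have le: "q * q * D \<le> (1 + q * g1) * (1 + q * g2) - (q * h)\<^sup>2"
    proof -
      have "(1 + q * g1) * (1 + q * g2) - (q * h)\<^sup>2 - q * q * D = (1 - q * q) + (q - q * q) * (g1 + g2)"
        by (simp add: D_def power2_eq_square algebra_simps)
      moreover have "0 \<le> (q - q * q) * (g1 + g2)" using qq g0 by (intro mult_nonneg_nonneg) auto
      ultimately show ?thesis using qq q by linarith
    qed
    have "4 * ln c + ln D = ln (q * q * D)" using c D by (simp add: q_def ln_mult ln_realpow)
    also have "\<dots> \<le> ln ((1 + q * g1) * (1 + q * g2) - (q * h)\<^sup>2)"
      using le q D by (intro ln_mono) auto
    finally show ?thesis unfolding q_def .
  qed
  have e1: "2 * real \<eta> * (R1 - \<delta>) = 2 * real \<eta> * R1 - 2 * (real \<eta> * \<delta>)"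
    "2 * real \<eta> * (R2 - \<delta>) = 2 * real \<eta> * R2 - 2 * (real \<eta> * \<delta>)"
    "2 * real \<eta> * (R1 - \<delta> + (R2 - \<delta>)) = 2 * real \<eta> * (R1 + R2) - 4 * (real \<eta> * \<delta>)"
    by (simp_all add: algebra_simps)
  have rate: "real \<eta> * (R1 - \<delta>) < ls.I1" "real \<eta> * (R2 - \<delta>) < ls.I2" "real \<eta> * (R1 - \<delta> + (R2 - \<delta>)) < ls.I12"
  proof -
    have "2 * real \<eta> * (R1 - \<delta>) < ln (1 + c\<^sup>2 * g1)" "2 * real \<eta> * (R2 - \<delta>) < ln (1 + c\<^sup>2 * g2)"
      "2 * real \<eta> * (R1 - \<delta> + (R2 - \<delta>)) < ln ((1 + c\<^sup>2 * g1) * (1 + c\<^sup>2 * g2) - (c\<^sup>2 * h)\<^sup>2)"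
      using rl l1[OF g0(1)] l1[OF g0(2)] l12 lnc \<eta>\<delta> unfolding rates_le_def e1 D_def[symmetric] by linarith+
    thus "real \<eta> * (R1 - \<delta>) < ls.I1" "real \<eta> * (R2 - \<delta>) < ls.I2" "real \<eta> * (R1 - \<delta> + (R2 - \<delta>)) < ls.I12"
      unfolding ls.I1_def ls.I2_def ls.I12_def ls.dd_def by (simp_all add: algebra_simps)
  qed
  have resp: "chanX1 (ls.enc1 L c1) (ls.enc2 L c2) (l * \<eta> + i) ((m1, m2), g)
        = c * bm.pc i * c1 m1 l + c * bm.qc i * c2 m2 l + blin \<eta> (bm.zc i) (bm.wc1 i) (bm.wc2 i) l g
      \<and> chanX2 (ls.enc1 L c1) (ls.enc2 L c2) (l * \<eta> + i) ((m1, m2), g)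
        = c * bm.pc (\<eta> + i) * c1 m1 l + c * bm.qc (\<eta> + i) * c2 m2 l
          + blin \<eta> (bm.zc (\<eta> + i)) (bm.wc1 (\<eta> + i)) (bm.wc2 (\<eta> + i)) l g"
    if l: "l < L" and i: "i < \<eta>" for L c1 c2 l i m1 m2 g
  proof -
    let ?x1 = "\<lambda>k. chanX1 (ls.enc1 L c1) (ls.enc2 L c2) (l * \<eta> + k) ((m1, m2), g)"
    let ?x2 = "\<lambda>k. chanX2 (ls.enc1 L c1) (ls.enc2 L c2) (l * \<eta> + k) ((m1, m2), g)"
    let ?y = "\<lambda>j. ls.outs L c1 c2 m1 m2 g (l * \<eta> + j)"
    \<comment> \<open>The inputs of both users in one block, stacked in the order of
      \<open>Sigma_mat\<close>.\<close>
    define X where "X = (\<lambda>k. if k < \<eta> then ?x1 k else ?x2 (k - \<eta>))"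
    have X: "X k = pc' * (c * c1 m1 l) + qc' * (c * c2 m2 l)
        + (\<Sum>j<\<eta>. nlin (bm.zc k j) (bm.wc1 k j) (bm.wc2 k j) (noiseZ g (l * \<eta> + j), noiseW1 g (l * \<eta> + j), noiseW2 g (l * \<eta> + j)))"
      if k: "k < 2 * \<eta>" and pq: "pc' = bm.pc k" "qc' = bm.qc k" for k pc' qc'
      unfolding pq
    proof (rule bm.block_response[where y = ?y, OF _ _ _ k])
      fix k assume k: "k < \<eta>"
      show "X k = a1 $ k * (c * c1 m1 l) + (\<Sum>j<\<eta>. bm.b1 k j * (?y j + noiseW1 g (l * \<eta> + j)))"
        using k ls.chanX_block(1)[OF l k, of c1 c2 m1 m2 g] by (simp add: X_def)
      show "X (\<eta> + k) = a2 $ k * (c * c2 m2 l) + (\<Sum>j<\<eta>. bm.b2 k j * (?y j + noiseW2 g (l * \<eta> + j)))"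
        using k ls.chanX_block(2)[OF l k, of c1 c2 m1 m2 g] by (simp add: X_def)
      show "?y k = X k + X (\<eta> + k) + noiseZ g (l * \<eta> + k)"
        using k ls.outs_block[of L c1 c2 m1 m2 g "l * \<eta> + k"] by (simp add: X_def)
    qed
    have g: "(noiseZ g t, noiseW1 g t, noiseW2 g t) = g t" for t
      by (simp add: noiseZ_def noiseW1_def noiseW2_def)
    have "X i = ?x1 i" "X (\<eta> + i) = ?x2 i" using i by (auto simp: X_def)
    thus ?thesis using X[OF _ refl refl, of i] X[OF _ refl refl, of "\<eta> + i"] i
      unfolding g blin_def by (simp add: mult_ac)
  qed
  \<comment> \<open>Chosen such that \<open>(1 + \<kappa>) * c\<^sup>2\<close> is one: the power
    saved by scaling the letters is exactly the margin for the deviation of the codebooks.\<close>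
  define \<kappa> where "\<kappa> = 1 / c\<^sup>2 - 1"
  have \<kappa>: "0 < \<kappa>" using c by (simp add: \<kappa>_def power_less_one_iff)
  have \<kappa>c: "(1 + \<kappa>) * (\<Sum>i<\<eta>. (c * p i)\<^sup>2 + (c * q i)\<^sup>2) = (\<Sum>i<\<eta>. (p i)\<^sup>2 + (q i)\<^sup>2)" for p q
  proof -
    have "(\<Sum>i<\<eta>. (c * p i)\<^sup>2 + (c * q i)\<^sup>2) = c\<^sup>2 * (\<Sum>i<\<eta>. (p i)\<^sup>2 + (q i)\<^sup>2)"
      by (simp add: sum_distrib_left power_mult_distrib distrib_left)
    thus ?thesis using c by (simp add: \<kappa>_def)
  qed
  have p12: "(\<Sum>i<\<eta>. Sigma_mat \<eta> N s1 s2 r a1 a2 B1 B2 $$ (i, i)) \<le> real \<eta> * P1"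
    "(\<Sum>i<\<eta>. Sigma_mat \<eta> N s1 s2 r a1 a2 B1 B2 $$ (\<eta> + i, \<eta> + i)) \<le> real \<eta> * P2"
    using pow by (auto simp: power_ok_def Let_def)
  have pow1: "(1 + \<kappa>) * (\<Sum>i<\<eta>. (c * bm.pc i)\<^sup>2 + (c * bm.qc i)\<^sup>2)
     + (\<Sum>i<\<eta>. \<Sum>j<\<eta>. ncov N s1 s2 r (bm.zc i j) (bm.wc1 i j) (bm.wc2 i j) (bm.zc i j) (bm.wc1 i j) (bm.wc2 i j)) \<le> real \<eta> * P1"
  proof -
    have "(\<Sum>i<\<eta>. Sigma_mat \<eta> N s1 s2 r a1 a2 B1 B2 $$ (i, i)) = (\<Sum>i<\<eta>. ((bm.pc i)\<^sup>2 + (bm.qc i)\<^sup>2)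
      + (\<Sum>j<\<eta>. ncov N s1 s2 r (bm.zc i j) (bm.wc1 i j) (bm.wc2 i j) (bm.zc i j) (bm.wc1 i j) (bm.wc2 i j)))"
      by (intro sum.cong refl bm.Sigma_diag) simp
    thus ?thesis using p12(1) unfolding \<kappa>c by (simp only: sum.distrib)
  qed
  have pow2: "(1 + \<kappa>) * (\<Sum>i<\<eta>. (c * bm.pc (\<eta> + i))\<^sup>2 + (c * bm.qc (\<eta> + i))\<^sup>2)
     + (\<Sum>i<\<eta>. \<Sum>j<\<eta>. ncov N s1 s2 r (bm.zc (\<eta> + i) j) (bm.wc1 (\<eta> + i) j) (bm.wc2 (\<eta> + i) j)
          (bm.zc (\<eta> + i) j) (bm.wc1 (\<eta> + i) j) (bm.wc2 (\<eta> + i) j)) \<le> real \<eta> * P2"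
  proof -
    have "(\<Sum>i<\<eta>. Sigma_mat \<eta> N s1 s2 r a1 a2 B1 B2 $$ (\<eta> + i, \<eta> + i)) = (\<Sum>i<\<eta>. ((bm.pc (\<eta> + i))\<^sup>2 + (bm.qc (\<eta> + i))\<^sup>2)
      + (\<Sum>j<\<eta>. ncov N s1 s2 r (bm.zc (\<eta> + i) j) (bm.wc1 (\<eta> + i) j) (bm.wc2 (\<eta> + i) j)
          (bm.zc (\<eta> + i) j) (bm.wc1 (\<eta> + i) j) (bm.wc2 (\<eta> + i) j)))"
      by (intro sum.cong refl bm.Sigma_diag) simp
    thus ?thesis using p12(2) unfolding \<kappa>c[of "\<lambda>i. bm.pc (\<eta> + i)" "\<lambda>i. bm.qc (\<eta> + i)"] by (simp only: sum.distrib)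
  qed
  show ?thesis
    by (rule ls.codes_exist[OF resp[THEN conjunct1] resp[THEN conjunct2] \<kappa> pow1 pow2 less_imp_le[OF P(1)] less_imp_le[OF P(2)] rate])
qed

theorem mainTheorem1:
  fixes P1 P2 N \<sigma>1 \<sigma>2 \<rho> :: real
  assumes "0 < P1" and "0 < P2" and "0 < N"
    and "0 \<le> \<sigma>1" and "0 \<le> \<sigma>2" and "-1 \<le> \<rho>" and "\<rho> \<le> 1"
  shows "R_region P1 P2 N \<sigma>1 \<sigma>2 \<rho> \<subseteq> C_NoisyFB P1 P2 N \<sigma>1 \<sigma>2 \<rho>"
proof
  fix R assume R: "R \<in> R_region P1 P2 N \<sigma>1 \<sigma>2 \<rho>"
  obtain R1 R2 where R12: "R = (R1, R2)" by (cases R)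
  have \<rho>: "\<rho>\<^sup>2 \<le> 1" using assms(6,7) by (simp add: abs_square_le_1 abs_le_iff)
  have "\<exists>k1 k2 :: nat \<Rightarrow> nat. \<exists>f1 f2 :: nat \<Rightarrow> nat \<Rightarrow> nat \<Rightarrow> (nat \<Rightarrow> real) \<Rightarrow> real.
     \<exists>dec :: nat \<Rightarrow> (nat \<Rightarrow> real) \<Rightarrow> nat \<times> nat. \<exists>n0.
       (\<forall>n\<ge>n0. is_code P1 P2 N \<sigma>1 \<sigma>2 \<rho> n (k1 n) (k2 n) (f1 n) (f2 n) (dec n) \<and>
                ln (real (k1 n)) / real n > R1 - \<delta> \<and> ln (real (k2 n)) / real n > R2 - \<delta>) \<and>
       (\<lambda>n. err_prob N \<sigma>1 \<sigma>2 \<rho> n (k1 n) (k2 n) (f1 n) (f2 n) (dec n)) \<longlonglongrightarrow> 0" if \<delta>: "\<delta> > 0" for \<delta>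
  proof -
    \<comment> \<open>One half of \<open>\<delta>\<close> pays for the distance to the union whose
      closure is taken, the other for the rate of the codes; the first also makes the rate bounds
      strict.\<close>
    have "\<delta> / 2 > 0" using \<delta> by simp
    obtain S where S: "dist S R < \<delta> / 2"
      and S': "S \<in> \<Union> {region_eta \<eta> N \<sigma>1 \<sigma>2 \<rho> a1 a2 B1 B2 C | \<eta> a1 a2 B1 B2 C.
       0 < \<eta> \<and> a1 \<in> carrier_vec \<eta> \<and> a2 \<in> carrier_vec \<eta> \<and>
       strictly_lower \<eta> B1 \<and> strictly_lower \<eta> B2 \<and> C \<in> carrier_mat 2 \<eta> \<and>
       power_ok \<eta> P1 P2 N \<sigma>1 \<sigma>2 \<rho> a1 a2 B1 B2}"
      using R[unfolded R_region_def closure_approachable, rule_format, OF \<open>\<delta> / 2 > 0\<close>] by (elim bexE) (rule that)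
    obtain S1 S2 where S12: "S = (S1, S2)" by (cases S)
    from S' obtain \<eta> a1 a2 B1 B2 C where eta: "0 < \<eta>" and a: "a1 \<in> carrier_vec \<eta>" "a2 \<in> carrier_vec \<eta>"
      and B: "strictly_lower \<eta> B1" "strictly_lower \<eta> B2" and C: "C \<in> carrier_mat 2 \<eta>"
      and pow: "power_ok \<eta> P1 P2 N \<sigma>1 \<sigma>2 \<rho> a1 a2 B1 B2"
      and mem: "(S1, S2) \<in> region_eta \<eta> N \<sigma>1 \<sigma>2 \<rho> a1 a2 B1 B2 C"
      unfolding S12 by blast
    have "\<bar>S1 - R1\<bar> < \<delta> / 2" "\<bar>S2 - R2\<bar> < \<delta> / 2"
      using S dist_fst_le[of S R] dist_snd_le[of S R] by (simp_all add: S12 R12 dist_real_def)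
    hence lt: "R1 - \<delta> < S1 - \<delta> / 2" "R2 - \<delta> < S2 - \<delta> / 2" by linarith+
    from region_eta_codes[OF assms(1-3) \<rho> eta a B C pow mem \<open>\<delta> / 2 > 0\<close>]
    obtain k1 k2 f1 f2 dec n0 where
      code: "\<forall>n\<ge>n0. is_code P1 P2 N \<sigma>1 \<sigma>2 \<rho> n (k1 n) (k2 n) (f1 n) (f2 n) (dec n) \<and>
                ln (real (k1 n)) / real n \<ge> S1 - \<delta> / 2 \<and> ln (real (k2 n)) / real n \<ge> S2 - \<delta> / 2"
      and err: "(\<lambda>n. err_prob N \<sigma>1 \<sigma>2 \<rho> n (k1 n) (k2 n) (f1 n) (f2 n) (dec n)) \<longlonglongrightarrow> 0"
      by (elim exE conjE) (rule that)
    from code have "\<forall>n\<ge>n0. is_code P1 P2 N \<sigma>1 \<sigma>2 \<rho> n (k1 n) (k2 n) (f1 n) (f2 n) (dec n) \<and>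
                ln (real (k1 n)) / real n > R1 - \<delta> \<and> ln (real (k2 n)) / real n > R2 - \<delta>"
      using lt by (meson less_le_trans)
    with err show ?thesis
      by - (rule exI[of _ k1], rule exI[of _ k2], rule exI[of _ f1], rule exI[of _ f2], rule exI[of _ dec],
          rule exI[of _ n0], rule conjI)
  qed
  thus "R \<in> C_NoisyFB P1 P2 N \<sigma>1 \<sigma>2 \<rho>" unfolding R12 C_NoisyFB_def mem_Collect_eq prod.case by (intro allI impI)
qed

end
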